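(* Let $\mathbb X$ be a virtual equipment and let $j\colon A\to E$ be a tight-cell in $\mathbb X$. There is an isomorphism of categories $\mathbf{RMnd}(j)\cong\mathbf{Mon}(\mathbb X[j])$ between the category of $j$-relative monads and the category of monoids in the associative-normal left-skew-multicategory $\mathbb X[j]$, commuting with the forgetful functors $U_j\colon\mathbf{RMnd}(j)\to\mathbb X[A,E]$ and $U_{\mathbb X[j]}\colon\mathbf{Mon}(\mathbb X[j])\to\mathbb X[A,E]$.
   Context: Virtual equipments. A virtual double category has objects; a category of tight-cells $f\colon A\to B$ (the composite of $f\colon A\to B$ and $g\colon B\to C$ is $gf$); loose-cells $p\colon A\nrightarrow B$; and 2-cells, each having as frame a chain of loose-cells $p_1\colon A_1\nrightarrow A_0,\dots,p_n\colon A_n\nrightarrow A_{n-1}$ ($n\ge 0$; chains are always listed in this order), a loose-cell $q\colon B_n\nrightarrow B_0$, and tight-cells $f_0\colon A_0\to B_0$ (left) and $f_n\colon A_n\to B_n$ (right); 2-cells have identities and associative unital multicategory-style composition. $\phi\colon p_1,\dots,p_n\Rightarrow q$ denotes a 2-cell whose tight-cells are identities; $(\phi_1,\dots,\phi_n)$ denotes juxtaposition. A 2-cell $q_1,\dots,q_m\Rightarrow q$ is opcartesian if every 2-cell (with any tight-cells) with domain $p_1,\dots,p_l,q_1,\dots,q_m,r_1,\dots,r_n$ factors uniquely through it; then $q$ is the loose-composite $q_1\odot\cdots\odot q_m$ (the loose-identity $A(1,1)\colon A\nrightarrow A$ if $m=0$). A unary 2-cell from $p$ to $q$ with left $f$ and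 right $g$ is cartesian if every 2-cell into $q$ with left $ff'$ and right $gg'$ factors uniquely through it via a 2-cell with left $f'$ and right $g'$; then $p$ is the restriction $q(f,g)$. A virtual equipment has all loose-identities and restrictions. Write $E(f,g):=E(1,1)(f,g)$; for $f\colon D\to E$, $g\colon A\to E$ it is a loose-cell $A\nrightarrow D$. The canonical isomorphisms $q(f,g)\cong C(f,1)\odot q\odot B(1,g)$ are used implicitly. A 2-cell $f\Rightarrow g$ between tight-cells $A\to B$ is equivalently a 2-cell $B(1,f)\Rightarrow B(1,g)$, or $B(g,1)\Rightarrow B(f,1)$, or $()\Rightarrow B(f,g)$; $\mathbb X[A,B]$ is the category of tight-cells $A\to B$ and such 2-cells. Restriction is functorial in 2-cells (contravariantly in the first argument, covariantly in the second). For $f\colon A\to B$, $\frown_f\colon ()\Rightarrow B(f,f)$ (corresponding to $1_f$) and $\smile_f\colon B(1,f),B(f,1)\Rightarrow B(1,1)$ are the canonical 2-cells (unit and counit of the adjunction $B(1,f)\dashv B(f,1)$). $\phi(f,g)$ denotes the 2-cell obtained from $\phi$ by restricting along $f$ on the left and $g$ on the right; e.g. $\smile_t(x,y)\colon E(x,t),E(t,y)\Rightarrow E(x,y)$ is composition. Relative monads. A $j$-relative monad $(t,\dagger,\eta)$ comprises a tight-cell $t\colon A\to E$, a 2-cell $\dagger\colon E(j,t)\Rightarrow E(t,t)$ and a 2-cell $\eta\colon j\Rightarrow t$ such that: (i) $E(\eta,t)\circ\dagger=1_{E(j,t)}$; (ii) $\dagger\circ E(j,\eta)\circ\frown_j=\frown_t$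 as 2-cells $()\Rightarrow E(t,t)$; (iii) the following two 2-cells $E(j,t),E(j,t)\Rightarrow E(t,t)$ are equal: $(\dagger,\dagger)$ followed by $\smile_t(t,t)$; and $(1,\dagger)$ followed by $\smile_t(j,t)\colon E(j,t),E(t,t)\Rightarrow E(j,t)$ followed by $\dagger$. A morphism $(t,\dagger,\eta)\to(t',\dagger',\eta')$ is a 2-cell $\tau\colon t\Rightarrow t'$ with $\tau\circ\eta=\eta'$ and $E(t,\tau)\circ\dagger=E(\tau,t')\circ\dagger'\circ E(j,\tau)$. These form $\mathbf{RMnd}(j)$; $U_j$ sends $(t,\dagger,\eta)$ to $t$. The skew-multicategory $\mathbb X[j]$. An associative-normal left-skew-multicategory is like a multicategory without nullary multimorphisms, except that the domain of a multimorphism is a nonempty list whose entries are objects or copies of a formal marker $\bullet$ (composition substitutes only at object entries), equipped with left-unitor functions $\lambda_{(\vec X;Y),k}$ inserting a $\bullet$ immediately after the $k$-th entry of an $n$-entry domain ($0\le k<n$) and right-unitor functions $\rho_{(\vec X;Y),k}$ deleting a $\bullet$ occurring immediately after the $k$-th entry ($0<k\le n$), compatible with composition and with themselves, and with $\rho_k\circ\lambda_k=1$ for $0<k<n$. $\mathbb X[j]$ has as objects the tight-cells $A\to E$ (identified with the representable loose-cells $E(1,t)\colon A\nrightarrow E$). A multimorphism $x_1,\dots,x_n\to s$ is a 2-cell $p_1,E(j,1),p_2,E(j,1),\dots,E(j,1),p_n\Rightarrow E(1,s)$ where $p_i=E(1,t_i)$ if $x_i=t_i$ is a tight-cell and $p_i=E(1,j)$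 if $x_i=\bullet$. Composition is that of 2-cells; $\lambda$ is given by pasting $\smile_j\colon E(1,j),E(j,1)\Rightarrow E(1,1)$, and $\rho$ by pasting $\frown_j\colon ()\Rightarrow E(j,1)\odot E(1,j)$. Monoids. A monoid in an associative-normal left-skew-multicategory comprises an object $M$, a multimorphism $m\colon M,M\to M$ and a multimorphism $u\colon\bullet\to M$ such that $m\circ(u,1_M)=\lambda_{(M;M),0}(1_M)$, $\rho_{(M;M),1}(m\circ(1_M,u))=1_M$ and $m\circ(m,1_M)=m\circ(1_M,m)$. A homomorphism $(M,m,u)\to(M',m',u')$ is a unary multimorphism $f\colon M\to M'$ with $f\circ u=u'$ and $f\circ m=m'\circ(f,f)$. $\mathbf{Mon}(-)$ is the category of monoids, and $U_{\mathbb X[j]}$ sends a monoid to its carrier. *)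

theory Defs
  imports Main
begin

section \<open>Categories, functors and isomorphisms of categories\<close>

text \<open>Hom-sets need not be disjoint: the same element may occur in several of them, so the
  action of a functor on morphisms also takes the source and the target as arguments.\<close>

record ('a, 'm) category =
  cat_ob :: "'a set"
  cat_hom :: "'a \<Rightarrow> 'a \<Rightarrow> 'm set"
  cat_id :: "'a \<Rightarrow> 'm"
  cat_comp :: "'m \<Rightarrow> 'm \<Rightarrow> 'm"

locale is_category =
  fixes C :: "('a, 'm) category"
  assumes id_in_hom: "a \<in> cat_ob C \<Longrightarrow> cat_id C a \<in> cat_hom C a a"
    and comp_in_hom: "\<lbrakk>a \<in> cat_ob C; b \<in> cat_ob C; c \<in> cat_ob C;
        f \<in> cat_hom C a b; g \<in> cat_hom C b c\<rbrakk> \<Longrightarrow> cat_comp C g f \<in> cat_hom C a c"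
    and comp_id: "\<lbrakk>a \<in> cat_ob C; b \<in> cat_ob C; f \<in> cat_hom C a b\<rbrakk> \<Longrightarrow> cat_comp C f (cat_id C a) = f"
    and id_comp: "\<lbrakk>a \<in> cat_ob C; b \<in> cat_ob C; f \<in> cat_hom C a b\<rbrakk> \<Longrightarrow> cat_comp C (cat_id C b) f = f"
    and comp_assoc: "\<lbrakk>a \<in> cat_ob C; b \<in> cat_ob C; c \<in> cat_ob C; d \<in> cat_ob C;
        f \<in> cat_hom C a b; g \<in> cat_hom C b c; h \<in> cat_hom C c d\<rbrakk> \<Longrightarrow>
        cat_comp C h (cat_comp C g f) = cat_comp C (cat_comp C h g) f"

record ('a, 'm, 'b, 'n) functor_data =
  fun_ob :: "'a \<Rightarrow> 'b"
  fun_hom :: "'a \<Rightarrow> 'a \<Rightarrow> 'm \<Rightarrow> 'n"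

locale is_functor = is_category C + D: is_category D
  for C :: "('a, 'm) category" and D :: "('b, 'n) category" +
  fixes F :: "('a, 'm, 'b, 'n) functor_data"
  assumes ob_in_ob: "a \<in> cat_ob C \<Longrightarrow> fun_ob F a \<in> cat_ob D"
    and hom_in_hom: "\<lbrakk>a \<in> cat_ob C; b \<in> cat_ob C; f \<in> cat_hom C a b\<rbrakk> \<Longrightarrow>
        fun_hom F a b f \<in> cat_hom D (fun_ob F a) (fun_ob F b)"
    and preserves_id: "a \<in> cat_ob C \<Longrightarrow> fun_hom F a a (cat_id C a) = cat_id D (fun_ob F a)"
    and preserves_comp: "\<lbrakk>a \<in> cat_ob C; b \<in> cat_ob C; c \<in> cat_ob C;
        f \<in> cat_hom C a b; g \<in> cat_hom C b c\<rbrakk> \<Longrightarrow>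
        fun_hom F a c (cat_comp C g f) = cat_comp D (fun_hom F b c g) (fun_hom F a b f)"

definition functor_id :: "('a, 'm, 'a, 'm) functor_data" where
  "functor_id = \<lparr>fun_ob = (\<lambda>a. a), fun_hom = (\<lambda>a b f. f)\<rparr>"

definition functor_comp ::
  "('b, 'n, 'c, 'k) functor_data \<Rightarrow> ('a, 'm, 'b, 'n) functor_data \<Rightarrow> ('a, 'm, 'c, 'k) functor_data" where
  "functor_comp G F = \<lparr>fun_ob = (\<lambda>a. fun_ob G (fun_ob F a)),
     fun_hom = (\<lambda>a b f. fun_hom G (fun_ob F a) (fun_ob F b) (fun_hom F a b f))\<rparr>"

text \<open>Equality of functors from \<open>C\<close> to \<open>D\<close>: the values at arguments that do not belong to \<open>C\<close> are
  irrelevant.\<close>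

definition functor_eq ::
  "('a, 'm) category \<Rightarrow> ('b, 'n) category \<Rightarrow> ('a, 'm, 'b, 'n) functor_data \<Rightarrow> ('a, 'm, 'b, 'n) functor_data \<Rightarrow> bool"
  where "functor_eq C D F G \<longleftrightarrow> is_functor C D F \<and> is_functor C D G \<and>
    (\<forall>a\<in>cat_ob C. fun_ob F a = fun_ob G a) \<and>
    (\<forall>a\<in>cat_ob C. \<forall>b\<in>cat_ob C. \<forall>f\<in>cat_hom C a b. fun_hom F a b f = fun_hom G a b f)"

definition category_iso ::
  "('a, 'm) category \<Rightarrow> ('b, 'n) category \<Rightarrow> ('a, 'm, 'b, 'n) functor_data \<Rightarrow> bool" where
  "category_iso C D F \<longleftrightarrow> is_functor C D F \<and>
    (\<exists>G. is_functor D C G \<and> functor_eq C C (functor_comp G F) functor_id \<and>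
         functor_eq D D (functor_comp F G) functor_id)"


section \<open>Virtual double categories\<close>

text \<open>
  A loose-cell \<open>p: A \<rightarrow> B\<close> has \<open>loose_src p = A\<close> and \<open>loose_tgt p = B\<close>.  A 2-cell \<open>\<phi>\<close> has domain
  the chain \<open>cell_dom \<phi>\<close>, codomain \<open>cell_cod \<phi>\<close>, and the left and right tight-cells
  \<open>cell_left \<phi>\<close> and \<open>cell_right \<phi>\<close>.

  \<open>cell_comp X \<psi> f [\<phi>\<^sub>1, \<dots>, \<phi>\<^sub>m]\<close> is the composite of \<open>\<psi>\<close> with a chain of \<open>m\<close> juxtaposed 2-cells
  whose left-most tight-cell is \<open>f\<close>.  When \<open>m > 0\<close> the argument \<open>f\<close> is just the left tight-cell of
  \<open>\<phi>\<^sub>1\<close>; when \<open>m = 0\<close> the chain consists of the tight-cell \<open>f\<close> alone, and the composite is the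
  nullary 2-cell \<open>\<psi>\<close> whiskered by \<open>f\<close>.
\<close>

record ('o, 't, 'l, 'c) vdc =
  objects :: "'o set"
  tight :: "'t set"
  tight_dom :: "'t \<Rightarrow> 'o"
  tight_cod :: "'t \<Rightarrow> 'o"
  tight_id :: "'o \<Rightarrow> 't"
  tight_comp :: "'t \<Rightarrow> 't \<Rightarrow> 't"
  loose :: "'l set"
  loose_src :: "'l \<Rightarrow> 'o"
  loose_tgt :: "'l \<Rightarrow> 'o"
  cells :: "'c set"
  cell_dom :: "'c \<Rightarrow> 'l list"
  cell_cod :: "'c \<Rightarrow> 'l"
  cell_left :: "'c \<Rightarrow> 't"
  cell_right :: "'c \<Rightarrow> 't"
  cell_id :: "'l \<Rightarrow> 'c"
  cell_comp :: "'c \<Rightarrow> 't \<Rightarrow> 'c list \<Rightarrow> 'c"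

text \<open>\<open>loose_chain X a [p\<^sub>1, \<dots>, p\<^sub>n] b\<close>: \<open>p\<^sub>i : A\<^sub>i \<rightarrow> A\<^sub>i\<^sub>-\<^sub>1\<close> with \<open>A\<^sub>0 = a\<close> and \<open>A\<^sub>n = b\<close>.\<close>

fun loose_chain :: "('o, 't, 'l, 'c, 'z) vdc_scheme \<Rightarrow> 'o \<Rightarrow> 'l list \<Rightarrow> 'o \<Rightarrow> bool" where
  "loose_chain X a [] b \<longleftrightarrow> a \<in> objects X \<and> a = b"
| "loose_chain X a (p # ps) b \<longleftrightarrow> p \<in> loose X \<and> loose_tgt X p = a \<and> loose_chain X (loose_src X p) ps b"

fun cell_chain :: "('o, 't, 'l, 'c, 'z) vdc_scheme \<Rightarrow> 't \<Rightarrow> 'c list \<Rightarrow> 't \<Rightarrow> bool" where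
  "cell_chain X f [] g \<longleftrightarrow> f \<in> tight X \<and> f = g"
| "cell_chain X f (\<phi> # \<phi>s) g \<longleftrightarrow> \<phi> \<in> cells X \<and> cell_left X \<phi> = f \<and> cell_chain X (cell_right X \<phi>) \<phi>s g"

definition last_tight :: "('o, 't, 'l, 'c, 'z) vdc_scheme \<Rightarrow> 't \<Rightarrow> 'c list \<Rightarrow> 't" where
  "last_tight X f \<phi>s = (if \<phi>s = [] then f else cell_right X (last \<phi>s))"

text \<open>The chain of the composites of the members of a chain of 2-cells with the consecutive blocks of
  another chain whose left-most tight-cell is \<open>f\<close>.\<close>

fun chain_comp :: "('o, 't, 'l, 'c, 'z) vdc_scheme \<Rightarrow> 't \<Rightarrow> 'c list \<Rightarrow> 'c list list \<Rightarrow> 'c list" where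
  "chain_comp X f (\<psi> # \<psi>s) (\<phi>s # \<phi>ss) =
     cell_comp X \<psi> f \<phi>s # chain_comp X (last_tight X f \<phi>s) \<psi>s \<phi>ss"
| "chain_comp X f _ _ = []"

locale virtual_double_category =
  fixes X :: "('o, 't, 'l, 'c, 'z) vdc_scheme"
  assumes tight_dom_ob: "f \<in> tight X \<Longrightarrow> tight_dom X f \<in> objects X"
    and tight_cod_ob: "f \<in> tight X \<Longrightarrow> tight_cod X f \<in> objects X"
    and tight_id: "a \<in> objects X \<Longrightarrow>
        tight_id X a \<in> tight X \<and> tight_dom X (tight_id X a) = a \<and> tight_cod X (tight_id X a) = a"
    and tight_comp: "\<lbrakk>f \<in> tight X; g \<in> tight X; tight_cod X f = tight_dom X g\<rbrakk> \<Longrightarrow>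
        tight_comp X g f \<in> tight X \<and> tight_dom X (tight_comp X g f) = tight_dom X f \<and>
        tight_cod X (tight_comp X g f) = tight_cod X g"
    and tight_comp_id: "f \<in> tight X \<Longrightarrow> tight_comp X f (tight_id X (tight_dom X f)) = f"
    and tight_id_comp: "f \<in> tight X \<Longrightarrow> tight_comp X (tight_id X (tight_cod X f)) f = f"
    and tight_assoc: "\<lbrakk>f \<in> tight X; g \<in> tight X; h \<in> tight X;
        tight_cod X f = tight_dom X g; tight_cod X g = tight_dom X h\<rbrakk> \<Longrightarrow>
        tight_comp X h (tight_comp X g f) = tight_comp X (tight_comp X h g) f"
    and loose_src_ob: "p \<in> loose X \<Longrightarrow> loose_src X p \<in> objects X"
    and loose_tgt_ob: "p \<in> loose X \<Longrightarrow> loose_tgt X p \<in> objects X"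
    and cell_frame: "\<phi> \<in> cells X \<Longrightarrow>
        cell_left X \<phi> \<in> tight X \<and> cell_right X \<phi> \<in> tight X \<and>
        loose_chain X (tight_dom X (cell_left X \<phi>)) (cell_dom X \<phi>) (tight_dom X (cell_right X \<phi>)) \<and>
        cell_cod X \<phi> \<in> loose X \<and>
        loose_tgt X (cell_cod X \<phi>) = tight_cod X (cell_left X \<phi>) \<and>
        loose_src X (cell_cod X \<phi>) = tight_cod X (cell_right X \<phi>)"
    and cell_id: "p \<in> loose X \<Longrightarrow>
        cell_id X p \<in> cells X \<and> cell_dom X (cell_id X p) = [p] \<and> cell_cod X (cell_id X p) = p \<and>
        cell_left X (cell_id X p) = tight_id X (loose_tgt X p) \<and>
        cell_right X (cell_id X p) = tight_id X (loose_src X p)"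
    and cell_comp: "\<lbrakk>\<psi> \<in> cells X; cell_chain X f \<phi>s g; map (cell_cod X) \<phi>s = cell_dom X \<psi>;
        tight_cod X f = tight_dom X (cell_left X \<psi>)\<rbrakk> \<Longrightarrow>
        cell_comp X \<psi> f \<phi>s \<in> cells X \<and>
        cell_dom X (cell_comp X \<psi> f \<phi>s) = concat (map (cell_dom X) \<phi>s) \<and>
        cell_cod X (cell_comp X \<psi> f \<phi>s) = cell_cod X \<psi> \<and>
        cell_left X (cell_comp X \<psi> f \<phi>s) = tight_comp X (cell_left X \<psi>) f \<and>
        cell_right X (cell_comp X \<psi> f \<phi>s) = tight_comp X (cell_right X \<psi>) g"
    and cell_id_comp: "\<phi> \<in> cells X \<Longrightarrow> cell_comp X (cell_id X (cell_cod X \<phi>)) (cell_left X \<phi>) [\<phi>] = \<phi>"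
    and cell_comp_id: "\<phi> \<in> cells X \<Longrightarrow>
        cell_comp X \<phi> (tight_id X (tight_dom X (cell_left X \<phi>))) (map (cell_id X) (cell_dom X \<phi>)) = \<phi>"
    and cell_assoc: "\<lbrakk>\<chi> \<in> cells X;
        cell_chain X g \<psi>s g'; map (cell_cod X) \<psi>s = cell_dom X \<chi>; tight_cod X g = tight_dom X (cell_left X \<chi>);
        cell_chain X f (concat \<phi>ss) f'; map (map (cell_cod X)) \<phi>ss = map (cell_dom X) \<psi>s;
        tight_cod X f = tight_dom X g\<rbrakk> \<Longrightarrow>
        cell_comp X (cell_comp X \<chi> g \<psi>s) f (concat \<phi>ss) =
        cell_comp X \<chi> (tight_comp X g f) (chain_comp X f \<psi>s \<phi>ss)"

text \<open>The 2-cells \<open>p\<^sub>1, \<dots>, p\<^sub>n \<Rightarrow> q\<close> whose tight-cells are identities, and their composition.\<close>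

definition globular :: "('o, 't, 'l, 'c, 'z) vdc_scheme \<Rightarrow> 'l list \<Rightarrow> 'l \<Rightarrow> 'c set" where
  "globular X ps q = {\<phi> \<in> cells X. cell_dom X \<phi> = ps \<and> cell_cod X \<phi> = q \<and>
     cell_left X \<phi> = tight_id X (loose_tgt X q) \<and> cell_right X \<phi> = tight_id X (loose_src X q)}"

definition gcomp :: "('o, 't, 'l, 'c, 'z) vdc_scheme \<Rightarrow> 'c \<Rightarrow> 'c list \<Rightarrow> 'c" where
  "gcomp X \<psi> \<phi>s = cell_comp X \<psi> (tight_id X (loose_tgt X (cell_cod X \<psi>))) \<phi>s"

definition opcartesian :: "('o, 't, 'l, 'c, 'z) vdc_scheme \<Rightarrow> 'c \<Rightarrow> bool" where
  "opcartesian X \<phi> \<longleftrightarrow> \<phi> \<in> globular X (cell_dom X \<phi>) (cell_cod X \<phi>) \<and>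
    (\<forall>ps rs \<psi>. \<psi> \<in> cells X \<and> cell_dom X \<psi> = ps @ cell_dom X \<phi> @ rs \<and>
       loose_chain X (tight_dom X (cell_left X \<psi>)) ps (loose_tgt X (cell_cod X \<phi>)) \<longrightarrow>
       (\<exists>!\<chi>. \<chi> \<in> cells X \<and> cell_dom X \<chi> = ps @ [cell_cod X \<phi>] @ rs \<and> cell_cod X \<chi> = cell_cod X \<psi> \<and>
          cell_left X \<chi> = cell_left X \<psi> \<and> cell_right X \<chi> = cell_right X \<psi> \<and>
          cell_comp X \<chi> (tight_id X (tight_dom X (cell_left X \<psi>)))
            (map (cell_id X) ps @ [\<phi>] @ map (cell_id X) rs) = \<psi>))"

text \<open>\<open>\<chi>\<close> is a factorisation of \<open>\<psi>\<close> through the unary 2-cell \<open>\<phi>\<close>, with left \<open>f'\<close> and right \<open>g'\<close>.\<close>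

definition is_lift :: "('o, 't, 'l, 'c, 'z) vdc_scheme \<Rightarrow> 'c \<Rightarrow> 't \<Rightarrow> 't \<Rightarrow> 'c \<Rightarrow> 'c \<Rightarrow> bool" where
  "is_lift X \<phi> f' g' \<psi> \<chi> \<longleftrightarrow> \<chi> \<in> cells X \<and> cell_dom X \<chi> = cell_dom X \<psi> \<and> [cell_cod X \<chi>] = cell_dom X \<phi> \<and>
     cell_left X \<chi> = f' \<and> cell_right X \<chi> = g' \<and> cell_comp X \<phi> f' [\<chi>] = \<psi>"

definition cartesian :: "('o, 't, 'l, 'c, 'z) vdc_scheme \<Rightarrow> 'c \<Rightarrow> bool" where
  "cartesian X \<phi> \<longleftrightarrow> \<phi> \<in> cells X \<and> length (cell_dom X \<phi>) = 1 \<and>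
    (\<forall>f' g' \<psi>. f' \<in> tight X \<and> g' \<in> tight X \<and>
       tight_cod X f' = tight_dom X (cell_left X \<phi>) \<and> tight_cod X g' = tight_dom X (cell_right X \<phi>) \<and>
       \<psi> \<in> cells X \<and> cell_cod X \<psi> = cell_cod X \<phi> \<and>
       cell_left X \<psi> = tight_comp X (cell_left X \<phi>) f' \<and>
       cell_right X \<psi> = tight_comp X (cell_right X \<phi>) g' \<longrightarrow>
       (\<exists>!\<chi>. is_lift X \<phi> f' g' \<psi> \<chi>))"

definition lift :: "('o, 't, 'l, 'c, 'z) vdc_scheme \<Rightarrow> 'c \<Rightarrow> 't \<Rightarrow> 't \<Rightarrow> 'c \<Rightarrow> 'c" where
  "lift X \<phi> f' g' \<psi> = (THE \<chi>. is_lift X \<phi> f' g' \<psi> \<chi>)"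


section \<open>Virtual equipments\<close>

text \<open>
  Loose-identities and restrictions come with a choice, on which the notation \<open>q(f, g)\<close> depends:
  \<open>loose_id X a\<close> is \<open>a(1, 1)\<close>, with opcartesian 2-cell \<open>loose_id_cell X a\<close>, and \<open>restr X q f g\<close> is
  \<open>q(f, g)\<close>, with cartesian 2-cell \<open>restr_cell X q f g\<close>.  The choice is arbitrary; in particular
  \<open>q(1, 1)\<close> may differ from \<open>q\<close>.
\<close>

record ('o, 't, 'l, 'c) vequip = "('o, 't, 'l, 'c) vdc" +
  loose_id :: "'o \<Rightarrow> 'l"
  loose_id_cell :: "'o \<Rightarrow> 'c"
  restr :: "'l \<Rightarrow> 't \<Rightarrow> 't \<Rightarrow> 'l"
  restr_cell :: "'l \<Rightarrow> 't \<Rightarrow> 't \<Rightarrow> 'c"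

locale virtual_equipment = virtual_double_category X
  for X :: "('o, 't, 'l, 'c, 'z) vequip_scheme" +
  assumes loose_id: "a \<in> objects X \<Longrightarrow>
        loose_src X (loose_id X a) = a \<and> loose_tgt X (loose_id X a) = a \<and>
        loose_id_cell X a \<in> globular X [] (loose_id X a) \<and> opcartesian X (loose_id_cell X a)"
    and restriction: "\<lbrakk>q \<in> loose X; f \<in> tight X; g \<in> tight X;
        tight_cod X f = loose_tgt X q; tight_cod X g = loose_src X q\<rbrakk> \<Longrightarrow>
        cell_dom X (restr_cell X q f g) = [restr X q f g] \<and> cell_cod X (restr_cell X q f g) = q \<and>
        cell_left X (restr_cell X q f g) = f \<and> cell_right X (restr_cell X q f g) = g \<and>
        cartesian X (restr_cell X q f g)"

text \<open>The loose-cell \<open>E(f, g)\<close> and its cartesian 2-cell to the loose-identity \<open>E(1, 1)\<close>.\<close>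

definition rep :: "('o, 't, 'l, 'c, 'z) vequip_scheme \<Rightarrow> 't \<Rightarrow> 't \<Rightarrow> 'l" where
  "rep X f g = restr X (loose_id X (tight_cod X f)) f g"

definition rep_cell :: "('o, 't, 'l, 'c, 'z) vequip_scheme \<Rightarrow> 't \<Rightarrow> 't \<Rightarrow> 'c" where
  "rep_cell X f g = restr_cell X (loose_id X (tight_cod X f)) f g"

abbreviation dom_id :: "('o, 't, 'l, 'c, 'z) vequip_scheme \<Rightarrow> 't \<Rightarrow> 't" where
  "dom_id X f \<equiv> tight_id X (tight_dom X f)"

abbreviation cod_id :: "('o, 't, 'l, 'c, 'z) vequip_scheme \<Rightarrow> 't \<Rightarrow> 't" where
  "cod_id X f \<equiv> tight_id X (tight_cod X f)"

text \<open>\<open>E(1, f)\<close> and \<open>E(f, 1)\<close>\<close>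

abbreviation companion :: "('o, 't, 'l, 'c, 'z) vequip_scheme \<Rightarrow> 't \<Rightarrow> 'l" where
  "companion X f \<equiv> rep X (cod_id X f) f"

abbreviation conjoint :: "('o, 't, 'l, 'c, 'z) vequip_scheme \<Rightarrow> 't \<Rightarrow> 'l" where
  "conjoint X f \<equiv> rep X f (cod_id X f)"

text \<open>The 2-cells exhibiting \<open>E(f, g)\<close> as the restrictions \<open>E(1, g)(f, 1)\<close> and \<open>E(f, 1)(1, g)\<close>: the
  cartesian 2-cell \<open>E(f, g) \<Rightarrow> E(1, g)\<close> with left \<open>f\<close> and right \<open>1\<close>, and the cartesian 2-cell
  \<open>E(f, g) \<Rightarrow> E(f, 1)\<close> with left \<open>1\<close> and right \<open>g\<close>.\<close>

definition rep_cell_left :: "('o, 't, 'l, 'c, 'z) vequip_scheme \<Rightarrow> 't \<Rightarrow> 't \<Rightarrow> 'c" where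
  "rep_cell_left X f g = lift X (rep_cell X (cod_id X g) g) f (dom_id X g) (rep_cell X f g)"

definition rep_cell_right :: "('o, 't, 'l, 'c, 'z) vequip_scheme \<Rightarrow> 't \<Rightarrow> 't \<Rightarrow> 'c" where
  "rep_cell_right X f g = lift X (rep_cell X f (cod_id X f)) (dom_id X f) g (rep_cell X f g)"

text \<open>The unitor \<open>B(1, 1), q \<Rightarrow> q\<close> for \<open>q : A \<rightarrow> B\<close>.\<close>

definition loose_unitor :: "('o, 't, 'l, 'c, 'z) vequip_scheme \<Rightarrow> 'l \<Rightarrow> 'c" where
  "loose_unitor X q = (THE \<chi>. \<chi> \<in> globular X [loose_id X (loose_tgt X q), q] q \<and>
     gcomp X \<chi> [loose_id_cell X (loose_tgt X q), cell_id X q] = cell_id X q)"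

text \<open>\<open>frown X f\<close> is \<open>() \<Rightarrow> E(f, f)\<close>: the 2-cell \<open>() \<Rightarrow> E(1, 1)\<close> with left and right \<open>f\<close> obtained from
  the unit of \<open>E(1, 1)\<close>, factored through \<open>E(f, f)\<close>.  \<open>smile X f\<close> is \<open>E(1, f), E(f, 1) \<Rightarrow> E(1, 1)\<close>, and
  \<open>smile_at X f x y\<close> is its restriction \<open>E(x, f), E(f, y) \<Rightarrow> E(x, y)\<close> along \<open>x\<close> and \<open>y\<close>.\<close>

definition frown :: "('o, 't, 'l, 'c, 'z) vequip_scheme \<Rightarrow> 't \<Rightarrow> 'c" where
  "frown X f = lift X (rep_cell X f f) (dom_id X f) (dom_id X f)
     (cell_comp X (loose_id_cell X (tight_cod X f)) f [])"

definition smile :: "('o, 't, 'l, 'c, 'z) vequip_scheme \<Rightarrow> 't \<Rightarrow> 'c" where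
  "smile X f = gcomp X (loose_unitor X (loose_id X (tight_cod X f)))
     [rep_cell X (cod_id X f) f, rep_cell X f (cod_id X f)]"

definition smile_at :: "('o, 't, 'l, 'c, 'z) vequip_scheme \<Rightarrow> 't \<Rightarrow> 't \<Rightarrow> 't \<Rightarrow> 'c" where
  "smile_at X f x y = lift X (rep_cell X x y) (dom_id X x) (dom_id X y)
     (cell_comp X (smile X f) x [rep_cell_left X x f, rep_cell_right X f y])"


section \<open>The category of tight-cells and functoriality of restriction\<close>

text \<open>A 2-cell \<open>f \<Rightarrow> g\<close> between tight-cells \<open>A \<rightarrow> B\<close> is represented as a 2-cell \<open>B(1, f) \<Rightarrow> B(1, g)\<close>.\<close>

definition tight_hom :: "('o, 't, 'l, 'c, 'z) vequip_scheme \<Rightarrow> 'o \<Rightarrow> 'o \<Rightarrow> 't set" where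
  "tight_hom X a b = {f \<in> tight X. tight_dom X f = a \<and> tight_cod X f = b}"

definition tight_cells2 :: "('o, 't, 'l, 'c, 'z) vequip_scheme \<Rightarrow> 't \<Rightarrow> 't \<Rightarrow> 'c set" where
  "tight_cells2 X f g = globular X [companion X f] (companion X g)"

definition tight_cat :: "('o, 't, 'l, 'c, 'z) vequip_scheme \<Rightarrow> 'o \<Rightarrow> 'o \<Rightarrow> ('t, 'c) category" where
  "tight_cat X a b = \<lparr>cat_ob = tight_hom X a b, cat_hom = tight_cells2 X,
     cat_id = (\<lambda>f. cell_id X (companion X f)), cat_comp = (\<lambda>\<beta> \<alpha>. gcomp X \<beta> [\<alpha>])\<rparr>"

text \<open>For \<open>\<alpha> : g \<Rightarrow> g'\<close>, the 2-cell \<open>E(f, \<alpha>) : E(f, g) \<Rightarrow> E(f, g')\<close> is the restriction along \<open>f\<close> of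
  \<open>\<alpha> : E(1, g) \<Rightarrow> E(1, g')\<close>.\<close>

definition rep_covariant ::
  "('o, 't, 'l, 'c, 'z) vequip_scheme \<Rightarrow> 't \<Rightarrow> 't \<Rightarrow> 't \<Rightarrow> 'c \<Rightarrow> 'c" where
  "rep_covariant X f g g' \<alpha> = lift X (rep_cell_left X f g') (dom_id X f) (dom_id X g')
     (cell_comp X \<alpha> f [rep_cell_left X f g])"

text \<open>The forms \<open>() \<Rightarrow> E(f, f')\<close> and \<open>E(f', 1) \<Rightarrow> E(f, 1)\<close> of \<open>\<alpha> : f \<Rightarrow> f'\<close>.\<close>

definition nullary_form :: "('o, 't, 'l, 'c, 'z) vequip_scheme \<Rightarrow> 't \<Rightarrow> 't \<Rightarrow> 'c \<Rightarrow> 'c" where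
  "nullary_form X f f' \<alpha> = gcomp X (rep_covariant X f f f' \<alpha>) [frown X f]"

definition conjoint_form :: "('o, 't, 'l, 'c, 'z) vequip_scheme \<Rightarrow> 't \<Rightarrow> 't \<Rightarrow> 'c \<Rightarrow> 'c" where
  "conjoint_form X f f' \<alpha> =
     gcomp X (smile_at X f' f (cod_id X f)) [nullary_form X f f' \<alpha>, cell_id X (conjoint X f')]"

text \<open>For \<open>\<alpha> : f \<Rightarrow> f'\<close>, the 2-cell \<open>E(\<alpha>, g) : E(f', g) \<Rightarrow> E(f, g)\<close> is the restriction along \<open>g\<close> of
  \<open>E(f', 1) \<Rightarrow> E(f, 1)\<close>.\<close>

definition rep_contravariant ::
  "('o, 't, 'l, 'c, 'z) vequip_scheme \<Rightarrow> 't \<Rightarrow> 't \<Rightarrow> 'c \<Rightarrow> 't \<Rightarrow> 'c" where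
  "rep_contravariant X f f' \<alpha> g = lift X (rep_cell_right X f g) (dom_id X f) (dom_id X g)
     (gcomp X (conjoint_form X f f' \<alpha>) [rep_cell_right X f' g])"


section \<open>Relative monads\<close>

record ('t, 'c) rel_monad =
  rm_cell :: 't
  rm_ext :: 'c
  rm_unit :: 'c

definition relative_monad :: "('o, 't, 'l, 'c, 'z) vequip_scheme \<Rightarrow> 't \<Rightarrow> ('t, 'c) rel_monad \<Rightarrow> bool" where
  "relative_monad X j T \<longleftrightarrow> (let t = rm_cell T; d = rm_ext T; \<eta> = rm_unit T in
     t \<in> tight_hom X (tight_dom X j) (tight_cod X j) \<and>
     d \<in> globular X [rep X j t] (rep X t t) \<and>
     \<eta> \<in> tight_cells2 X j t \<and>
     gcomp X (rep_contravariant X j t \<eta> t) [d] = cell_id X (rep X j t) \<and>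
     gcomp X d [gcomp X (rep_covariant X j j t \<eta>) [frown X j]] = frown X t \<and>
     gcomp X (smile_at X t t t) [d, d] =
       gcomp X d [gcomp X (smile_at X t j t) [cell_id X (rep X j t), d]])"

definition relative_monad_hom ::
  "('o, 't, 'l, 'c, 'z) vequip_scheme \<Rightarrow> 't \<Rightarrow> ('t, 'c) rel_monad \<Rightarrow> ('t, 'c) rel_monad \<Rightarrow> 'c set" where
  "relative_monad_hom X j T T' =
     (let t = rm_cell T; d = rm_ext T; \<eta> = rm_unit T; t' = rm_cell T'; d' = rm_ext T'; \<eta>' = rm_unit T' in
     {\<tau> \<in> tight_cells2 X t t'. gcomp X \<tau> [\<eta>] = \<eta>' \<and>
        gcomp X (rep_covariant X t t t' \<tau>) [d] =
        gcomp X (rep_contravariant X t t' \<tau> t') [gcomp X d' [rep_covariant X j t t' \<tau>]]})"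

definition RMnd :: "('o, 't, 'l, 'c, 'z) vequip_scheme \<Rightarrow> 't \<Rightarrow> (('t, 'c) rel_monad, 'c) category" where
  "RMnd X j = \<lparr>cat_ob = {T. relative_monad X j T}, cat_hom = relative_monad_hom X j,
     cat_id = (\<lambda>T. cell_id X (companion X (rm_cell T))), cat_comp = (\<lambda>\<beta> \<alpha>. gcomp X \<beta> [\<alpha>])\<rparr>"

definition U_RMnd :: "(('t, 'c) rel_monad, 'c, 't, 'c) functor_data" where
  "U_RMnd = \<lparr>fun_ob = rm_cell, fun_hom = (\<lambda>T T' \<tau>. \<tau>)\<rparr>"


section \<open>Associative-normal left-skew-multicategories and monoids\<close>

datatype 'a entry = Obj 'a | Bullet (\<open>\<bullet>\<close>)

text \<open>
  \<open>sk_hom M xs y\<close> is the set of multimorphisms \<open>xs \<rightarrow> y\<close>.  \<open>sk_comp M g fs\<close> is the composite of \<open>g\<close>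
  with \<open>fs\<close>, a list of the same length as the domain of \<open>g\<close>: \<open>Obj f\<close> substitutes \<open>f\<close> at an object entry,
  and \<open>\<bullet>\<close> is the only possibility at a marker.  \<open>sk_lam M xs y k\<close> maps \<open>xs \<rightarrow> y\<close> to \<open>ys \<rightarrow> y\<close> and
  \<open>sk_rho M xs y k\<close> maps \<open>ys \<rightarrow> y\<close> to \<open>xs \<rightarrow> y\<close>, where \<open>ys\<close> is \<open>xs\<close> with a marker inserted
  immediately after the \<open>k\<close>-th entry.
\<close>

record ('a, 'm) skew_multicat =
  sk_ob :: "'a set"
  sk_hom :: "'a entry list \<Rightarrow> 'a \<Rightarrow> 'm set"
  sk_id :: "'a \<Rightarrow> 'm"
  sk_comp :: "'m \<Rightarrow> 'm entry list \<Rightarrow> 'm"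
  sk_lam :: "'a entry list \<Rightarrow> 'a \<Rightarrow> nat \<Rightarrow> 'm \<Rightarrow> 'm"
  sk_rho :: "'a entry list \<Rightarrow> 'a \<Rightarrow> nat \<Rightarrow> 'm \<Rightarrow> 'm"

text \<open>\<open>sk_args M xss fs ys\<close>: the list \<open>fs\<close> can be substituted into a domain \<open>ys\<close>, its entries having the
  domains \<open>xss\<close>.\<close>

definition sk_args :: "('a, 'm) skew_multicat \<Rightarrow> 'a entry list list \<Rightarrow> 'm entry list \<Rightarrow> 'a entry list \<Rightarrow> bool"
  where "sk_args M xss fs ys \<longleftrightarrow> length xss = length ys \<and> length fs = length ys \<and>
    (\<forall>i<length ys. case ys ! i of
        Obj y \<Rightarrow> (\<exists>f \<in> sk_hom M (xss ! i) y. fs ! i = Obj f)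
      | \<bullet> \<Rightarrow> fs ! i = \<bullet> \<and> xss ! i = [\<bullet>])"

definition insert_bullet :: "nat \<Rightarrow> 'a entry list \<Rightarrow> 'a entry list" where
  "insert_bullet k xs = take k xs @ [\<bullet>] @ drop k xs"

locale skew_multicategory =
  fixes M :: "('a, 'm) skew_multicat"
  assumes hom_entries: "f \<in> sk_hom M xs y \<Longrightarrow>
        xs \<noteq> [] \<and> set xs \<subseteq> insert \<bullet> (Obj ` sk_ob M) \<and> y \<in> sk_ob M"
    and id_in_hom: "a \<in> sk_ob M \<Longrightarrow> sk_id M a \<in> sk_hom M [Obj a] a"
    and comp_in_hom: "\<lbrakk>g \<in> sk_hom M ys z; sk_args M xss fs ys\<rbrakk> \<Longrightarrow> sk_comp M g fs \<in> sk_hom M (concat xss) z"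
    and comp_id: "g \<in> sk_hom M ys z \<Longrightarrow> sk_comp M g (map (map_entry (sk_id M)) ys) = g"
    and id_comp: "f \<in> sk_hom M xs y \<Longrightarrow> sk_comp M (sk_id M y) [Obj f] = f"
    and comp_assoc: "\<lbrakk>h \<in> sk_hom M zs w; sk_args M yss gs zs; sk_args M xss (concat fss) (concat yss);
        map length fss = map length yss\<rbrakk> \<Longrightarrow>
        sk_comp M (sk_comp M h gs) (concat fss) =
        sk_comp M h (map2 (\<lambda>g fs. map_entry (\<lambda>g. sk_comp M g fs) g) gs fss)"
    and lam_in_hom: "\<lbrakk>f \<in> sk_hom M xs y; k < length xs\<rbrakk> \<Longrightarrow>
        sk_lam M xs y k f \<in> sk_hom M (insert_bullet k xs) y"
    and rho_in_hom: "\<lbrakk>f \<in> sk_hom M (insert_bullet k xs) y; 0 < k; k \<le> length xs\<rbrakk> \<Longrightarrow>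
        sk_rho M xs y k f \<in> sk_hom M xs y"
    and comp_lam: "\<lbrakk>g \<in> sk_hom M ys z; sk_args M xss fs ys; k < length ys\<rbrakk> \<Longrightarrow>
        sk_comp M (sk_lam M ys z k g) (insert_bullet k fs) =
        sk_lam M (concat xss) z (length (concat (take k xss))) (sk_comp M g fs)"
    and lam_comp: "\<lbrakk>g \<in> sk_hom M ys z; sk_args M xss fs ys; i < length ys; ys ! i = Obj y; fs ! i = Obj f;
        k < length (xss ! i)\<rbrakk> \<Longrightarrow>
        sk_comp M g (fs[i := Obj (sk_lam M (xss ! i) y k f)]) =
        sk_lam M (concat xss) z (length (concat (take i xss)) + k) (sk_comp M g fs)"
    and comp_rho: "\<lbrakk>g \<in> sk_hom M (insert_bullet k ys) z; sk_args M xss fs ys; 0 < k; k \<le> length ys\<rbrakk> \<Longrightarrow>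
        sk_comp M (sk_rho M ys z k g) fs =
        sk_rho M (concat xss) z (length (concat (take k xss))) (sk_comp M g (insert_bullet k fs))"
    and rho_comp: "\<lbrakk>g \<in> sk_hom M ys z; sk_args M (xss[i := insert_bullet k (xss ! i)]) fs ys;
        i < length ys; ys ! i = Obj y; fs ! i = Obj f; 0 < k; k \<le> length (xss ! i)\<rbrakk> \<Longrightarrow>
        sk_comp M g (fs[i := Obj (sk_rho M (xss ! i) y k f)]) =
        sk_rho M (concat xss) z (length (concat (take i xss)) + k) (sk_comp M g fs)"
    and lam_lam: "\<lbrakk>f \<in> sk_hom M xs y; k \<le> l; l < length xs\<rbrakk> \<Longrightarrow>
        sk_lam M (insert_bullet k xs) y (Suc l) (sk_lam M xs y k f) =
        sk_lam M (insert_bullet l xs) y k (sk_lam M xs y l f)"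
    and rho_rho: "\<lbrakk>f \<in> sk_hom M (insert_bullet (Suc l) (insert_bullet k xs)) y; 0 < k; k \<le> l; l \<le> length xs\<rbrakk> \<Longrightarrow>
        sk_rho M xs y k (sk_rho M (insert_bullet k xs) y (Suc l) f) =
        sk_rho M xs y l (sk_rho M (insert_bullet l xs) y k f)"
    and rho_lam_after: "\<lbrakk>f \<in> sk_hom M (insert_bullet l xs) y; k < l; l \<le> length xs\<rbrakk> \<Longrightarrow>
        sk_rho M (insert_bullet k xs) y (Suc l) (sk_lam M (insert_bullet l xs) y k f) =
        sk_lam M xs y k (sk_rho M xs y l f)"
    and rho_lam_before: "\<lbrakk>f \<in> sk_hom M (insert_bullet l xs) y; 0 < l; l \<le> k; k < length xs\<rbrakk> \<Longrightarrow>
        sk_rho M (insert_bullet k xs) y l (sk_lam M (insert_bullet l xs) y (Suc k) f) =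
        sk_lam M xs y k (sk_rho M xs y l f)"
    and rho_lam: "\<lbrakk>f \<in> sk_hom M xs y; 0 < k; k < length xs\<rbrakk> \<Longrightarrow> sk_rho M xs y k (sk_lam M xs y k f) = f"

text \<open>The definitions of monoids and their homomorphisms only involve the operations, so they are stated
  for the bare data.\<close>

record ('a, 'm) monoid_obj =
  mon_carrier :: 'a
  mon_mult :: 'm
  mon_unit :: 'm

definition is_monoid :: "('a, 'm) skew_multicat \<Rightarrow> ('a, 'm) monoid_obj \<Rightarrow> bool" where
  "is_monoid \<M> Q \<longleftrightarrow> (let M = mon_carrier Q; m = mon_mult Q; u = mon_unit Q; e = sk_id \<M> M in
     M \<in> sk_ob \<M> \<and>
     m \<in> sk_hom \<M> [Obj M, Obj M] M \<and>
     u \<in> sk_hom \<M> [\<bullet>] M \<and>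
     sk_comp \<M> m [Obj u, Obj e] = sk_lam \<M> [Obj M] M 0 e \<and>
     sk_rho \<M> [Obj M] M 1 (sk_comp \<M> m [Obj e, Obj u]) = e \<and>
     sk_comp \<M> m [Obj m, Obj e] = sk_comp \<M> m [Obj e, Obj m])"

definition monoid_hom ::
  "('a, 'm) skew_multicat \<Rightarrow> ('a, 'm) monoid_obj \<Rightarrow> ('a, 'm) monoid_obj \<Rightarrow> 'm set" where
  "monoid_hom \<M> Q Q' = {f \<in> sk_hom \<M> [Obj (mon_carrier Q)] (mon_carrier Q').
     sk_comp \<M> f [Obj (mon_unit Q)] = mon_unit Q' \<and>
     sk_comp \<M> f [Obj (mon_mult Q)] = sk_comp \<M> (mon_mult Q') [Obj f, Obj f]}"

definition Mon :: "('a, 'm) skew_multicat \<Rightarrow> (('a, 'm) monoid_obj, 'm) category" where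
  "Mon \<M> = \<lparr>cat_ob = {Q. is_monoid \<M> Q}, cat_hom = monoid_hom \<M>,
     cat_id = (\<lambda>Q. sk_id \<M> (mon_carrier Q)), cat_comp = (\<lambda>g f. sk_comp \<M> g [Obj f])\<rparr>"

definition U_Mon :: "(('a, 'm) monoid_obj, 'm, 'a, 'm) functor_data" where
  "U_Mon = \<lparr>fun_ob = mon_carrier, fun_hom = (\<lambda>Q Q' f. f)\<rparr>"


section \<open>The skew-multicategory X[j]\<close>

fun interleave :: "'a \<Rightarrow> 'a list \<Rightarrow> 'a list" where
  "interleave s (x # y # zs) = x # s # interleave s (y # zs)"
| "interleave s xs = xs"

fun entry_loose :: "('o, 't, 'l, 'c, 'z) vequip_scheme \<Rightarrow> 't \<Rightarrow> 't entry \<Rightarrow> 'l" where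
  "entry_loose X j (Obj t) = companion X t"
| "entry_loose X j \<bullet> = companion X j"

fun entry_cell :: "('o, 't, 'l, 'c, 'z) vequip_scheme \<Rightarrow> 't \<Rightarrow> 'c entry \<Rightarrow> 'c" where
  "entry_cell X j (Obj \<phi>) = \<phi>"
| "entry_cell X j \<bullet> = cell_id X (companion X j)"

text \<open>The chain \<open>p\<^sub>1, E(j, 1), p\<^sub>2, \<dots>, E(j, 1), p\<^sub>n\<close>.\<close>

definition xj_chain :: "('o, 't, 'l, 'c, 'z) vequip_scheme \<Rightarrow> 't \<Rightarrow> 't entry list \<Rightarrow> 'l list" where
  "xj_chain X j xs = interleave (conjoint X j) (map (entry_loose X j) xs)"

definition xj_hom :: "('o, 't, 'l, 'c, 'z) vequip_scheme \<Rightarrow> 't \<Rightarrow> 't entry list \<Rightarrow> 't \<Rightarrow> 'c set" where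
  "xj_hom X j xs s = (let obs = tight_hom X (tight_dom X j) (tight_cod X j) in
     if xs \<noteq> [] \<and> set xs \<subseteq> insert \<bullet> (Obj ` obs) \<and> s \<in> obs
     then globular X (xj_chain X j xs) (companion X s) else {})"

definition xj_comp :: "('o, 't, 'l, 'c, 'z) vequip_scheme \<Rightarrow> 't \<Rightarrow> 'c \<Rightarrow> 'c entry list \<Rightarrow> 'c" where
  "xj_comp X j g fs = gcomp X g (interleave (cell_id X (conjoint X j)) (map (entry_cell X j) fs))"

text \<open>\<open>\<lambda>\<^sub>k\<close> precomposes the \<open>(k+1)\<close>-st entry \<open>p\<close> of the domain with
  \<open>E(1, j), E(j, 1), p \<Rightarrow> E(1, 1), p \<Rightarrow> p\<close>.\<close>

definition xj_lam ::
  "('o, 't, 'l, 'c, 'z) vequip_scheme \<Rightarrow> 't \<Rightarrow> 't entry list \<Rightarrow> 't \<Rightarrow> nat \<Rightarrow> 'c \<Rightarrow> 'c" where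
  "xj_lam X j xs s k \<phi> = (let ps = map (entry_loose X j) xs; p = ps ! k in
     gcomp X \<phi> (interleave (cell_id X (conjoint X j))
       ((map (cell_id X) ps)[k := gcomp X (loose_unitor X p) [smile X j, cell_id X p]])))"

text \<open>The loose-composite \<open>E(j, 1) \<odot> E(1, j)\<close> is \<open>E(j, j)\<close>, with opcartesian 2-cell the composition
  \<open>E(j, 1), E(1, j) \<Rightarrow> E(j, j)\<close>.  \<open>\<rho>\<^sub>k\<close> factors a 2-cell with domain
  \<open>p\<^sub>1, \<dots>, p\<^sub>k, E(j, 1), E(1, j), E(j, 1), p\<^sub>k\<^sub>+\<^sub>1, \<dots>, p\<^sub>n\<close> through the latter and precomposes with
  \<open>() \<Rightarrow> E(j, j)\<close>.\<close>

definition xj_rho ::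
  "('o, 't, 'l, 'c, 'z) vequip_scheme \<Rightarrow> 't \<Rightarrow> 't entry list \<Rightarrow> 't \<Rightarrow> nat \<Rightarrow> 'c \<Rightarrow> 'c" where
  "xj_rho X j xs s k \<phi> = (let ps = xj_chain X j (take k xs); rs = drop (length ps) (xj_chain X j xs);
       paste = (\<lambda>\<chi> \<theta>. gcomp X \<chi> (map (cell_id X) ps @ [\<theta>] @ map (cell_id X) rs)) in
     paste (THE \<chi>. \<chi> \<in> globular X (ps @ [rep X j j] @ rs) (companion X s) \<and>
              paste \<chi> (smile_at X (cod_id X j) j j) = \<phi>)
       (frown X j))"

definition XJ :: "('o, 't, 'l, 'c, 'z) vequip_scheme \<Rightarrow> 't \<Rightarrow> ('t, 'c) skew_multicat" where
  "XJ X j = \<lparr>sk_ob = tight_hom X (tight_dom X j) (tight_cod X j), sk_hom = xj_hom X j,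
     sk_id = (\<lambda>t. cell_id X (companion X t)), sk_comp = xj_comp X j,
     sk_lam = xj_lam X j, sk_rho = xj_rho X j\<rparr>"

end

theory Submission
  imports Defs
begin

text \<open>
  A 2-cell \<open>\<chi>\<close> into \<open>E(f, g)\<close> is determined by its composite with the cartesian 2-cell
  \<open>E(f, g) \<Rightarrow> E(1, 1)\<close>, and 2-cells into \<open>E(1, 1)\<close> multiply associatively and unitally through
  \<open>E(1, 1), E(1, 1) \<Rightarrow> E(1, 1)\<close>, like heteromorphisms valued in \<open>E\<close>.  Write \<open>\<epsilon>\<^sub>f\<close> for the cartesian
  2-cell \<open>E(1, f) \<Rightarrow> E(1, 1)\<close>, and \<open>D\<close> for the composite \<open>E(j, t) \<Rightarrow> E(t, t) \<Rightarrow> E(1, 1)\<close> given by an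
  extension operator on \<open>t\<close>.  As \<open>E(j, t)\<close> is the loose-composite of \<open>E(j, 1)\<close> and \<open>E(1, t)\<close>, \<open>D\<close>
  amounts to a 2-cell \<open>D': E(j, 1), E(1, t) \<Rightarrow> E(1, 1)\<close> with left and right \<open>t\<close>, and by the Yoneda lemma
  for \<open>E(1, t)\<close> to the 2-cell \<open>\<epsilon>\<^sub>t \<star> D'\<close>, that is, to a multiplication
  \<open>m: E(1, t), E(j, 1), E(1, t) \<Rightarrow> E(1, t)\<close>.  After composition with \<open>\<epsilon>\<^sub>t\<close>, the laws for \<open>m\<close> become
  those for \<open>D\<close>, multiplied by \<open>\<epsilon>\<close> on the left and precomposed with \<open>E(j, 1), E(1, t) \<Rightarrow> E(j, t)\<close>;
  both operations are injective.
\<close>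

text \<open>The obstacle is that a virtual equipment postulates loose-composites only for empty
  chains. That E(j, t) is the loose-composite of E(j, 1) and E(1, t), in every context and against
  2-cells with arbitrary tight-cells, has to be derived from loose-identities and restrictions
  (\<open>smile_at_opcartesian\<close>). This fact lets an operator on E(j, t) be traded for a
  multiplication whose domain contains E(j, 1), E(1, t), and it is what makes \<rho> computable.
  Restrictions are chosen arbitrarily, so no canonical isomorphism can be treated as an identity.
  Comparing 2-cells only after composition with the cartesian 2-cells into E(1, 1) removes the
  choices: \<open>frown\<close> becomes a unit, \<open>smile_at\<close> a product, and restriction
  along a 2-cell a product with a nullary 2-cell, its \<open>point\<close>. Each law is proved as an
  equivalence for an arbitrary operator, not for a relative monad, so that bijectivity of
  \<open>ext_mult\<close> transports whole structures. Units and morphisms are the same 2-cells on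
  both sides; only the extension operator is translated.\<close>

section \<open>Functors acting identically on morphisms\<close>

text \<open>The category axioms for the domain are inherited from the codomain.\<close>

lemma is_functor_inclusion:
  assumes D: "is_category D"
    and ob: "\<And>a. a \<in> cat_ob C \<Longrightarrow> p a \<in> cat_ob D"
    and hom: "\<And>a b. \<lbrakk>a \<in> cat_ob C; b \<in> cat_ob C\<rbrakk> \<Longrightarrow> cat_hom C a b \<subseteq> cat_hom D (p a) (p b)"
    and id: "\<And>a. a \<in> cat_ob C \<Longrightarrow> cat_id C a = cat_id D (p a)"
    and comp: "cat_comp C = cat_comp D"
    and id_in: "\<And>a. a \<in> cat_ob C \<Longrightarrow> cat_id C a \<in> cat_hom C a a"
    and comp_in: "\<And>a b c f g. \<lbrakk>a \<in> cat_ob C; b \<in> cat_ob C; c \<in> cat_ob C; f \<in> cat_hom C a b; g \<in> cat_hom C b c\<rbrakk> \<Longrightarrow>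
      cat_comp C g f \<in> cat_hom C a c"
  shows "is_functor C D \<lparr>fun_ob = p, fun_hom = (\<lambda>a b f. f)\<rparr>"
proof -
  interpret D: is_category D by (rule D)
  have hom': "f \<in> cat_hom D (p a) (p b)" if "a \<in> cat_ob C" "b \<in> cat_ob C" "f \<in> cat_hom C a b" for a b f
    using hom that by blast
  interpret C: is_category C
  proof (unfold_locales, goal_cases)
    case (3 a b f)
    then show ?case
      using D.comp_id[of "p a" "p b" f] hom' by (simp add: ob id comp)
  next
    case (4 a b f)
    then show ?case
      using D.id_comp[of "p a" "p b" f] hom' by (simp add: ob id comp)
  next
    case (5 a b c d f g h)
    then show ?case
      using D.comp_assoc[of "p a" "p b" "p c" "p d" f g h] hom' by (simp add: ob comp)
  qed (use id_in comp_in in simp_all)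
  show ?thesis
    by unfold_locales (use ob hom' id comp in simp_all)
qed

lemma is_functor_functor_id: "is_category C \<Longrightarrow> is_functor C C functor_id"
  by (simp add: is_functor_def is_functor_axioms_def functor_id_def)

lemma is_functor_comp:
  assumes F: "is_functor C D F" and G: "is_functor D K G"
  shows "is_functor C K (functor_comp G F)"
proof -
  interpret F: is_functor C D F by (rule F)
  interpret G: is_functor D K G by (rule G)
  show ?thesis
    by unfold_locales
      (simp_all add: functor_comp_def F.ob_in_ob F.hom_in_hom F.preserves_id F.preserves_comp
        G.ob_in_ob G.hom_in_hom G.preserves_id G.preserves_comp)
qed

section \<open>Composition in a virtual double category\<close>

lemma ex1_unique: "\<lbrakk>\<exists>!x. P x; P x; P y\<rbrakk> \<Longrightarrow> x = y"
  by blast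

lemma ex1_iff: "\<exists>!x. P x \<Longrightarrow> (\<And>x. P x \<longleftrightarrow> Q x) \<Longrightarrow> \<exists>!x. Q x"
  by simp

context virtual_double_category
begin

declare tight_dom_ob [simp] tight_cod_ob [simp] tight_id [simp] tight_comp [simp]
  loose_src_ob [simp] loose_tgt_ob [simp] cell_id [simp]

lemma tight_comp_id' [simp]: "\<lbrakk>f \<in> tight X; tight_dom X f = a\<rbrakk> \<Longrightarrow> tight_comp X f (tight_id X a) = f"
  using tight_comp_id by blast

lemma tight_id_comp' [simp]: "\<lbrakk>f \<in> tight X; tight_cod X f = a\<rbrakk> \<Longrightarrow> tight_comp X (tight_id X a) f = f"
  using tight_id_comp by blast

lemma cell_left_tight [simp]: "\<phi> \<in> cells X \<Longrightarrow> cell_left X \<phi> \<in> tight X"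
  and cell_right_tight [simp]: "\<phi> \<in> cells X \<Longrightarrow> cell_right X \<phi> \<in> tight X"
  and cell_cod_loose [simp]: "\<phi> \<in> cells X \<Longrightarrow> cell_cod X \<phi> \<in> loose X"
  using cell_frame by blast+

lemma tight_cod_cell_left: "\<phi> \<in> cells X \<Longrightarrow> tight_cod X (cell_left X \<phi>) = loose_tgt X (cell_cod X \<phi>)"
  and tight_cod_cell_right: "\<phi> \<in> cells X \<Longrightarrow> tight_cod X (cell_right X \<phi>) = loose_src X (cell_cod X \<phi>)"
  using cell_frame by metis+

lemma cell_dom_chain: "\<phi> \<in> cells X \<Longrightarrow>
    loose_chain X (tight_dom X (cell_left X \<phi>)) (cell_dom X \<phi>) (tight_dom X (cell_right X \<phi>))"
  using cell_frame by blast

lemma last_tight_Nil [simp]: "last_tight X f [] = f"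
  and last_tight_Cons [simp]: "last_tight X f (\<phi> # \<phi>s) = last_tight X (cell_right X \<phi>) \<phi>s"
  by (simp_all add: last_tight_def)

lemma last_tight_append [simp]:
  "last_tight X f (\<phi>s @ \<psi>s) = last_tight X (last_tight X f \<phi>s) \<psi>s"
  by (induction \<phi>s arbitrary: f) simp_all

lemma last_tight_chain: "cell_chain X f \<phi>s g \<Longrightarrow> last_tight X f \<phi>s = g"
  by (induction \<phi>s arbitrary: f) auto

lemma cell_chain_tight: "cell_chain X f \<phi>s g \<Longrightarrow> f \<in> tight X \<and> g \<in> tight X"
  by (induction \<phi>s arbitrary: f) auto

lemma cell_chain_append:
  "cell_chain X f (\<phi>s @ \<psi>s) g \<longleftrightarrow>
    cell_chain X f \<phi>s (last_tight X f \<phi>s) \<and> cell_chain X (last_tight X f \<phi>s) \<psi>s g"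
  by (induction \<phi>s arbitrary: f) (auto dest: cell_chain_tight)

lemma loose_chain_ob: "loose_chain X a ps b \<Longrightarrow> a \<in> objects X \<and> b \<in> objects X"
  by (induction ps arbitrary: a) auto

lemma loose_chain_append:
  "loose_chain X a (ps @ qs) c \<longleftrightarrow> (\<exists>b. loose_chain X a ps b \<and> loose_chain X b qs c)"
  by (induction ps arbitrary: a) (auto dest: loose_chain_ob)

lemma loose_chain_loose: "loose_chain X a ps b \<Longrightarrow> set ps \<subseteq> loose X"
  by (induction ps arbitrary: a) auto

lemma cell_chain_ids: "loose_chain X a ps b \<Longrightarrow> cell_chain X (tight_id X a) (map (cell_id X) ps) (tight_id X b)"
  by (induction ps arbitrary: a) auto

lemma map_cell_cod_ids [simp]: "set ps \<subseteq> loose X \<Longrightarrow> map (cell_cod X \<circ> cell_id X) ps = ps"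
  by (induction ps) auto

lemma concat_map_cell_dom_ids [simp]:
  "set ps \<subseteq> loose X \<Longrightarrow> concat (map (cell_dom X \<circ> cell_id X) ps) = ps"
  by (induction ps) auto

text \<open>Computing the right-most tight-cell by \<open>last_tight\<close> leaves no variable that
  occurs in the premises alone, so frames of composites can be found by rewriting.\<close>

lemma cell_comp_cell:
  assumes "\<psi> \<in> cells X" "cell_chain X f \<phi>s (last_tight X f \<phi>s)" "map (cell_cod X) \<phi>s = cell_dom X \<psi>"
    "tight_cod X f = tight_dom X (cell_left X \<psi>)"
  shows "cell_comp X \<psi> f \<phi>s \<in> cells X \<and>
        cell_dom X (cell_comp X \<psi> f \<phi>s) = concat (map (cell_dom X) \<phi>s) \<and>
        cell_cod X (cell_comp X \<psi> f \<phi>s) = cell_cod X \<psi> \<and>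
        cell_left X (cell_comp X \<psi> f \<phi>s) = tight_comp X (cell_left X \<psi>) f \<and>
        cell_right X (cell_comp X \<psi> f \<phi>s) = tight_comp X (cell_right X \<psi>) (last_tight X f \<phi>s)"
  using cell_comp[OF assms] .

declare cell_comp_cell [simp]

lemma cell_id_comp' [simp]:
  "\<lbrakk>\<phi> \<in> cells X; cell_cod X \<phi> = q; cell_left X \<phi> = f\<rbrakk> \<Longrightarrow> cell_comp X (cell_id X q) f [\<phi>] = \<phi>"
  using cell_id_comp by blast

lemma cell_comp_id' [simp]:
  "\<lbrakk>\<phi> \<in> cells X; cell_dom X \<phi> = [p]; tight_dom X (cell_left X \<phi>) = a\<rbrakk> \<Longrightarrow>
    cell_comp X \<phi> (tight_id X a) [cell_id X p] = \<phi>"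
  using cell_comp_id[of \<phi>] by simp

lemma chain_comp_append: "length \<psi>s = length \<phi>ss \<Longrightarrow>
    chain_comp X f (\<psi>s @ \<psi>s') (\<phi>ss @ \<phi>ss') =
    chain_comp X f \<psi>s \<phi>ss @ chain_comp X (last_tight X f (concat \<phi>ss)) \<psi>s' \<phi>ss'"
  by (induction \<psi>s \<phi>ss arbitrary: f rule: list_induct2) simp_all

lemma chain_comp_ids: "loose_chain X a ps b \<Longrightarrow>
    chain_comp X (tight_id X a) (map (cell_id X) ps) (map (\<lambda>p. [cell_id X p]) ps) = map (cell_id X) ps"
  by (induction ps arbitrary: a) auto

text \<open>The inner chain is usually written as one flat list. The premise
  \<open>\<phi>s = concat \<phi>ss\<close> allows its division into blocks, some of them possibly
  empty, to be supplied by instantiating \<open>\<phi>ss\<close>.\<close>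

lemma cell_assoc1:
  assumes "\<chi> \<in> cells X" "cell_chain X g \<psi>s (last_tight X g \<psi>s)" "map (cell_cod X) \<psi>s = cell_dom X \<chi>"
    "tight_cod X g = tight_dom X (cell_left X \<chi>)"
    "cell_chain X f (concat \<phi>ss) (last_tight X f (concat \<phi>ss))"
    "map (map (cell_cod X)) \<phi>ss = map (cell_dom X) \<psi>s" "tight_cod X f = tight_dom X g"
    "\<phi>s = concat \<phi>ss"
  shows "cell_comp X (cell_comp X \<chi> g \<psi>s) f \<phi>s =
        cell_comp X \<chi> (tight_comp X g f) (chain_comp X f \<psi>s \<phi>ss)"
  using cell_assoc[OF assms(1-7)] assms(8) by simp

text \<open>Substitution in the middle of a domain, which is how the universal property of
  opcartesian 2-cells is phrased. The tight-cell has to be passed explicitly because the substituted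
  chain may be empty; being an identity, it leaves the left tight-cell of \<open>\<psi>\<close>
  unchanged.\<close>

definition ctx :: "'c \<Rightarrow> 'l list \<Rightarrow> 'c list \<Rightarrow> 'l list \<Rightarrow> 'c" where
  "ctx \<psi> ps \<phi>s rs = cell_comp X \<psi> (tight_id X (tight_dom X (cell_left X \<psi>)))
     (map (cell_id X) ps @ \<phi>s @ map (cell_id X) rs)"

lemma ctx_cell:
  assumes \<psi>: "\<psi> \<in> cells X" and dom: "cell_dom X \<psi> = ps @ qs @ rs"
    and ps: "loose_chain X (tight_dom X (cell_left X \<psi>)) ps a"
    and rs: "loose_chain X b rs (tight_dom X (cell_right X \<psi>))"
    and \<phi>s: "cell_chain X (tight_id X a) \<phi>s (tight_id X b)" "map (cell_cod X) \<phi>s = qs"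
  shows "ctx \<psi> ps \<phi>s rs \<in> cells X \<and>
    cell_dom X (ctx \<psi> ps \<phi>s rs) = ps @ concat (map (cell_dom X) \<phi>s) @ rs \<and>
    cell_cod X (ctx \<psi> ps \<phi>s rs) = cell_cod X \<psi> \<and>
    cell_left X (ctx \<psi> ps \<phi>s rs) = cell_left X \<psi> \<and>
    cell_right X (ctx \<psi> ps \<phi>s rs) = cell_right X \<psi>"
proof -
  have "cell_chain X (tight_id X (tight_dom X (cell_left X \<psi>)))
      (map (cell_id X) ps @ \<phi>s @ map (cell_id X) rs) (tight_id X (tight_dom X (cell_right X \<psi>)))"
    using cell_chain_ids[OF ps] cell_chain_ids[OF rs] \<phi>s
    by (simp add: cell_chain_append last_tight_chain)
  note * = cell_comp[OF \<psi> this]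
  show ?thesis
    unfolding ctx_def using * dom \<phi>s(2) loose_chain_loose[OF ps] loose_chain_loose[OF rs] \<psi>
    by (simp add: comp_assoc)
qed

lemma ctx_ids: "\<lbrakk>\<psi> \<in> cells X; cell_dom X \<psi> = ps @ qs @ rs\<rbrakk> \<Longrightarrow> ctx \<psi> ps (map (cell_id X) qs) rs = \<psi>"
  unfolding ctx_def using cell_comp_id[of \<psi>] by simp

text \<open>This is associativity with every block over \<open>ps\<close> and \<open>rs\<close> a
  single identity, so chains inside a context compose as if the context were absent.\<close>

lemma ctx_comp:
  assumes \<psi>: "\<psi> \<in> cells X" and dom: "cell_dom X \<psi> = ps @ qs @ rs"
    and ps: "loose_chain X (tight_dom X (cell_left X \<psi>)) ps a"
    and rs: "loose_chain X b rs (tight_dom X (cell_right X \<psi>))"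
    and \<phi>s: "cell_chain X (tight_id X a) \<phi>s (tight_id X b)" "map (cell_cod X) \<phi>s = qs"
    and \<theta>ss: "cell_chain X (tight_id X a) (concat \<theta>ss) (tight_id X b)"
      "map (map (cell_cod X)) \<theta>ss = map (cell_dom X) \<phi>s"
    and \<theta>s: "\<theta>s = concat \<theta>ss"
  shows "ctx (ctx \<psi> ps \<phi>s rs) ps \<theta>s rs = ctx \<psi> ps (chain_comp X (tight_id X a) \<phi>s \<theta>ss) rs"
proof -
  let ?i = "tight_id X (tight_dom X (cell_left X \<psi>))"
  let ?\<theta>ss = "map (\<lambda>p. [cell_id X p]) ps @ \<theta>ss @ map (\<lambda>p. [cell_id X p]) rs"
  have lp: "set ps \<subseteq> loose X" and lr: "set rs \<subseteq> loose X"
    using loose_chain_loose ps rs by blast+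
  have concat_sing: "concat (map (\<lambda>p. [cell_id X p]) ps) = map (cell_id X) ps" for ps by (induction ps) auto
  have len: "length \<phi>s = length \<theta>ss" using \<theta>ss(2) by (metis length_map)
  have maps: "map (map (cell_cod X)) (map (\<lambda>p. [cell_id X p]) ps) = map (cell_dom X) (map (cell_id X) ps)"
    if "set ps \<subseteq> loose X" for ps using that by auto
  have 1: "cell_left X (ctx \<psi> ps \<phi>s rs) = cell_left X \<psi>"
    using ctx_cell[OF \<psi> dom ps rs \<phi>s] by simp
  have "ctx (ctx \<psi> ps \<phi>s rs) ps \<theta>s rs =
      cell_comp X (cell_comp X \<psi> ?i (map (cell_id X) ps @ \<phi>s @ map (cell_id X) rs)) ?i (concat ?\<theta>ss)"
    unfolding ctx_def[of "ctx _ _ _ _"] 1 by (simp add: ctx_def concat_sing \<theta>s)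
  also have "\<dots> = cell_comp X \<psi> (tight_comp X ?i ?i)
      (chain_comp X ?i (map (cell_id X) ps @ \<phi>s @ map (cell_id X) rs) ?\<theta>ss)"
  proof (rule cell_assoc)
    show "cell_chain X ?i (map (cell_id X) ps @ \<phi>s @ map (cell_id X) rs) (tight_id X (tight_dom X (cell_right X \<psi>)))"
      using cell_chain_ids[OF ps] cell_chain_ids[OF rs] \<phi>s
      by (simp add: cell_chain_append last_tight_chain)
    show "cell_chain X ?i (concat ?\<theta>ss) (tight_id X (tight_dom X (cell_right X \<psi>)))"
      using cell_chain_ids[OF ps] cell_chain_ids[OF rs] \<theta>ss
      by (simp add: cell_chain_append last_tight_chain concat_sing)
    show "map (map (cell_cod X)) ?\<theta>ss = map (cell_dom X) (map (cell_id X) ps @ \<phi>s @ map (cell_id X) rs)"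
      using maps[OF lp] maps[OF lr] \<theta>ss by simp
  qed (use \<psi> dom \<phi>s lp lr in simp_all)
  also have "\<dots> = ctx \<psi> ps (chain_comp X (tight_id X a) \<phi>s \<theta>ss) rs"
    using cell_chain_ids[OF ps] \<theta>ss \<psi>
    by (simp add: ctx_def chain_comp_append len chain_comp_ids[OF ps] chain_comp_ids[OF rs]
        concat_sing last_tight_chain)
  finally show ?thesis .
qed

section \<open>Universal properties of opcartesian and cartesian 2-cells\<close>

lemma opcartesian_ex1:
  assumes "opcartesian X \<phi>" "\<psi> \<in> cells X" "cell_dom X \<psi> = ps @ cell_dom X \<phi> @ rs"
    "loose_chain X (tight_dom X (cell_left X \<psi>)) ps (loose_tgt X (cell_cod X \<phi>))"
  shows "\<exists>!\<chi>. \<chi> \<in> cells X \<and> cell_dom X \<chi> = ps @ [cell_cod X \<phi>] @ rs \<and> cell_cod X \<chi> = cell_cod X \<psi> \<and>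
    cell_left X \<chi> = cell_left X \<psi> \<and> cell_right X \<chi> = cell_right X \<psi> \<and> ctx \<chi> ps [\<phi>] rs = \<psi>"
proof -
  have "\<exists>!\<chi>. \<chi> \<in> cells X \<and> cell_dom X \<chi> = ps @ [cell_cod X \<phi>] @ rs \<and> cell_cod X \<chi> = cell_cod X \<psi> \<and>
          cell_left X \<chi> = cell_left X \<psi> \<and> cell_right X \<chi> = cell_right X \<psi> \<and>
          cell_comp X \<chi> (tight_id X (tight_dom X (cell_left X \<psi>)))
            (map (cell_id X) ps @ [\<phi>] @ map (cell_id X) rs) = \<psi>"
    using assms unfolding opcartesian_def by metis
  moreover have "cell_left X \<chi> = cell_left X \<psi> \<Longrightarrow> ctx \<chi> ps [\<phi>] rs =
      cell_comp X \<chi> (tight_id X (tight_dom X (cell_left X \<psi>)))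
            (map (cell_id X) ps @ [\<phi>] @ map (cell_id X) rs)" for \<chi>
    by (simp add: ctx_def)
  ultimately show ?thesis by (smt (verit))
qed

text \<open>Both 2-cells factor the same composite, and \<open>ctx_cell\<close> shows that this
  composite has the frame that uniqueness asks for. Equations between 2-cells out of E(1, 1) are
  tested in this way by inserting the unit, those out of E(j, t) by inserting E(j, 1), E(1,
  t).\<close>

lemma opcartesian_cancel:
  assumes op: "opcartesian X \<phi>" and \<chi>: "\<chi> \<in> cells X" "\<chi>' \<in> cells X"
    and dom: "cell_dom X \<chi> = ps @ [cell_cod X \<phi>] @ rs" "cell_dom X \<chi>' = cell_dom X \<chi>"
    and frame: "cell_cod X \<chi>' = cell_cod X \<chi>" "cell_left X \<chi>' = cell_left X \<chi>"
      "cell_right X \<chi>' = cell_right X \<chi>"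
    and eq: "ctx \<chi> ps [\<phi>] rs = ctx \<chi>' ps [\<phi>] rs"
  shows "\<chi> = \<chi>'"
proof -
  let ?\<psi> = "ctx \<chi> ps [\<phi>] rs"
  have \<phi>: "\<phi> \<in> cells X" "cell_left X \<phi> = tight_id X (loose_tgt X (cell_cod X \<phi>))"
    "cell_right X \<phi> = tight_id X (loose_src X (cell_cod X \<phi>))"
    using op by (auto simp: opcartesian_def globular_def)
  have ch: "loose_chain X (tight_dom X (cell_left X \<chi>)) ps (loose_tgt X (cell_cod X \<phi>))"
    "loose_chain X (loose_src X (cell_cod X \<phi>)) rs (tight_dom X (cell_right X \<chi>))"
    using cell_dom_chain[OF \<chi>(1)] dom(1) by (auto simp: loose_chain_append)
  have \<psi>: "?\<psi> \<in> cells X" "cell_dom X ?\<psi> = ps @ cell_dom X \<phi> @ rs"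
    "cell_cod X ?\<psi> = cell_cod X \<chi>" "cell_left X ?\<psi> = cell_left X \<chi>" "cell_right X ?\<psi> = cell_right X \<chi>"
    using ctx_cell[OF \<chi>(1) dom(1) ch, of "[\<phi>]"] \<phi> by simp_all
  have uniq: "\<theta> = \<theta>'"
    if "\<theta> \<in> cells X \<and> cell_dom X \<theta> = ps @ [cell_cod X \<phi>] @ rs \<and> cell_cod X \<theta> = cell_cod X ?\<psi> \<and>
      cell_left X \<theta> = cell_left X ?\<psi> \<and> cell_right X \<theta> = cell_right X ?\<psi> \<and> ctx \<theta> ps [\<phi>] rs = ?\<psi>"
      "\<theta>' \<in> cells X \<and> cell_dom X \<theta>' = ps @ [cell_cod X \<phi>] @ rs \<and> cell_cod X \<theta>' = cell_cod X ?\<psi> \<and>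
      cell_left X \<theta>' = cell_left X ?\<psi> \<and> cell_right X \<theta>' = cell_right X ?\<psi> \<and> ctx \<theta>' ps [\<phi>] rs = ?\<psi>"
    for \<theta> \<theta>'
    by (rule ex1_unique[OF opcartesian_ex1[OF op \<psi>(1,2)] that]) (simp only: \<psi>(4) ch(1))
  show ?thesis
    by (rule uniq) (use \<chi> dom frame \<psi> eq in simp_all)
qed

lemma opcartesian_factor:
  assumes op: "opcartesian X \<phi>" and \<psi>: "\<psi> \<in> cells X" "cell_dom X \<psi> = ps @ cell_dom X \<phi> @ rs"
    "loose_chain X (tight_dom X (cell_left X \<psi>)) ps (loose_tgt X (cell_cod X \<phi>))"
  obtains \<chi> where "\<chi> \<in> cells X" "cell_dom X \<chi> = ps @ [cell_cod X \<phi>] @ rs" "cell_cod X \<chi> = cell_cod X \<psi>"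
    "cell_left X \<chi> = cell_left X \<psi>" "cell_right X \<chi> = cell_right X \<psi>" "ctx \<chi> ps [\<phi>] rs = \<psi>"
  using opcartesian_ex1[OF assms(1-4)] by blast

lemma cartesian_cancel:
  assumes c: "cartesian X \<phi>" and \<chi>: "\<chi> \<in> cells X" "\<chi>' \<in> cells X"
    and dom: "cell_dom X \<chi>' = cell_dom X \<chi>" "[cell_cod X \<chi>] = cell_dom X \<phi>" "cell_cod X \<chi>' = cell_cod X \<chi>"
    and tight: "cell_left X \<chi>' = cell_left X \<chi>" "cell_right X \<chi>' = cell_right X \<chi>"
    and eq: "cell_comp X \<phi> (cell_left X \<chi>) [\<chi>] = cell_comp X \<phi> (cell_left X \<chi>) [\<chi>']"
  shows "\<chi> = \<chi>'"
proof -
  let ?\<psi> = "cell_comp X \<phi> (cell_left X \<chi>) [\<chi>]"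
  have \<phi>: "\<phi> \<in> cells X" using c by (simp add: cartesian_def)
  have t: "tight_cod X (cell_left X \<chi>) = tight_dom X (cell_left X \<phi>)"
     "tight_cod X (cell_right X \<chi>) = tight_dom X (cell_right X \<phi>)"
    using cell_dom_chain[OF \<phi>] \<chi> dom(2)[symmetric] by (auto simp: tight_cod_cell_left tight_cod_cell_right)
  have "\<exists>!\<theta>. is_lift X \<phi> (cell_left X \<chi>) (cell_right X \<chi>) ?\<psi> \<theta>"
    using c \<chi> \<phi> t dom unfolding cartesian_def by simp
  moreover have "is_lift X \<phi> (cell_left X \<chi>) (cell_right X \<chi>) ?\<psi> \<chi>"
    using \<chi> \<phi> t dom by (simp add: is_lift_def)
  moreover have "is_lift X \<phi> (cell_left X \<chi>) (cell_right X \<chi>) ?\<psi> \<chi>'"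
    using \<chi> \<phi> t dom tight eq by (simp add: is_lift_def)
  ultimately show ?thesis by blast
qed

lemma lift_cell:
  assumes "cartesian X \<phi>" "f' \<in> tight X" "g' \<in> tight X"
    "tight_cod X f' = tight_dom X (cell_left X \<phi>)" "tight_cod X g' = tight_dom X (cell_right X \<phi>)"
    "\<psi> \<in> cells X" "cell_cod X \<psi> = cell_cod X \<phi>"
    "cell_left X \<psi> = tight_comp X (cell_left X \<phi>) f'" "cell_right X \<psi> = tight_comp X (cell_right X \<phi>) g'"
  shows "lift X \<phi> f' g' \<psi> \<in> cells X \<and> cell_dom X (lift X \<phi> f' g' \<psi>) = cell_dom X \<psi> \<and>
    [cell_cod X (lift X \<phi> f' g' \<psi>)] = cell_dom X \<phi> \<and> cell_left X (lift X \<phi> f' g' \<psi>) = f' \<and>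
    cell_right X (lift X \<phi> f' g' \<psi>) = g' \<and> cell_comp X \<phi> f' [lift X \<phi> f' g' \<psi>] = \<psi>"
proof -
  have "\<exists>!\<chi>. is_lift X \<phi> f' g' \<psi> \<chi>" using assms unfolding cartesian_def by simp
  then have "is_lift X \<phi> f' g' \<psi> (lift X \<phi> f' g' \<psi>)" unfolding lift_def by (rule theI')
  then show ?thesis by (simp add: is_lift_def)
qed

lemma cell_comp_id_Nil [simp]:
  "\<lbrakk>\<phi> \<in> cells X; cell_dom X \<phi> = []; tight_dom X (cell_left X \<phi>) = a\<rbrakk> \<Longrightarrow>
    cell_comp X \<phi> (tight_id X a) [] = \<phi>"
  using cell_comp_id[of \<phi>] by simp

lemma comp_single:
  assumes "\<phi> \<in> cells X" "\<psi> \<in> cells X" "cell_dom X \<phi> = [cell_cod X \<psi>]" "cell_left X \<psi> = g"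
    "cell_chain X f xs (last_tight X f xs)" "map (cell_cod X) xs = cell_dom X \<psi>"
    "tight_cod X f = tight_dom X (cell_left X \<psi>)"
    "tight_cod X g = tight_dom X (cell_left X \<phi>)"
  shows "cell_comp X (cell_comp X \<phi> g [\<psi>]) f xs = cell_comp X \<phi> (tight_comp X g f) [cell_comp X \<psi> f xs]"
  using cell_assoc1[of \<phi> g "[\<psi>]" f "[xs]" xs] assms by simp

text \<open>Composition with \<open>\<phi>\<close> is injective on 2-cells with a given frame, so
  the lifts of \<open>\<psi>\<close> through \<open>\<chi>\<close> are exactly the lifts of its
  composite with \<open>\<phi>\<close> through the composite of \<open>\<phi>\<close> and
  \<open>\<chi>\<close>. This yields that E(f, g) is a restriction of E(1, g) and of E(f,
  1).\<close>

lemma cartesian_factor: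
  assumes \<phi>: "cartesian X \<phi>" and \<chi>: "\<chi> \<in> cells X" "cell_dom X \<phi> = [cell_cod X \<chi>]" "cell_left X \<chi> = f"
    and c: "cartesian X (cell_comp X \<phi> f [\<chi>])"
  shows "cartesian X \<chi>"
proof -
  have \<phi>': "\<phi> \<in> cells X" using \<phi> by (simp add: cartesian_def)
  have t: "tight_dom X (cell_left X \<phi>) = tight_cod X f" "tight_dom X (cell_right X \<phi>) = tight_cod X (cell_right X \<chi>)"
    using cell_dom_chain[OF \<phi>'] \<chi> by (auto simp: tight_cod_cell_left[symmetric] tight_cod_cell_right)
  have f: "f \<in> tight X" using \<chi> by auto
  have len: "length (cell_dom X \<chi>) = 1"
    using c \<chi> \<phi>' t by (simp add: cartesian_def)
  have "\<exists>!\<theta>. is_lift X \<chi> f' g' \<psi> \<theta>"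
    if H: "f' \<in> tight X" "g' \<in> tight X" "tight_cod X f' = tight_dom X f"
       "tight_cod X g' = tight_dom X (cell_right X \<chi>)" "\<psi> \<in> cells X" "cell_cod X \<psi> = cell_cod X \<chi>"
       "cell_left X \<psi> = tight_comp X f f'" "cell_right X \<psi> = tight_comp X (cell_right X \<chi>) g'" for f' g' \<psi>
  proof -
    let ?\<psi> = "cell_comp X \<phi> (tight_comp X f f') [\<psi>]"
    have eq: "cell_comp X (cell_comp X \<phi> f [\<chi>]) f' [\<theta>] = cell_comp X \<phi> (tight_comp X f f') [cell_comp X \<chi> f' [\<theta>]]"
      if "\<theta> \<in> cells X" "[cell_cod X \<theta>] = cell_dom X \<chi>" "cell_left X \<theta> = f'" for \<theta>
      by (rule comp_single) (use that \<chi> \<phi>' t f H in auto)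
    have "is_lift X \<chi> f' g' \<psi> \<theta> \<longleftrightarrow> is_lift X (cell_comp X \<phi> f [\<chi>]) f' g' ?\<psi> \<theta>" for \<theta>
    proof
      assume "is_lift X \<chi> f' g' \<psi> \<theta>"
      then show "is_lift X (cell_comp X \<phi> f [\<chi>]) f' g' ?\<psi> \<theta>"
        using \<chi> \<phi>' t f H eq[of \<theta>] by (auto simp: is_lift_def)
    next
      assume L: "is_lift X (cell_comp X \<phi> f [\<chi>]) f' g' ?\<psi> \<theta>"
      then have \<theta>: "\<theta> \<in> cells X" "[cell_cod X \<theta>] = cell_dom X \<chi>" "cell_left X \<theta> = f'" "cell_right X \<theta> = g'"
        "cell_dom X \<theta> = cell_dom X \<psi>"
        using \<chi> \<phi>' t f H by (simp_all add: is_lift_def)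
      have "cell_comp X \<chi> f' [\<theta>] = \<psi>"
        by (rule cartesian_cancel[OF \<phi>]) (use L \<theta> \<chi> \<phi>' t f H eq[of \<theta>] in \<open>auto simp: is_lift_def\<close>)
      then show "is_lift X \<chi> f' g' \<psi> \<theta>"
        using \<theta> by (simp add: is_lift_def)
    qed
    moreover have "\<exists>!\<theta>. is_lift X (cell_comp X \<phi> f [\<chi>]) f' g' ?\<psi> \<theta>"
    proof -
      have "?\<psi> \<in> cells X" "cell_cod X ?\<psi> = cell_cod X (cell_comp X \<phi> f [\<chi>])"
        "cell_left X ?\<psi> = tight_comp X (cell_left X (cell_comp X \<phi> f [\<chi>])) f'"
        "cell_right X ?\<psi> = tight_comp X (cell_right X (cell_comp X \<phi> f [\<chi>])) g'"
        "tight_dom X (cell_left X (cell_comp X \<phi> f [\<chi>])) = tight_dom X f"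
        "tight_dom X (cell_right X (cell_comp X \<phi> f [\<chi>])) = tight_dom X (cell_right X \<chi>)"
        using \<chi> \<phi>' t f H by (simp_all add: tight_assoc)
      then show ?thesis
        using c H unfolding cartesian_def by simp
    qed
    ultimately show ?thesis by simp
  qed
  then show ?thesis
    using \<chi> len unfolding cartesian_def by simp
qed

end

section \<open>2-cells into a loose-identity\<close>

context virtual_equipment
begin

lemma loose_id_frame [simp]:
  assumes "a \<in> objects X"
  shows "loose_id X a \<in> loose X \<and> loose_src X (loose_id X a) = a \<and> loose_tgt X (loose_id X a) = a \<and>
    loose_id_cell X a \<in> cells X \<and> cell_dom X (loose_id_cell X a) = [] \<and>
    cell_cod X (loose_id_cell X a) = loose_id X a \<and>
    cell_left X (loose_id_cell X a) = tight_id X a \<and> cell_right X (loose_id_cell X a) = tight_id X a \<and>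
    opcartesian X (loose_id_cell X a)"
  using loose_id[OF assms] cell_cod_loose by (fastforce simp: globular_def)

section \<open>The unitor: naturality, unit laws and associativity\<close>

lemma loose_unitor_frame [simp]:
  assumes q: "q \<in> loose X" and a: "loose_tgt X q = a"
  shows "loose_unitor X q \<in> cells X \<and> cell_dom X (loose_unitor X q) = [loose_id X a, q] \<and>
    cell_cod X (loose_unitor X q) = q \<and> cell_left X (loose_unitor X q) = tight_id X a \<and>
    cell_right X (loose_unitor X q) = tight_id X (loose_src X q) \<and>
    cell_comp X (loose_unitor X q) (tight_id X a) [loose_id_cell X a, cell_id X q] = cell_id X q"
proof -
  let ?P = "\<lambda>\<chi>. \<chi> \<in> globular X [loose_id X (loose_tgt X q), q] q \<and>
     gcomp X \<chi> [loose_id_cell X (loose_tgt X q), cell_id X q] = cell_id X q"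
  have ob: "a \<in> objects X" using q a by auto
  have "\<exists>!\<chi>. ?P \<chi>"
  proof (rule ex1_iff[OF opcartesian_ex1[of "loose_id_cell X a" "cell_id X q" "[]" "[q]"]])
    fix \<chi>
    have "cell_left X \<chi> = tight_id X a \<Longrightarrow> gcomp X \<chi> [loose_id_cell X a, cell_id X q] = ctx \<chi> [] [loose_id_cell X a] [q]"
      if "cell_cod X \<chi> = q"
      using that a ob by (simp add: ctx_def gcomp_def)
    then show "(\<chi> \<in> cells X \<and> cell_dom X \<chi> = [] @ [cell_cod X (loose_id_cell X a)] @ [q] \<and>
      cell_cod X \<chi> = cell_cod X (cell_id X q) \<and> cell_left X \<chi> = cell_left X (cell_id X q) \<and>
      cell_right X \<chi> = cell_right X (cell_id X q) \<and> ctx \<chi> [] [loose_id_cell X a] [q] = cell_id X q) \<longleftrightarrow> ?P \<chi>"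
      using a q ob by (auto simp: globular_def)
  qed (use ob a q in simp_all)
  then have "?P (loose_unitor X q)"
    unfolding loose_unitor_def by (rule theI')
  then show ?thesis
    using a by (auto simp: globular_def gcomp_def)
qed

text \<open>The defining equation of the unitor is precomposed with \<open>\<phi>\<close>; the unit
  of \<open>a(1, 1)\<close> then receives the empty block and is thereby whiskered by the left
  tight-cell of \<open>\<phi>\<close>.\<close>

lemma loose_unitor_unit:
  assumes \<phi>: "\<phi> \<in> cells X" "cell_cod X \<phi> = q" "loose_tgt X q = a"
  shows "cell_comp X (loose_unitor X q) (cell_left X \<phi>)
    [cell_comp X (loose_id_cell X a) (cell_left X \<phi>) [], \<phi>] = \<phi>"
proof -
  have ob: "a \<in> objects X" "q \<in> loose X" using \<phi> by auto
  have "cell_comp X (cell_comp X (loose_unitor X q) (tight_id X a) [loose_id_cell X a, cell_id X q])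
      (cell_left X \<phi>) [\<phi>] = cell_comp X (loose_unitor X q) (cell_left X \<phi>)
    [cell_comp X (loose_id_cell X a) (cell_left X \<phi>) [], \<phi>]"
    using ob \<phi> by (subst cell_assoc1[where \<phi>ss = "[[], [\<phi>]]"]) (simp_all add: tight_cod_cell_left)
  then show ?thesis using \<phi> ob by simp
qed

text \<open>Inserting the unit into \<open>a(1, 1)\<close> turns both sides into
  \<open>\<phi>\<close>, which suffices because the unit is opcartesian. The domain may have further
  entries \<open>rs\<close>: the unitor meets only the first one.\<close>

lemma loose_unitor_natural:
  assumes \<phi>: "\<phi> \<in> cells X" "cell_dom X \<phi> = p # rs" "cell_cod X \<phi> = q" "cell_left X \<phi> = tight_id X a"
    and a: "a \<in> objects X"
  shows "cell_comp X (loose_unitor X q) (tight_id X a) [cell_id X (loose_id X a), \<phi>] =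
    ctx \<phi> [] [loose_unitor X p] rs"
proof (rule opcartesian_cancel[of "loose_id_cell X a" _ _ "[]" "p # rs"])
  have q: "q \<in> loose X" "loose_tgt X q = a"
    using \<phi> a tight_cod_cell_left[OF \<phi>(1)] by auto
  have p: "p \<in> loose X" "loose_tgt X p = a" and rs: "loose_chain X (loose_src X p) rs (tight_dom X (cell_right X \<phi>))"
    using cell_dom_chain[OF \<phi>(1)] \<phi> a by auto
  let ?l = "cell_comp X (loose_unitor X q) (tight_id X a) [cell_id X (loose_id X a), \<phi>]"
  let ?r = "ctx \<phi> [] [loose_unitor X p] rs"
  let ?u = "loose_id_cell X a"
  have c: "cell_chain X (tight_id X a) (map (cell_id X) (p # rs)) (tight_id X (tight_dom X (cell_right X \<phi>)))"
    using p rs by (intro cell_chain_ids) simp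
  note r = ctx_cell[of \<phi> "[]" "[p]" rs a "loose_src X p" "[loose_unitor X p]"]
  show "?l \<in> cells X" "?r \<in> cells X" "cell_dom X ?l = [] @ [cell_cod X (loose_id_cell X a)] @ p # rs"
    "cell_dom X ?r = cell_dom X ?l" "cell_cod X ?r = cell_cod X ?l" "cell_left X ?r = cell_left X ?l"
    "cell_right X ?r = cell_right X ?l" "opcartesian X (loose_id_cell X a)"
    using r \<phi> a p q rs tight_cod_cell_right[OF \<phi>(1)] by simp_all
  show "ctx ?l [] [loose_id_cell X a] (p # rs) = ctx ?r [] [loose_id_cell X a] (p # rs)"
  proof -
    have "ctx ?l [] [?u] (p # rs) = cell_comp X ?l (tight_id X a) (?u # map (cell_id X) (p # rs))"
      using \<phi> a p q rs by (simp add: ctx_def)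
    also have "\<dots> = cell_comp X (loose_unitor X q) (tight_id X a) [?u, \<phi>]"
      using \<phi> a p q rs c cell_comp_id[OF \<phi>(1)] loose_chain_loose[OF rs]
      by (subst cell_assoc1[where \<phi>ss = "[[?u], map (cell_id X) (p # rs)]"]) (simp_all add: last_tight_chain)
    also have "\<dots> = \<phi>"
      using loose_unitor_unit[OF \<phi>(1,3) q(2)] a \<phi>(4) by simp
    also have "\<dots> = ctx \<phi> [] (map (cell_id X) [p]) rs"
      using \<phi> by (intro ctx_ids[symmetric]) simp_all
    also have "\<dots> = ctx \<phi> [] (chain_comp X (tight_id X a) [loose_unitor X p] [[?u, cell_id X p]]) rs"
      using p by simp
    also have "\<dots> = ctx ?r [] [?u, cell_id X p] rs"
      by (rule ctx_comp[where qs = "[p]" and b = "loose_src X p", symmetric]) (use \<phi> a p rs in simp_all)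
    also have "\<dots> = ctx ?r [] [?u] (p # rs)"
      by (simp add: ctx_def)
    finally show ?thesis .
  qed
qed

text \<open>\<open>loose_unitor\<close> is by definition only a left unitor. At a loose-identity it
  is a right unitor too: after the unit is inserted into the remaining \<open>a(1, 1)\<close>, both
  sides are the unit.\<close>

lemma loose_unitor_right_unit:
  assumes a: "a \<in> objects X"
  shows "cell_comp X (loose_unitor X (loose_id X a)) (tight_id X a) [cell_id X (loose_id X a), loose_id_cell X a] =
    cell_id X (loose_id X a)"
proof (rule opcartesian_cancel[of "loose_id_cell X a" _ _ "[]" "[]"])
  let ?u = "loose_id_cell X a" and ?I = "loose_id X a"
  let ?l = "cell_comp X (loose_unitor X ?I) (tight_id X a) [cell_id X ?I, ?u]"
  have "ctx ?l [] [?u] [] = cell_comp X (loose_unitor X ?I) (tight_id X a) [?u, ?u]"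
    unfolding ctx_def using a by (simp, subst cell_assoc1[where \<phi>ss = "[[?u], []]"]) simp_all
  also have "\<dots> = ?u"
    using loose_unitor_unit[of ?u ?I a] a by simp
  finally show "ctx ?l [] [?u] [] = ctx (cell_id X ?I) [] [?u] []"
    using a by (simp add: ctx_def)
qed (use a in simp_all)

text \<open>Naturality of the unitor, applied to the unitor itself.\<close>

lemma loose_unitor_assoc:
  assumes a: "a \<in> objects X"
  shows "cell_comp X (loose_unitor X (loose_id X a)) (tight_id X a) [cell_id X (loose_id X a), loose_unitor X (loose_id X a)] =
    cell_comp X (loose_unitor X (loose_id X a)) (tight_id X a) [loose_unitor X (loose_id X a), cell_id X (loose_id X a)]"
  using loose_unitor_natural[of "loose_unitor X (loose_id X a)" "loose_id X a" "[loose_id X a]" _ a] a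
  by (simp add: ctx_def)

lemma rep_cell_frame [simp]:
  assumes f: "f \<in> tight X" "tight_cod X f = E" and g: "g \<in> tight X" "tight_cod X g = E"
  shows "rep_cell X f g \<in> cells X \<and> cell_dom X (rep_cell X f g) = [rep X f g] \<and>
    cell_cod X (rep_cell X f g) = loose_id X E \<and> cell_left X (rep_cell X f g) = f \<and>
    cell_right X (rep_cell X f g) = g \<and> cartesian X (rep_cell X f g)"
  using restriction[of "loose_id X E" f g] f g tight_cod_ob[OF f(1)]
  unfolding rep_cell_def rep_def by (simp add: cartesian_def)

lemma rep_frame [simp]:
  assumes f: "f \<in> tight X" and g: "g \<in> tight X" "tight_cod X g = tight_cod X f"
  shows "rep X f g \<in> loose X \<and> loose_tgt X (rep X f g) = tight_dom X f \<and> loose_src X (rep X f g) = tight_dom X g"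
  using cell_dom_chain[of "rep_cell X f g"] f g by simp

lemma rep_cancel:
  assumes f: "f \<in> tight X" and g: "g \<in> tight X" "tight_cod X g = tight_cod X f"
    and \<chi>: "\<chi> \<in> cells X" "\<chi>' \<in> cells X" "cell_cod X \<chi> = rep X f g" "cell_cod X \<chi>' = rep X f g"
    "cell_dom X \<chi>' = cell_dom X \<chi>" "cell_left X \<chi> = h" "cell_left X \<chi>' = h" "cell_right X \<chi>' = cell_right X \<chi>"
    and eq: "cell_comp X (rep_cell X f g) h [\<chi>] = cell_comp X (rep_cell X f g) h [\<chi>']"
  shows "\<chi> = \<chi>'"
  by (rule cartesian_cancel[of "rep_cell X f g"]) (use assms in simp_all)

text \<open>The unitor \<open>E(1, 1), E(1, 1) \<Rightarrow> E(1, 1)\<close> serves as the multiplication of \<open>E(1, 1)\<close>.\<close>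

definition mul :: "'c \<Rightarrow> 'c \<Rightarrow> 'c" (infixl "\<star>" 70) where
  "\<phi> \<star> \<psi> = cell_comp X (loose_unitor X (cell_cod X \<phi>)) (cell_left X \<phi>) [\<phi>, \<psi>]"

definition one :: "'t \<Rightarrow> 'c" where
  "one f = cell_comp X (loose_id_cell X (tight_cod X f)) f []"

end

section \<open>The algebra of 2-cells into E(1, 1)\<close>

locale equipment_over = virtual_equipment +
  fixes E
  assumes E [simp]: "E \<in> objects X"
begin

abbreviation I where "I \<equiv> loose_id X E"

definition slice :: "'b set" where
  "slice = {f \<in> tight X. tight_cod X f = E}"

definition hets :: "'d set" where
  "hets = {\<phi> \<in> cells X. cell_cod X \<phi> = I}"

lemma sliceD [simp]: "f \<in> slice \<Longrightarrow> f \<in> tight X" "f \<in> slice \<Longrightarrow> tight_cod X f = E"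
  by (simp_all add: slice_def)

lemma tight_id_slice [simp]: "tight_id X E \<in> slice"
  by (simp add: slice_def del: sliceD)

lemma hetsD [simp]: "\<phi> \<in> hets \<Longrightarrow> \<phi> \<in> cells X" "\<phi> \<in> hets \<Longrightarrow> cell_cod X \<phi> = I"
  by (simp_all add: hets_def)

lemma hets_slice [simp]: "\<phi> \<in> hets \<Longrightarrow> cell_left X \<phi> \<in> slice" "\<phi> \<in> hets \<Longrightarrow> cell_right X \<phi> \<in> slice"
  by (simp_all add: hets_def slice_def tight_cod_cell_left tight_cod_cell_right del: hetsD sliceD)

lemma one_frame [simp]:
  "f \<in> slice \<Longrightarrow> one f \<in> hets \<and> cell_dom X (one f) = [] \<and> cell_left X (one f) = f \<and> cell_right X (one f) = f"
  by (simp add: one_def hets_def del: hetsD)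

lemma mul_frame [simp]:
  "\<lbrakk>\<phi> \<in> hets; \<psi> \<in> hets; cell_right X \<phi> = cell_left X \<psi>\<rbrakk> \<Longrightarrow> \<phi> \<star> \<psi> \<in> hets \<and>
    cell_dom X (\<phi> \<star> \<psi>) = cell_dom X \<phi> @ cell_dom X \<psi> \<and>
    cell_left X (\<phi> \<star> \<psi>) = cell_left X \<phi> \<and> cell_right X (\<phi> \<star> \<psi>) = cell_right X \<psi>"
  using hets_slice[of \<phi>] hets_slice[of \<psi>] by (simp add: mul_def hets_def del: hetsD hets_slice)

lemma comp_hets [simp]:
  "\<lbrakk>\<phi> \<in> hets; cell_chain X f xs (last_tight X f xs); map (cell_cod X) xs = cell_dom X \<phi>;
    tight_cod X f = tight_dom X (cell_left X \<phi>)\<rbrakk> \<Longrightarrow> cell_comp X \<phi> f xs \<in> hets"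
  by (simp add: hets_def del: hetsD)

text \<open>By associativity, precomposition acts on the two factors separately. The chain for the
  second factor starts at the tight-cell where the chain for the first one ends.\<close>

lemma mul_comp:
  assumes "\<phi> \<in> hets" "\<psi> \<in> hets" "cell_right X \<phi> = cell_left X \<psi>"
    "cell_chain X f xs (last_tight X f xs)" "map (cell_cod X) xs = cell_dom X \<phi>"
    "cell_chain X (last_tight X f xs) ys (last_tight X (last_tight X f xs) ys)" "map (cell_cod X) ys = cell_dom X \<psi>"
    "tight_cod X f = tight_dom X (cell_left X \<phi>)"
  shows "cell_comp X (\<phi> \<star> \<psi>) f (xs @ ys) = cell_comp X \<phi> f xs \<star> cell_comp X \<psi> (last_tight X f xs) ys"
  unfolding mul_def using assms
  by (subst cell_assoc1[where \<phi>ss = "[xs, ys]"])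
    (simp_all add: cell_chain_append)

lemma one_mul [simp]: "\<lbrakk>\<phi> \<in> hets; cell_left X \<phi> = f\<rbrakk> \<Longrightarrow> one f \<star> \<phi> = \<phi>"
  using loose_unitor_unit[of \<phi> I E] by (auto simp: mul_def one_def)

lemma mul_one [simp]:
  assumes \<phi>: "\<phi> \<in> hets" and g: "cell_right X \<phi> = g"
  shows "\<phi> \<star> one g = \<phi>"
proof -
  have "cell_comp X (cell_comp X (loose_unitor X I) (tight_id X E) [cell_id X I, loose_id_cell X E])
      (cell_left X \<phi>) [\<phi>] = cell_comp X (loose_unitor X I) (cell_left X \<phi>) [\<phi>, one g]"
    using g \<phi> by (subst cell_assoc1[where \<phi>ss = "[[\<phi>], []]"]) (auto simp: one_def)
  then show ?thesis
    using \<phi> by (simp add: loose_unitor_right_unit mul_def)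
qed

lemma mul_assoc:
  assumes \<phi>: "\<phi> \<in> hets" "\<psi> \<in> hets" "\<theta> \<in> hets" "cell_right X \<phi> = cell_left X \<psi>" "cell_right X \<psi> = cell_left X \<theta>"
  shows "(\<phi> \<star> \<psi>) \<star> \<theta> = \<phi> \<star> (\<psi> \<star> \<theta>)"
proof -
  let ?m = "loose_unitor X I" and ?i = "cell_id X I" and ?e = "tight_id X E"
  have "\<phi> \<star> \<psi> \<star> \<theta> = cell_comp X (cell_comp X ?m ?e [?m, ?i]) (cell_left X \<phi>) [\<phi>, \<psi>, \<theta>]"
    using \<phi> by (subst cell_assoc1[where \<phi>ss = "[[\<phi>, \<psi>], [\<theta>]]"]) (simp_all, simp add: mul_def)
  also have "\<dots> = cell_comp X (cell_comp X ?m ?e [?i, ?m]) (cell_left X \<phi>) [\<phi>, \<psi>, \<theta>]"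
    by (simp add: loose_unitor_assoc)
  also have "\<dots> = \<phi> \<star> (\<psi> \<star> \<theta>)"
    using \<phi> by (subst cell_assoc1[where \<phi>ss = "[[\<phi>], [\<psi>, \<theta>]]"]) (simp_all, simp add: mul_def)
  finally show ?thesis .
qed

lemma rep_cell_hets [simp]: "\<lbrakk>f \<in> slice; g \<in> slice\<rbrakk> \<Longrightarrow> rep_cell X f g \<in> hets"
  by (simp add: hets_def del: hetsD)

lemma lift_rep_cell:
  assumes f: "f \<in> slice" and g: "g \<in> slice" and \<psi>: "\<psi> \<in> hets"
    and f': "f' \<in> tight X" "tight_cod X f' = tight_dom X f" "cell_left X \<psi> = tight_comp X f f'"
    and g': "g' \<in> tight X" "tight_cod X g' = tight_dom X g" "cell_right X \<psi> = tight_comp X g g'"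
  shows "lift X (rep_cell X f g) f' g' \<psi> \<in> cells X \<and>
    cell_dom X (lift X (rep_cell X f g) f' g' \<psi>) = cell_dom X \<psi> \<and>
    cell_cod X (lift X (rep_cell X f g) f' g' \<psi>) = rep X f g \<and>
    cell_left X (lift X (rep_cell X f g) f' g' \<psi>) = f' \<and>
    cell_right X (lift X (rep_cell X f g) f' g' \<psi>) = g' \<and>
    cell_comp X (rep_cell X f g) f' [lift X (rep_cell X f g) f' g' \<psi>] = \<psi>"
  using lift_cell[of "rep_cell X f g" f' g' \<psi>] assms by simp

section \<open>Companions, conjoints and the Yoneda lemma\<close>

abbreviation id\<^sub>E where "id\<^sub>E \<equiv> tight_id X E"

text \<open>Together with the cartesian 2-cell E(1, t) \<Rightarrow> E(1, 1), this nullary 2-cell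
  with left \<open>t\<close> and right an identity makes E(1, t) the companion of \<open>t\<close>.
  Precomposition with it plays the part of evaluation at the universal element.\<close>

definition companion_unit :: "'b \<Rightarrow> 'd" where
  "companion_unit t = lift X (rep_cell X id\<^sub>E t) t (dom_id X t) (one t)"

definition conjoint_unit :: "'b \<Rightarrow> 'd" where
  "conjoint_unit t = lift X (rep_cell X t id\<^sub>E) (dom_id X t) t (one t)"

lemma companion_unit_frame [simp]:
  "t \<in> slice \<Longrightarrow> companion_unit t \<in> cells X \<and> cell_dom X (companion_unit t) = [] \<and>
    cell_cod X (companion_unit t) = rep X id\<^sub>E t \<and> cell_left X (companion_unit t) = t \<and>
    cell_right X (companion_unit t) = dom_id X t \<and>
    cell_comp X (rep_cell X id\<^sub>E t) t [companion_unit t] = one t"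
  using lift_rep_cell[of "id\<^sub>E" t "one t" t "dom_id X t"] by (simp add: companion_unit_def)

lemma conjoint_unit_frame [simp]:
  "t \<in> slice \<Longrightarrow> conjoint_unit t \<in> cells X \<and> cell_dom X (conjoint_unit t) = [] \<and>
    cell_cod X (conjoint_unit t) = rep X t id\<^sub>E \<and> cell_left X (conjoint_unit t) = dom_id X t \<and>
    cell_right X (conjoint_unit t) = t \<and>
    cell_comp X (rep_cell X t id\<^sub>E) (dom_id X t) [conjoint_unit t] = one t"
  using lift_rep_cell[of t "id\<^sub>E" "one t" "dom_id X t" t] by (simp add: conjoint_unit_def)

text \<open>The second companion identity; the first one is the last conclusion of
  \<open>companion_unit_frame\<close>. Over E(1, 1), naturality of the unitor turns the left-hand
  side into \<open>rep_cell X id\<^sub>E t \<star> one t\<close>, where the unit drops out.\<close>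

lemma companion_zigzag:
  assumes t: "t \<in> slice"
  shows "cell_comp X (loose_unitor X (rep X id\<^sub>E t)) id\<^sub>E [rep_cell X id\<^sub>E t, companion_unit t] =
    cell_id X (rep X id\<^sub>E t)"
proof (rule rep_cancel[of "id\<^sub>E" t _ _ "id\<^sub>E"])
  let ?k = "loose_unitor X (rep X id\<^sub>E t)" and ?e = "rep_cell X id\<^sub>E t"
  have "cell_comp X ?e id\<^sub>E [cell_comp X ?k id\<^sub>E [?e, companion_unit t]] =
      cell_comp X (cell_comp X ?e id\<^sub>E [?k]) id\<^sub>E [?e, companion_unit t]"
    using t by (subst comp_single) simp_all
  also have "cell_comp X ?e id\<^sub>E [?k] = cell_comp X (loose_unitor X I) id\<^sub>E [cell_id X I, ?e]"
    using loose_unitor_natural[of ?e "rep X id\<^sub>E t" "[]" I E] t by (simp add: ctx_def)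
  also have "cell_comp X \<dots> id\<^sub>E [?e, companion_unit t] = ?e \<star> one t"
    using t by (subst cell_assoc1[where \<phi>ss = "[[?e], [companion_unit t]]"]) (simp_all add: mul_def)
  also have "\<dots> = cell_comp X ?e id\<^sub>E [cell_id X (rep X id\<^sub>E t)]"
    using t by simp
  finally show "cell_comp X ?e id\<^sub>E [cell_comp X ?k id\<^sub>E [?e, companion_unit t]] = \<dots>" .
qed (use t in simp_all)

text \<open>Only a left unitor is defined, so the right action of E(1, 1) on E(t, 1) is made here by
  factoring an identity through the unit. The last conclusion is the mirror image of
  \<open>companion_zigzag\<close>.\<close>

lemma conjoint_right_unitor:
  assumes t: "t \<in> slice"
  obtains k where "k \<in> cells X" "cell_dom X k = [rep X t id\<^sub>E, I]" "cell_cod X k = rep X t id\<^sub>E"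
    "cell_left X k = dom_id X t" "cell_right X k = id\<^sub>E"
    "cell_comp X k (dom_id X t) [cell_id X (rep X t id\<^sub>E), loose_id_cell X E] = cell_id X (rep X t id\<^sub>E)"
    "cell_comp X k (dom_id X t) [conjoint_unit t, rep_cell X t id\<^sub>E] = cell_id X (rep X t id\<^sub>E)"
proof -
  let ?p = "rep X t id\<^sub>E" and ?u = "loose_id_cell X E" and ?d = "dom_id X t" and ?e = "rep_cell X t id\<^sub>E"
  obtain k where k: "k \<in> cells X" "cell_dom X k = [?p, I]" "cell_cod X k = ?p"
    "cell_left X k = ?d" "cell_right X k = id\<^sub>E" "ctx k [?p] [?u] [] = cell_id X ?p"
    using opcartesian_factor[of ?u "cell_id X ?p" "[?p]" "[]"] t by auto
  then have ku: "cell_comp X k ?d [cell_id X ?p, ?u] = cell_id X ?p"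
    using t by (simp add: ctx_def)
  \<comment> \<open>The action agrees with the multiplication of E(1, 1), as is seen on the unit.
    This takes the place of naturality of the left unitor.\<close>
  have nat: "cell_comp X ?e ?d [k] = cell_comp X (loose_unitor X I) t [?e, cell_id X I]"
  proof (rule opcartesian_cancel[of ?u _ _ "[?p]" "[]"])
    have "ctx (cell_comp X ?e ?d [k]) [?p] [?u] [] = cell_comp X (cell_comp X ?e ?d [k]) ?d [cell_id X ?p, ?u]"
      using t k by (simp add: ctx_def)
    also have "\<dots> = ?e"
      using t k ku by (subst comp_single) simp_all
    also have "\<dots> = ?e \<star> one id\<^sub>E" using t by simp
    also have "\<dots> = cell_comp X (cell_comp X (loose_unitor X I) t [?e, cell_id X I]) ?d [cell_id X ?p, ?u]"
      using t by (subst cell_assoc1[where \<phi>ss = "[[cell_id X ?p], [?u]]"]) (simp_all add: mul_def one_def)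
    also have "\<dots> = ctx (cell_comp X (loose_unitor X I) t [?e, cell_id X I]) [?p] [?u] []"
      using t by (simp add: ctx_def)
    finally show "ctx (cell_comp X ?e ?d [k]) [?p] [?u] [] = \<dots>" .
  qed (use k t in simp_all)
  have "cell_comp X k ?d [conjoint_unit t, ?e] = cell_id X ?p"
  proof (rule rep_cancel[of t "id\<^sub>E" _ _ ?d])
    have "cell_comp X ?e ?d [cell_comp X k ?d [conjoint_unit t, ?e]] =
        cell_comp X (cell_comp X ?e ?d [k]) ?d [conjoint_unit t, ?e]"
      using t k by (subst comp_single) simp_all
    also have "\<dots> = one t \<star> ?e"
      unfolding nat
      using t by (subst cell_assoc1[where \<phi>ss = "[[conjoint_unit t], [?e]]"]) (simp_all add: mul_def)
    also have "\<dots> = cell_comp X ?e ?d [cell_id X ?p]"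
      using t by simp
    finally show "cell_comp X ?e ?d [cell_comp X k ?d [conjoint_unit t, ?e]] = \<dots>" .
  qed (use k t in simp_all)
  then show ?thesis using that k ku by blast
qed

text \<open>One half of the Yoneda lemma: naturality of the unitor replaces the product by a unitor
  inserted at the first entry E(1, t), where \<open>companion_zigzag\<close> cancels it.\<close>

lemma yoneda_eq:
  assumes t: "t \<in> slice" and \<phi>: "\<phi> \<in> hets" "cell_dom X \<phi> = rep X id\<^sub>E t # rs" "cell_left X \<phi> = id\<^sub>E"
  shows "rep_cell X id\<^sub>E t \<star> cell_comp X \<phi> t (companion_unit t # map (cell_id X) rs) = \<phi>"
proof -
  let ?e = "rep_cell X id\<^sub>E t" and ?n = "companion_unit t" and ?b = "tight_dom X (cell_right X \<phi>)"
  have rs: "loose_chain X (tight_dom X t) rs ?b"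
    using cell_dom_chain[of \<phi>] \<phi> t by auto
  note ids = cell_chain_ids[OF rs] loose_chain_loose[OF rs]
  have "?e \<star> cell_comp X \<phi> t (?n # map (cell_id X) rs) =
      cell_comp X (cell_comp X (loose_unitor X I) id\<^sub>E [cell_id X I, \<phi>]) id\<^sub>E ([?e, ?n] @ map (cell_id X) rs)"
    using t \<phi> ids
    by (subst cell_assoc1[where \<phi>ss = "[[?e], ?n # map (cell_id X) rs]"]) (simp_all add: last_tight_chain mul_def)
  also have "\<dots> = ctx (ctx \<phi> [] [loose_unitor X (rep X id\<^sub>E t)] rs) [] [?e, ?n] rs"
    using loose_unitor_natural[of \<phi> _ rs I E] \<phi> t ctx_cell[of \<phi> "[]" "[rep X id\<^sub>E t]" rs E "tight_dom X t" "[loose_unitor X (rep X id\<^sub>E t)]"] rs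
    by (simp add: ctx_def[of _ "[]" "[?e, ?n]"])
  also have "\<dots> = ctx \<phi> [] (chain_comp X id\<^sub>E [loose_unitor X (rep X id\<^sub>E t)] [[?e, ?n]]) rs"
    by (rule ctx_comp[where qs = "[rep X id\<^sub>E t]" and b = "tight_dom X t"]) (use \<phi> t rs in simp_all)
  also have "\<dots> = ctx \<phi> [] (map (cell_id X) [rep X id\<^sub>E t]) rs"
    using t by (simp add: companion_zigzag)
  also have "\<dots> = \<phi>"
    using \<phi> by (intro ctx_ids) simp_all
  finally show ?thesis .
qed

text \<open>The other half: precomposition splits over the product, and the first factor evaluates
  to \<open>one t\<close>.\<close>

lemma yoneda_comp:
  assumes t: "t \<in> slice" and \<phi>: "\<phi> \<in> hets" "cell_left X \<phi> = t"
  shows "cell_comp X (rep_cell X id\<^sub>E t \<star> \<phi>) t (companion_unit t # map (cell_id X) (cell_dom X \<phi>)) = \<phi>"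
proof -
  let ?b = "tight_dom X (cell_right X \<phi>)"
  have rs: "loose_chain X (tight_dom X t) (cell_dom X \<phi>) ?b"
    using cell_dom_chain[of \<phi>] \<phi> t by auto
  note ids = cell_chain_ids[OF rs] loose_chain_loose[OF rs]
  have "cell_comp X (rep_cell X id\<^sub>E t \<star> \<phi>) t ([companion_unit t] @ map (cell_id X) (cell_dom X \<phi>)) =
      cell_comp X (rep_cell X id\<^sub>E t) t [companion_unit t] \<star>
      cell_comp X \<phi> (last_tight X t [companion_unit t]) (map (cell_id X) (cell_dom X \<phi>))"
    by (rule mul_comp) (use t \<phi> ids in \<open>simp_all add: last_tight_chain\<close>)
  then show ?thesis
    using cell_comp_id[of \<phi>] t \<phi> by simp
qed

lemma yoneda_cancel:
  assumes "t \<in> slice" "\<phi> \<in> hets" "\<psi> \<in> hets" "cell_left X \<phi> = t" "cell_left X \<psi> = t" "cell_dom X \<psi> = cell_dom X \<phi>"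
    and eq: "rep_cell X id\<^sub>E t \<star> \<phi> = rep_cell X id\<^sub>E t \<star> \<psi>"
  shows "\<phi> = \<psi>"
  using yoneda_comp[of t \<phi>] yoneda_comp[of t \<psi>] assms by simp

section \<open>Restrictions of E(1, 1) and their loose-composites\<close>

lemma frown_frame [simp]:
  "\<lbrakk>f \<in> slice; tight_dom X f = a\<rbrakk> \<Longrightarrow> frown X f \<in> cells X \<and> cell_dom X (frown X f) = [] \<and>
    cell_cod X (frown X f) = rep X f f \<and> cell_left X (frown X f) = tight_id X a \<and>
    cell_right X (frown X f) = tight_id X a \<and>
    cell_comp X (rep_cell X f f) (tight_id X a) [frown X f] = one f"
  using lift_rep_cell[of f f "one f" "dom_id X f" "dom_id X f"] unfolding frown_def one_def[symmetric] by auto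

lemma smile_eq: "t \<in> slice \<Longrightarrow> smile X t = rep_cell X id\<^sub>E t \<star> rep_cell X t id\<^sub>E"
  by (simp add: smile_def mul_def gcomp_def)

lemma rep_cell_left_frame [simp]:
  "\<lbrakk>f \<in> slice; g \<in> slice\<rbrakk> \<Longrightarrow> rep_cell_left X f g \<in> cells X \<and> cell_dom X (rep_cell_left X f g) = [rep X f g] \<and>
    cell_cod X (rep_cell_left X f g) = rep X id\<^sub>E g \<and> cell_left X (rep_cell_left X f g) = f \<and>
    cell_right X (rep_cell_left X f g) = dom_id X g \<and>
    cell_comp X (rep_cell X id\<^sub>E g) f [rep_cell_left X f g] = rep_cell X f g"
  using lift_rep_cell[of "id\<^sub>E" g "rep_cell X f g" f "dom_id X g"] by (simp add: rep_cell_left_def)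

lemma rep_cell_right_frame [simp]:
  "\<lbrakk>f \<in> slice; g \<in> slice; tight_dom X f = a\<rbrakk> \<Longrightarrow> rep_cell_right X f g \<in> cells X \<and>
    cell_dom X (rep_cell_right X f g) = [rep X f g] \<and>
    cell_cod X (rep_cell_right X f g) = rep X f id\<^sub>E \<and> cell_left X (rep_cell_right X f g) = tight_id X a \<and>
    cell_right X (rep_cell_right X f g) = g \<and>
    cell_comp X (rep_cell X f id\<^sub>E) (tight_id X a) [rep_cell_right X f g] = rep_cell X f g"
  using lift_rep_cell[of f "id\<^sub>E" "rep_cell X f g" "dom_id X f" g] by (auto simp: rep_cell_right_def)

lemma cartesian_rep_cell_left: "\<lbrakk>f \<in> slice; g \<in> slice\<rbrakk> \<Longrightarrow> cartesian X (rep_cell_left X f g)"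
  by (rule cartesian_factor[of "rep_cell X id\<^sub>E g" _ f]) simp_all

lemma cartesian_rep_cell_right: "\<lbrakk>f \<in> slice; g \<in> slice\<rbrakk> \<Longrightarrow> cartesian X (rep_cell_right X f g)"
  by (rule cartesian_factor[of "rep_cell X f id\<^sub>E" _ "dom_id X f"]) simp_all

text \<open>In the definition, \<open>smile\<close> is restricted along \<open>x\<close> and
  \<open>y\<close> by way of E(1, t) and E(t, 1). Over E(1, 1) all this collapses to a product of
  two cartesian 2-cells, the only description of \<open>smile_at\<close> used in
  calculations.\<close>

lemma smile_at_frame [simp]:
  assumes t: "t \<in> slice" and x: "x \<in> slice" "tight_dom X x = a" and y: "y \<in> slice"
  shows "smile_at X t x y \<in> cells X \<and> cell_dom X (smile_at X t x y) = [rep X x t, rep X t y] \<and>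
    cell_cod X (smile_at X t x y) = rep X x y \<and> cell_left X (smile_at X t x y) = tight_id X a \<and>
    cell_right X (smile_at X t x y) = dom_id X y \<and>
    cell_comp X (rep_cell X x y) (tight_id X a) [smile_at X t x y] = rep_cell X x t \<star> rep_cell X t y"
proof -
  have "cell_comp X (smile X t) x ([rep_cell_left X x t] @ [rep_cell_right X t y]) =
      cell_comp X (rep_cell X id\<^sub>E t) x [rep_cell_left X x t] \<star>
      cell_comp X (rep_cell X t id\<^sub>E) (last_tight X x [rep_cell_left X x t]) [rep_cell_right X t y]"
    unfolding smile_eq[OF t] by (rule mul_comp) (use t x y in simp_all)
  also have "\<dots> = rep_cell X x t \<star> rep_cell X t y"
    using t x y by simp
  finally show ?thesis
    using lift_rep_cell[of x y "rep_cell X x t \<star> rep_cell X t y" "dom_id X x" "dom_id X y"] t x y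
    by (auto simp: smile_at_def)
qed

text \<open>The key is a triple from E(f, g) to E(f, 1), E(1, 1), E(1, g): the conjoint unit of
  \<open>f\<close>, the cartesian 2-cell of E(f, g) and the companion unit of \<open>g\<close>. For
  existence, E(1, 1) is inserted between E(f, 1) and E(1, g) and the result is precomposed with the
  triple; the zigzag identities give back \<open>\<psi>\<close>. For uniqueness, the triple is
  followed by a 2-cell back to E(f, g) and the composite is the identity.\<close>

lemma smile_at_opcartesian:
  assumes f: "f \<in> slice" and g: "g \<in> slice"
  shows "opcartesian X (smile_at X id\<^sub>E f g)"
proof -
  let ?p = "rep X f id\<^sub>E" and ?r = "rep X id\<^sub>E g" and ?q = "rep X f g" and ?c = "smile_at X id\<^sub>E f g"
  let ?a = "tight_dom X f" and ?b = "tight_dom X g"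
  let ?u = "loose_id_cell X E" and ?\<epsilon> = "rep_cell X f id\<^sub>E" and ?\<delta> = "rep_cell X id\<^sub>E g"
  let ?\<eta> = "conjoint_unit f" and ?\<theta> = "companion_unit g" and ?k = "loose_unitor X (rep X id\<^sub>E g)"
  obtain l where l: "l \<in> cells X" "cell_dom X l = [rep X f id\<^sub>E, I]" "cell_cod X l = rep X f id\<^sub>E"
    "cell_left X l = dom_id X f" "cell_right X l = id\<^sub>E"
    "cell_comp X l (dom_id X f) [cell_id X (rep X f id\<^sub>E), loose_id_cell X E] = cell_id X (rep X f id\<^sub>E)"
    "cell_comp X l (dom_id X f) [conjoint_unit f, rep_cell X f id\<^sub>E] = cell_id X (rep X f id\<^sub>E)"
    using conjoint_right_unitor[OF f] .
  have ex: "\<exists>\<chi>. \<chi> \<in> cells X \<and> cell_dom X \<chi> = ps @ [?q] @ rs \<and> cell_cod X \<chi> = cell_cod X \<psi> \<and>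
      cell_left X \<chi> = cell_left X \<psi> \<and> cell_right X \<chi> = cell_right X \<psi> \<and> ctx \<chi> ps [?c] rs = \<psi>"
    if \<psi>: "\<psi> \<in> cells X" "cell_dom X \<psi> = ps @ [?p, ?r] @ rs"
      and ps: "loose_chain X (tight_dom X (cell_left X \<psi>)) ps ?a" for \<psi> ps rs
  proof -
    have rs: "loose_chain X ?b rs (tight_dom X (cell_right X \<psi>))"
      using cell_dom_chain[OF \<psi>(1)] f g \<psi>(2) by (auto simp: loose_chain_append)
    have psp: "loose_chain X (tight_dom X (cell_left X \<psi>)) (ps @ [?p]) E"
      using ps f by (auto simp: loose_chain_append)
    obtain \<psi>1 where \<psi>1: "\<psi>1 \<in> cells X" "cell_dom X \<psi>1 = (ps @ [?p]) @ [I] @ ?r # rs" "cell_cod X \<psi>1 = cell_cod X \<psi>"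
      "cell_left X \<psi>1 = cell_left X \<psi>" "cell_right X \<psi>1 = cell_right X \<psi>" "ctx \<psi>1 (ps @ [?p]) [?u] (?r # rs) = \<psi>"
      using opcartesian_factor[of ?u \<psi> "ps @ [?p]" "?r # rs"] \<psi> psp by auto
    let ?m = "loose_unitor X I"
    let ?\<chi> = "ctx \<psi>1 ps [?\<eta>, rep_cell X f g, ?\<theta>] rs"
    let ?A = "ctx \<psi>1 ps [cell_id X ?p, ?m, cell_id X ?r] rs"
    let ?B = "ctx \<psi> ps [l, ?k] rs" and ?C = "ctx \<psi> ps [cell_id X ?p, ?k] rs"
    have ps1: "loose_chain X (tight_dom X (cell_left X \<psi>1)) ps ?a"
      and rs1: "loose_chain X ?b rs (tight_dom X (cell_right X \<psi>1))"
      and dom1: "cell_dom X \<psi>1 = ps @ [?p, I, ?r] @ rs"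
      using ps rs \<psi>1 by simp_all
    have k: "cell_comp X ?k id\<^sub>E [cell_id X I, cell_id X ?r] = ?k"
      using cell_comp_id[of ?k] g by simp
    note \<chi> = ctx_cell[OF \<psi>1(1) dom1 ps1 rs1, of "[?\<eta>, rep_cell X f g, ?\<theta>]"]
    note A = ctx_cell[OF \<psi>1(1) dom1 ps1 rs1, of "[cell_id X ?p, ?m, cell_id X ?r]"]
    note B = ctx_cell[OF \<psi>(1,2) ps rs, of "[l, ?k]"] and C = ctx_cell[OF \<psi>(1,2) ps rs, of "[cell_id X ?p, ?k]"]
    \<comment> \<open>Explicitly, the inserted E(1, 1) is absorbed by E(1, g) through the left
      unitor.\<close>
    have "\<psi>1 = ?C"
    proof (rule opcartesian_cancel[of ?u _ _ "ps @ [?p]" "?r # rs"])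
      have "ctx ?C (ps @ [?p]) [?u] (?r # rs) = ctx ?C ps [cell_id X ?p, ?u, cell_id X ?r] rs"
        by (simp add: ctx_def)
      also have "\<dots> = ctx \<psi> ps (chain_comp X (tight_id X ?a) [cell_id X ?p, ?k] [[cell_id X ?p], [?u, cell_id X ?r]]) rs"
        by (rule ctx_comp[OF \<psi>(1,2) ps rs]) (use f g in simp_all)
      also have "\<dots> = ctx \<psi> ps (map (cell_id X) [?p, ?r]) rs"
        using f g by simp
      also have "\<dots> = \<psi>"
        using \<psi> by (intro ctx_ids) simp_all
      finally show "ctx \<psi>1 (ps @ [?p]) [?u] (?r # rs) = ctx ?C (ps @ [?p]) [?u] (?r # rs)"
        using \<psi>1 by simp
    qed (use C \<psi>1 f g in simp_all)
    \<comment> \<open>Two adjacent copies of E(1, 1) may be multiplied with each other or absorbed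
      one on each side. Inserting the unit into the first copy reduces both sides to
      \<open>\<psi>1\<close>.\<close>
    have "?A = ?B"
    proof (rule opcartesian_cancel[of ?u _ _ "ps @ [?p]" "I # ?r # rs"])
      have "ctx ?A (ps @ [?p]) [?u] (I # ?r # rs) = ctx ?A ps [cell_id X ?p, ?u, cell_id X I, cell_id X ?r] rs"
        by (simp add: ctx_def)
      also have "\<dots> = ctx \<psi>1 ps (chain_comp X (tight_id X ?a) [cell_id X ?p, ?m, cell_id X ?r]
          [[cell_id X ?p], [?u, cell_id X I], [cell_id X ?r]]) rs"
        by (rule ctx_comp[OF \<psi>1(1) dom1 ps1 rs1]) (use f g in simp_all)
      also have "\<dots> = ctx \<psi>1 ps (map (cell_id X) [?p, I, ?r]) rs"
        using f g by simp
      also have "\<dots> = \<psi>1"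
        using \<psi>1 by (intro ctx_ids) simp_all
      also have "\<dots> = ctx \<psi> ps (chain_comp X (tight_id X ?a) [l, ?k] [[cell_id X ?p, ?u], [cell_id X I, cell_id X ?r]]) rs"
        using f g l k \<open>\<psi>1 = ?C\<close> by simp
      also have "\<dots> = ctx ?B ps [cell_id X ?p, ?u, cell_id X I, cell_id X ?r] rs"
        by (rule ctx_comp[OF \<psi>(1,2) ps rs, symmetric]) (use f g l in simp_all)
      also have "\<dots> = ctx ?B (ps @ [?p]) [?u] (I # ?r # rs)"
        by (simp add: ctx_def)
      finally show "ctx ?A (ps @ [?p]) [?u] (I # ?r # rs) = \<dots>" .
    qed (use A B \<psi>1 f g l in simp_all)
    have "ctx ?\<chi> ps [?c] rs = ctx \<psi>1 ps (chain_comp X (tight_id X ?a) [?\<eta>, rep_cell X f g, ?\<theta>] [[], [?c], []]) rs"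
      by (rule ctx_comp[OF \<psi>1(1) dom1 ps1 rs1]) (use f g in simp_all)
    also have "\<dots> = ctx \<psi>1 ps (chain_comp X (tight_id X ?a) [cell_id X ?p, ?m, cell_id X ?r] [[?\<eta>], [?\<epsilon>, ?\<delta>], [?\<theta>]]) rs"
      using f g by (simp add: mul_def)
    also have "\<dots> = ctx ?A ps [?\<eta>, ?\<epsilon>, ?\<delta>, ?\<theta>] rs"
      by (rule ctx_comp[OF \<psi>1(1) dom1 ps1 rs1, symmetric]) (use f g in simp_all)
    also have "\<dots> = ctx \<psi> ps (chain_comp X (tight_id X ?a) [l, ?k] [[?\<eta>, ?\<epsilon>], [?\<delta>, ?\<theta>]]) rs"
      unfolding \<open>?A = ?B\<close> by (rule ctx_comp[OF \<psi>(1,2) ps rs]) (use f g l in simp_all)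
    also have "\<dots> = ctx \<psi> ps (map (cell_id X) [?p, ?r]) rs"
      using f g l by (simp add: companion_zigzag)
    also have "\<dots> = \<psi>"
      using \<psi> by (intro ctx_ids) simp_all
    finally have "ctx ?\<chi> ps [?c] rs = \<psi>" .
    then show ?thesis
      using \<chi> \<psi>1 f g by (intro exI[of _ ?\<chi>]) simp
  qed
  have un: "\<chi> = \<chi>'"
    if \<chi>: "\<chi> \<in> cells X" "cell_dom X \<chi> = ps @ [?q] @ rs" "\<chi>' \<in> cells X" "cell_dom X \<chi>' = cell_dom X \<chi>"
      "cell_cod X \<chi>' = cell_cod X \<chi>" "cell_left X \<chi>' = cell_left X \<chi>" "cell_right X \<chi>' = cell_right X \<chi>"
      "ctx \<chi> ps [?c] rs = ctx \<chi>' ps [?c] rs" for \<chi> \<chi>' ps rs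
  proof -
    \<comment> \<open>\<open>c\<close> composes E(f, 1), E(1, 1), E(1, g) to E(f, g). Inserting the
      unit into it gives \<open>?c\<close>, so a composite with \<open>?c\<close> determines the one
      with \<open>c\<close>; precomposing the latter with the triple recovers the original
      2-cell.\<close>
    let ?h = "?\<epsilon> \<star> cell_id X I \<star> ?\<delta>"
    define c where "c = lift X (rep_cell X f g) (tight_id X ?a) (tight_id X ?b) ?h"
    have u: "?u \<in> hets" by (simp add: hets_def del: hetsD)
    have I: "cell_id X I \<in> hets" by (simp add: hets_def del: hetsD)
    have c: "c \<in> cells X" "cell_dom X c = [?p, I, ?r]" "cell_cod X c = ?q" "cell_left X c = tight_id X ?a"
      "cell_right X c = tight_id X ?b" "cell_comp X (rep_cell X f g) (tight_id X ?a) [c] = ?h"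
      using lift_rep_cell[of f g ?h "tight_id X ?a" "tight_id X ?b"] f g I by (simp_all add: c_def)
    have h1: "cell_comp X ?h (tight_id X ?a) (([x] @ [y]) @ [z]) =
        cell_comp X ?\<epsilon> (tight_id X ?a) [x] \<star> y \<star> cell_comp X ?\<delta> (cell_right X y) [z]"
      if "x \<in> cells X" "cell_cod X x = ?p" "cell_left X x = tight_id X ?a"
        "y \<in> hets" "cell_left X y = cell_right X x"
        "z \<in> cells X" "cell_cod X z = ?r" "cell_left X z = cell_right X y" for x y z
    proof -
      have "cell_comp X (?\<epsilon> \<star> cell_id X I) (tight_id X ?a) ([x] @ [y]) = cell_comp X ?\<epsilon> (tight_id X ?a) [x] \<star> y"
        using that f g I by (subst mul_comp) simp_all
      then show ?thesis
        using that f g I by (subst mul_comp) simp_all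
    qed
    have cu: "cell_comp X c (tight_id X ?a) [cell_id X ?p, ?u, cell_id X ?r] = ?c"
    proof (rule rep_cancel[of f g _ _ "tight_id X ?a"])
      have "cell_comp X (rep_cell X f g) (tight_id X ?a) [cell_comp X c (tight_id X ?a) [cell_id X ?p, ?u, cell_id X ?r]] =
          cell_comp X ?h (tight_id X ?a) (([cell_id X ?p] @ [?u]) @ [cell_id X ?r])"
        unfolding c(6)[symmetric] using f g c(1-5) by (subst comp_single) simp_all
      also have "\<dots> = ?\<epsilon> \<star> ?u \<star> ?\<delta>"
        using f g u by (subst h1) simp_all
      also have "?\<epsilon> \<star> ?u = ?\<epsilon>"
        using mul_one[of ?\<epsilon> "id\<^sub>E"] f by (simp add: one_def)
      finally show "cell_comp X (rep_cell X f g) (tight_id X ?a) [cell_comp X c (tight_id X ?a) [cell_id X ?p, ?u, cell_id X ?r]] =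
          cell_comp X (rep_cell X f g) (tight_id X ?a) [?c]"
        using f g by simp
    qed (use f g c in simp_all)
    have ci: "cell_comp X c (tight_id X ?a) [?\<eta>, rep_cell X f g, ?\<theta>] = cell_id X ?q"
    proof (rule rep_cancel[of f g _ _ "tight_id X ?a"])
      have "cell_comp X (rep_cell X f g) (tight_id X ?a) [cell_comp X c (tight_id X ?a) [?\<eta>, rep_cell X f g, ?\<theta>]] =
          cell_comp X ?h (tight_id X ?a) (([?\<eta>] @ [rep_cell X f g]) @ [?\<theta>])"
        unfolding c(6)[symmetric] using f g c(1-5) by (subst comp_single) simp_all
      also have "\<dots> = rep_cell X f g"
        using f g by (subst h1) simp_all
      finally show "cell_comp X (rep_cell X f g) (tight_id X ?a) [cell_comp X c (tight_id X ?a) [?\<eta>, rep_cell X f g, ?\<theta>]] =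
          cell_comp X (rep_cell X f g) (tight_id X ?a) [cell_id X ?q]"
        using f g by simp
    qed (use f g c in simp_all)
    have ps: "loose_chain X (tight_dom X (cell_left X \<chi>)) ps ?a"
      and rs: "loose_chain X ?b rs (tight_dom X (cell_right X \<chi>))"
      using cell_dom_chain[OF \<chi>(1)] f g \<chi>(2) by (auto simp: loose_chain_append)
    have 1: "ctx (ctx \<xi> ps [c] rs) (ps @ [?p]) [?u] (?r # rs) = ctx \<xi> ps [?c] rs"
      and 2: "ctx (ctx \<xi> ps [c] rs) ps [?\<eta>, rep_cell X f g, ?\<theta>] rs = \<xi>"
      if \<xi>: "\<xi> \<in> cells X" "cell_dom X \<xi> = ps @ [?q] @ rs"
        "loose_chain X (tight_dom X (cell_left X \<xi>)) ps ?a"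
        "loose_chain X ?b rs (tight_dom X (cell_right X \<xi>))" for \<xi>
    proof -
      have "ctx (ctx \<xi> ps [c] rs) (ps @ [?p]) [?u] (?r # rs) = ctx (ctx \<xi> ps [c] rs) ps [cell_id X ?p, ?u, cell_id X ?r] rs"
        by (simp add: ctx_def)
      also have "\<dots> = ctx \<xi> ps (chain_comp X (tight_id X ?a) [c] [[cell_id X ?p, ?u, cell_id X ?r]]) rs"
        by (rule ctx_comp[OF \<xi>]) (use f g c in simp_all)
      finally show "ctx (ctx \<xi> ps [c] rs) (ps @ [?p]) [?u] (?r # rs) = ctx \<xi> ps [?c] rs"
        using cu by simp
      have "ctx (ctx \<xi> ps [c] rs) ps [?\<eta>, rep_cell X f g, ?\<theta>] rs =
          ctx \<xi> ps (chain_comp X (tight_id X ?a) [c] [[?\<eta>, rep_cell X f g, ?\<theta>]]) rs"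
        by (rule ctx_comp[OF \<xi>]) (use f g c in simp_all)
      also have "\<dots> = ctx \<xi> ps (map (cell_id X) [?q]) rs"
        using ci by simp
      also have "\<dots> = \<xi>"
        using \<xi> by (intro ctx_ids) simp_all
      finally show "ctx (ctx \<xi> ps [c] rs) ps [?\<eta>, rep_cell X f g, ?\<theta>] rs = \<xi>" .
    qed
    note D = ctx_cell[OF \<chi>(1,2) ps rs, of "[c]"]
    have \<chi>': "cell_dom X \<chi>' = ps @ [?q] @ rs" "loose_chain X (tight_dom X (cell_left X \<chi>')) ps ?a"
      "loose_chain X ?b rs (tight_dom X (cell_right X \<chi>'))"
      using ps rs \<chi> by simp_all
    note D' = ctx_cell[OF \<chi>(3) \<chi>', of "[c]"]
    have "ctx \<chi> ps [c] rs = ctx \<chi>' ps [c] rs"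
      by (rule opcartesian_cancel[of ?u _ _ "ps @ [?p]" "?r # rs"])
        (use D D' 1[OF \<chi>(1,2) ps rs] 1[OF \<chi>(3) \<chi>'] \<chi> c f g in simp_all)
    then show ?thesis
      using 2[OF \<chi>(1,2) ps rs] 2[OF \<chi>(3) \<chi>'] by metis
  qed
  show ?thesis
    unfolding opcartesian_def
  proof (intro conjI allI impI, goal_cases)
    case 1
    then show ?case
      using f g by (simp add: globular_def)
  next
    case (2 ps rs \<psi>)
    then have \<psi>: "\<psi> \<in> cells X" "cell_dom X \<psi> = ps @ [?p, ?r] @ rs"
      "loose_chain X (tight_dom X (cell_left X \<psi>)) ps ?a"
      using f g by simp_all
    obtain \<chi> where \<chi>: "\<chi> \<in> cells X \<and> cell_dom X \<chi> = ps @ [?q] @ rs \<and> cell_cod X \<chi> = cell_cod X \<psi> \<and>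
      cell_left X \<chi> = cell_left X \<psi> \<and> cell_right X \<chi> = cell_right X \<psi> \<and> ctx \<chi> ps [?c] rs = \<psi>"
      using ex[OF \<psi>] by blast
    have cod: "cell_cod X ?c = ?q" using f g by simp
    show ?case
      unfolding cod
    proof (rule ex1I[of _ \<chi>], goal_cases)
      case 1
      show ?case using \<chi> by (auto simp: ctx_def)
    next
      case (2 \<chi>')
      then show ?case
        using \<chi> by (intro un[of \<chi>' ps rs \<chi>]) (elim conjE, simp add: ctx_def)+
    qed
  qed
qed

end

section \<open>Restriction along 2-cells as multiplication by points\<close>

locale hom_equipment = equipment_over +
  fixes A
  assumes A [simp]: "A \<in> objects X"
begin

abbreviation T where "T \<equiv> tight_hom X A E"
abbreviation id\<^sub>A where "id\<^sub>A \<equiv> tight_id X A"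

lemma tight_homD [simp]: "f \<in> T \<Longrightarrow> f \<in> slice" "f \<in> T \<Longrightarrow> tight_dom X f = A"
  by (simp_all add: tight_hom_def slice_def del: sliceD)

lemma tight_cells2_iff:
  "\<lbrakk>f \<in> T; g \<in> T\<rbrakk> \<Longrightarrow> \<alpha> \<in> tight_cells2 X f g \<longleftrightarrow> \<alpha> \<in> cells X \<and> cell_dom X \<alpha> = [rep X id\<^sub>E f] \<and>
    cell_cod X \<alpha> = rep X id\<^sub>E g \<and> cell_left X \<alpha> = id\<^sub>E \<and> cell_right X \<alpha> = id\<^sub>A"
  by (simp add: tight_cells2_def globular_def)

lemma tight_cells2_frame:
  "\<lbrakk>\<alpha> \<in> tight_cells2 X f g; f \<in> T; g \<in> T\<rbrakk> \<Longrightarrow> \<alpha> \<in> cells X \<and> cell_dom X \<alpha> = [rep X id\<^sub>E f] \<and>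
    cell_cod X \<alpha> = rep X id\<^sub>E g \<and> cell_left X \<alpha> = id\<^sub>E \<and> cell_right X \<alpha> = id\<^sub>A"
  by (simp add: tight_cells2_iff)

text \<open>The form \<open>() \<Rightarrow> E(1, 1)\<close>, with left \<open>f\<close> and right \<open>g\<close>, of \<open>\<alpha> : f \<Rightarrow> g\<close>.\<close>

definition point :: "'b \<Rightarrow> 'b \<Rightarrow> 'd \<Rightarrow> 'd" where
  "point f g \<alpha> = cell_comp X (cell_comp X (rep_cell X id\<^sub>E g) id\<^sub>E [\<alpha>]) f [companion_unit f]"

lemma point_frame:
  assumes "\<alpha> \<in> tight_cells2 X f g" "f \<in> T" "g \<in> T"
  shows "point f g \<alpha> \<in> hets \<and> cell_dom X (point f g \<alpha>) = [] \<and> cell_left X (point f g \<alpha>) = f \<and>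
    cell_right X (point f g \<alpha>) = g"
  using tight_cells2_frame[OF assms] assms(2,3) by (simp add: point_def)

text \<open>The instance of \<open>yoneda_eq\<close> in which E(1, f) is the whole domain. It
  converts between composition with \<open>\<alpha>\<close> and multiplication by its point.\<close>

lemma rep_cell_comp_tight_cells2:
  assumes "\<alpha> \<in> tight_cells2 X f g" "f \<in> T" "g \<in> T"
  shows "cell_comp X (rep_cell X id\<^sub>E g) id\<^sub>E [\<alpha>] = rep_cell X id\<^sub>E f \<star> point f g \<alpha>"
  using yoneda_eq[of f "cell_comp X (rep_cell X id\<^sub>E g) id\<^sub>E [\<alpha>]" "[]"] tight_cells2_frame[OF assms] assms(2,3)
  by (simp add: point_def)

lemma comp_point:
  assumes "\<alpha> \<in> tight_cells2 X f g" "f \<in> T" "g \<in> T"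
  shows "cell_comp X (point f g \<alpha>) id\<^sub>A [] = point f g \<alpha>"
  using point_frame[OF assms] assms by simp

text \<open>A point has empty domain, so the whole chain goes to the other factor. Ending the chain
  in an identity keeps the point from being whiskered.\<close>

lemma mul_point_comp:
  assumes \<alpha>: "\<alpha> \<in> tight_cells2 X f g" "f \<in> T" "g \<in> T"
    and \<phi>: "\<phi> \<in> hets" "cell_right X \<phi> = f"
    and xs: "cell_chain X h xs id\<^sub>A" "map (cell_cod X) xs = cell_dom X \<phi>" "tight_cod X h = tight_dom X (cell_left X \<phi>)"
  shows "cell_comp X (\<phi> \<star> point f g \<alpha>) h xs = cell_comp X \<phi> h xs \<star> point f g \<alpha>"
  using mul_comp[of \<phi> "point f g \<alpha>" h xs "[]"] point_frame[OF \<alpha>] comp_point[OF \<alpha>] assms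
  by (simp add: last_tight_chain)

lemma point_mul_comp:
  assumes \<alpha>: "\<alpha> \<in> tight_cells2 X f g" "f \<in> T" "g \<in> T"
    and \<phi>: "\<phi> \<in> hets" "cell_left X \<phi> = g"
    and xs: "cell_chain X id\<^sub>A xs (last_tight X id\<^sub>A xs)" "map (cell_cod X) xs = cell_dom X \<phi>"
  shows "cell_comp X (point f g \<alpha> \<star> \<phi>) id\<^sub>A xs = point f g \<alpha> \<star> cell_comp X \<phi> id\<^sub>A xs"
  using mul_comp[of "point f g \<alpha>" \<phi> "id\<^sub>A" "[]" xs] point_frame[OF \<alpha>] comp_point[OF \<alpha>] assms
  by simp

text \<open>The 2-cell E(f, \<alpha>) is defined by a lift along E(1, g'). Moving the calculation to
  E(1, 1) turns it into right multiplication by the point of \<alpha>.\<close>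

lemma rep_covariant_frame:
  assumes \<alpha>: "\<alpha> \<in> tight_cells2 X g g'" "g \<in> T" "g' \<in> T" and f: "f \<in> T"
  shows "rep_covariant X f g g' \<alpha> \<in> cells X \<and> cell_dom X (rep_covariant X f g g' \<alpha>) = [rep X f g] \<and>
    cell_cod X (rep_covariant X f g g' \<alpha>) = rep X f g' \<and> cell_left X (rep_covariant X f g g' \<alpha>) = id\<^sub>A \<and>
    cell_right X (rep_covariant X f g g' \<alpha>) = id\<^sub>A \<and>
    cell_comp X (rep_cell X f g') id\<^sub>A [rep_covariant X f g g' \<alpha>] = rep_cell X f g \<star> point g g' \<alpha>"
proof -
  let ?r = "rep_covariant X f g g' \<alpha>"
  note a = tight_cells2_frame[OF \<alpha>]
  have r: "?r \<in> cells X \<and> cell_dom X ?r = [rep X f g] \<and> cell_cod X ?r = rep X f g' \<and>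
    cell_left X ?r = id\<^sub>A \<and> cell_right X ?r = id\<^sub>A \<and>
    cell_comp X (rep_cell_left X f g') id\<^sub>A [?r] = cell_comp X \<alpha> f [rep_cell_left X f g]"
    using lift_cell[OF cartesian_rep_cell_left[of f g'], of "id\<^sub>A" "id\<^sub>A" "cell_comp X \<alpha> f [rep_cell_left X f g]"] a f \<alpha>
    by (simp add: rep_covariant_def)
  have "cell_comp X (rep_cell X f g') id\<^sub>A [?r] =
      cell_comp X (cell_comp X (rep_cell X id\<^sub>E g') f [rep_cell_left X f g']) id\<^sub>A [?r]"
    using f \<alpha> by simp
  also have "\<dots> = cell_comp X (rep_cell X id\<^sub>E g') f [cell_comp X \<alpha> f [rep_cell_left X f g]]"
    using f \<alpha> r by (subst comp_single) simp_all
  also have "\<dots> = cell_comp X (cell_comp X (rep_cell X id\<^sub>E g') id\<^sub>E [\<alpha>]) f [rep_cell_left X f g]"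
    using f \<alpha> a by (subst comp_single) simp_all
  also have "\<dots> = rep_cell X f g \<star> point g g' \<alpha>"
    unfolding rep_cell_comp_tight_cells2[OF \<alpha>] using f \<alpha> by (subst mul_point_comp) simp_all
  finally show ?thesis using r by simp
qed

lemma nullary_form_frame:
  assumes \<alpha>: "\<alpha> \<in> tight_cells2 X f g" "f \<in> T" "g \<in> T"
  shows "nullary_form X f g \<alpha> \<in> cells X \<and> cell_dom X (nullary_form X f g \<alpha>) = [] \<and>
    cell_cod X (nullary_form X f g \<alpha>) = rep X f g \<and> cell_left X (nullary_form X f g \<alpha>) = id\<^sub>A \<and>
    cell_right X (nullary_form X f g \<alpha>) = id\<^sub>A \<and>
    cell_comp X (rep_cell X f g) id\<^sub>A [nullary_form X f g \<alpha>] = point f g \<alpha>"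
proof -
  note r = rep_covariant_frame[OF \<alpha> \<alpha>(2)]
  have eq: "nullary_form X f g \<alpha> = cell_comp X (rep_covariant X f f g \<alpha>) id\<^sub>A [frown X f]"
    using r \<alpha> by (simp add: nullary_form_def gcomp_def)
  have "cell_comp X (rep_cell X f g) id\<^sub>A [cell_comp X (rep_covariant X f f g \<alpha>) id\<^sub>A [frown X f]] =
      cell_comp X (cell_comp X (rep_cell X f g) id\<^sub>A [rep_covariant X f f g \<alpha>]) id\<^sub>A [frown X f]"
    using r \<alpha> by (subst comp_single) simp_all
  also have "\<dots> = cell_comp X (rep_cell X f f \<star> point f g \<alpha>) id\<^sub>A [frown X f]"
    using r by simp
  also have "\<dots> = point f g \<alpha>"
    using \<alpha> point_frame[OF \<alpha>] by (subst mul_point_comp) simp_all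
  finally show ?thesis
    unfolding eq using r \<alpha> by simp
qed

lemma conjoint_form_frame:
  assumes \<alpha>: "\<alpha> \<in> tight_cells2 X f g" "f \<in> T" "g \<in> T"
  shows "conjoint_form X f g \<alpha> \<in> cells X \<and> cell_dom X (conjoint_form X f g \<alpha>) = [rep X g id\<^sub>E] \<and>
    cell_cod X (conjoint_form X f g \<alpha>) = rep X f id\<^sub>E \<and> cell_left X (conjoint_form X f g \<alpha>) = id\<^sub>A \<and>
    cell_right X (conjoint_form X f g \<alpha>) = id\<^sub>E \<and>
    cell_comp X (rep_cell X f id\<^sub>E) id\<^sub>A [conjoint_form X f g \<alpha>] = point f g \<alpha> \<star> rep_cell X g id\<^sub>E"
proof -
  note n = nullary_form_frame[OF \<alpha>]
  have eq: "conjoint_form X f g \<alpha> = cell_comp X (smile_at X g f id\<^sub>E) id\<^sub>A [nullary_form X f g \<alpha>, cell_id X (rep X g id\<^sub>E)]"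
    using \<alpha> by (simp add: conjoint_form_def gcomp_def)
  have "cell_comp X (rep_cell X f id\<^sub>E) id\<^sub>A [cell_comp X (smile_at X g f id\<^sub>E) id\<^sub>A [nullary_form X f g \<alpha>, cell_id X (rep X g id\<^sub>E)]] =
      cell_comp X (rep_cell X f g \<star> rep_cell X g id\<^sub>E) id\<^sub>A ([nullary_form X f g \<alpha>] @ [cell_id X (rep X g id\<^sub>E)])"
    using comp_single[of "rep_cell X f id\<^sub>E" "smile_at X g f id\<^sub>E" "id\<^sub>A" "id\<^sub>A" "[nullary_form X f g \<alpha>, cell_id X (rep X g id\<^sub>E)]"] n \<alpha> by simp
  also have "\<dots> = point f g \<alpha> \<star> rep_cell X g id\<^sub>E"
    using \<alpha> n by (subst mul_comp) simp_all
  finally show ?thesis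
    unfolding eq using n \<alpha> by simp
qed

text \<open>Dually, E(\<alpha>, g) becomes left multiplication by the point of \<alpha>: the detour
  through the nullary and conjoint forms only moves that point to the other side.\<close>

lemma rep_contravariant_frame:
  assumes \<alpha>: "\<alpha> \<in> tight_cells2 X f f'" "f \<in> T" "f' \<in> T" and g: "g \<in> T"
  shows "rep_contravariant X f f' \<alpha> g \<in> cells X \<and> cell_dom X (rep_contravariant X f f' \<alpha> g) = [rep X f' g] \<and>
    cell_cod X (rep_contravariant X f f' \<alpha> g) = rep X f g \<and> cell_left X (rep_contravariant X f f' \<alpha> g) = id\<^sub>A \<and>
    cell_right X (rep_contravariant X f f' \<alpha> g) = id\<^sub>A \<and>
    cell_comp X (rep_cell X f g) id\<^sub>A [rep_contravariant X f f' \<alpha> g] = point f f' \<alpha> \<star> rep_cell X f' g"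
proof -
  let ?r = "rep_contravariant X f f' \<alpha> g" and ?c = "conjoint_form X f f' \<alpha>"
  note c = conjoint_form_frame[OF \<alpha>]
  have r: "?r \<in> cells X \<and> cell_dom X ?r = [rep X f' g] \<and> cell_cod X ?r = rep X f g \<and>
    cell_left X ?r = id\<^sub>A \<and> cell_right X ?r = id\<^sub>A \<and>
    cell_comp X (rep_cell_right X f g) id\<^sub>A [?r] = cell_comp X ?c id\<^sub>A [rep_cell_right X f' g]"
    using lift_cell[OF cartesian_rep_cell_right[of f g], of "id\<^sub>A" "id\<^sub>A" "cell_comp X ?c id\<^sub>A [rep_cell_right X f' g]"] c g \<alpha>
    by (simp add: rep_contravariant_def gcomp_def)
  have "cell_comp X (rep_cell X f g) id\<^sub>A [?r] =
      cell_comp X (cell_comp X (rep_cell X f id\<^sub>E) id\<^sub>A [rep_cell_right X f g]) id\<^sub>A [?r]"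
    using g \<alpha> by simp
  also have "\<dots> = cell_comp X (rep_cell X f id\<^sub>E) id\<^sub>A [cell_comp X ?c id\<^sub>A [rep_cell_right X f' g]]"
    using g \<alpha> r by (subst comp_single) simp_all
  also have "\<dots> = cell_comp X (cell_comp X (rep_cell X f id\<^sub>E) id\<^sub>A [?c]) id\<^sub>A [rep_cell_right X f' g]"
    using g \<alpha> c by (subst comp_single) simp_all
  also have "\<dots> = cell_comp X (point f f' \<alpha> \<star> rep_cell X f' id\<^sub>E) id\<^sub>A [rep_cell_right X f' g]"
    using c by simp
  also have "\<dots> = point f f' \<alpha> \<star> rep_cell X f' g"
    using g \<alpha> by (subst point_mul_comp) simp_all
  finally show ?thesis using r by simp
qed

end

section \<open>Extension operators and multiplications\<close>

locale rooted_equipment = hom_equipment +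
  fixes j
  assumes j [simp]: "j \<in> tight_hom X A E"
begin

text \<open>\<open>join t\<close> exhibits \<open>E(j, t)\<close> as the loose-composite \<open>E(j, 1) \<odot> E(1, t)\<close>.\<close>

abbreviation join where "join t \<equiv> smile_at X id\<^sub>E j t"

lemma join_frame [simp]:
  assumes t: "t \<in> T"
  shows "join t \<in> cells X \<and> cell_dom X (join t) = [rep X j id\<^sub>E, rep X id\<^sub>E t] \<and>
    cell_cod X (join t) = rep X j t \<and> cell_left X (join t) = id\<^sub>A \<and> cell_right X (join t) = id\<^sub>A \<and>
    cell_comp X (rep_cell X j t) id\<^sub>A [join t] = rep_cell X j id\<^sub>E \<star> rep_cell X id\<^sub>E t"
  using smile_at_frame[of "id\<^sub>E" j A t] t by simp

lemma join_opcartesian: "t \<in> T \<Longrightarrow> opcartesian X (join t)"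
  by (simp add: smile_at_opcartesian)

lemma join_cancel:
  assumes t: "t \<in> T" and \<phi>: "\<phi> \<in> hets" "\<psi> \<in> hets" "cell_dom X \<phi> = [rep X j t]" "cell_dom X \<psi> = [rep X j t]"
    "cell_left X \<phi> = f" "cell_left X \<psi> = f" "f \<in> T" "cell_right X \<phi> = cell_right X \<psi>"
    and eq: "cell_comp X \<phi> id\<^sub>A [join t] = cell_comp X \<psi> id\<^sub>A [join t]"
  shows "\<phi> = \<psi>"
  by (rule opcartesian_cancel[OF join_opcartesian[OF t], of _ _ "[]" "[]"]) (use assms in \<open>simp_all add: ctx_def\<close>)

text \<open>The universal property is used in two contexts: at the first E(j, t) with the second one
  intact, and at the second one with E(j, 1), E(1, t) already standing before it.\<close>

lemma join_join_cancel:
  assumes t: "t \<in> T" and \<phi>: "\<phi> \<in> hets" "\<psi> \<in> hets" "cell_dom X \<phi> = [rep X j t, rep X j t]"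
    "cell_dom X \<psi> = [rep X j t, rep X j t]"
    "cell_left X \<phi> = f" "cell_left X \<psi> = f" "f \<in> T" "cell_right X \<phi> = g" "cell_right X \<psi> = g" "g \<in> T"
    and eq: "cell_comp X \<phi> id\<^sub>A [join t, join t] = cell_comp X \<psi> id\<^sub>A [join t, join t]"
  shows "\<phi> = \<psi>"
proof (rule opcartesian_cancel[OF join_opcartesian[OF t], of _ _ "[]" "[rep X j t]"])
  let ?q = "rep X j t" and ?p = "rep X j id\<^sub>E" and ?r = "rep X id\<^sub>E t"
  have dom: "cell_comp X (join t) id\<^sub>A [cell_id X ?p, cell_id X ?r] = join t"
    using cell_comp_id[of "join t"] t by simp
  have 1: "ctx (ctx \<chi> [] [join t] [?q]) [?p, ?r] [join t] [] = cell_comp X \<chi> id\<^sub>A [join t, join t]"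
    if "\<chi> \<in> hets" "cell_dom X \<chi> = [?q, ?q]" "cell_left X \<chi> = f" for \<chi>
  proof -
    have "ctx (ctx \<chi> [] [join t] [?q]) [?p, ?r] [join t] [] =
        cell_comp X (cell_comp X \<chi> id\<^sub>A [join t, cell_id X ?q]) id\<^sub>A [cell_id X ?p, cell_id X ?r, join t]"
      using that t \<open>f \<in> T\<close> by (simp add: ctx_def)
    also have "\<dots> = cell_comp X \<chi> id\<^sub>A [join t, join t]"
      using that t dom \<open>f \<in> T\<close> by (subst cell_assoc1[where \<phi>ss = "[[cell_id X ?p, cell_id X ?r], [join t]]"]) simp_all
    finally show ?thesis .
  qed
  show "ctx \<phi> [] [join t] [?q] = ctx \<psi> [] [join t] [?q]"
    by (rule opcartesian_cancel[OF join_opcartesian[OF t], of _ _ "[?p, ?r]" "[]"])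
      (use assms 1 in \<open>simp_all add: ctx_def\<close>)
qed (use assms in simp_all)

text \<open>This is naturality of \<open>join\<close>. Over E(1, 1) both sides are the product of
  the cartesian 2-cells of E(j, 1) and E(1, f) with the point of \<alpha>, bracketed in two
  ways.\<close>

lemma rep_covariant_join:
  assumes \<alpha>: "\<alpha> \<in> tight_cells2 X f g" "f \<in> T" "g \<in> T"
  shows "cell_comp X (rep_covariant X j f g \<alpha>) id\<^sub>A [join f] = cell_comp X (join g) id\<^sub>A [cell_id X (rep X j id\<^sub>E), \<alpha>]"
proof (rule rep_cancel[of j g _ _ "id\<^sub>A"])
  let ?p = "cell_id X (rep X j id\<^sub>E)"
  note a = tight_cells2_frame[OF \<alpha>] and r = rep_covariant_frame[OF \<alpha> j]
  have "cell_comp X (rep_cell X j g) id\<^sub>A [cell_comp X (rep_covariant X j f g \<alpha>) id\<^sub>A [join f]] =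
      cell_comp X (cell_comp X (rep_cell X j g) id\<^sub>A [rep_covariant X j f g \<alpha>]) id\<^sub>A [join f]"
    using \<alpha> r by (subst comp_single) simp_all
  also have "\<dots> = cell_comp X (rep_cell X j f \<star> point f g \<alpha>) id\<^sub>A [join f]"
    using r by simp
  also have "\<dots> = rep_cell X j id\<^sub>E \<star> rep_cell X id\<^sub>E f \<star> point f g \<alpha>"
    using \<alpha> by (subst mul_point_comp) simp_all
  also have "\<dots> = rep_cell X j id\<^sub>E \<star> (rep_cell X id\<^sub>E f \<star> point f g \<alpha>)"
    using \<alpha> point_frame[OF \<alpha>] by (subst mul_assoc) simp_all
  also have "\<dots> = cell_comp X (rep_cell X j id\<^sub>E \<star> rep_cell X id\<^sub>E g) id\<^sub>A ([?p] @ [\<alpha>])"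
    using \<alpha> a rep_cell_comp_tight_cells2[OF \<alpha>] by (subst mul_comp) simp_all
  also have "\<dots> = cell_comp X (cell_comp X (rep_cell X j g) id\<^sub>A [join g]) id\<^sub>A [?p, \<alpha>]"
    using \<alpha> by simp
  also have "\<dots> = cell_comp X (rep_cell X j g) id\<^sub>A [cell_comp X (join g) id\<^sub>A [?p, \<alpha>]]"
    using \<alpha> a by (subst comp_single) simp_all
  finally show "cell_comp X (rep_cell X j g) id\<^sub>A [cell_comp X (rep_covariant X j f g \<alpha>) id\<^sub>A [join f]] = \<dots>" .
qed (use tight_cells2_frame[OF \<alpha>] rep_covariant_frame[OF \<alpha> j] \<alpha> in simp_all)

definition ext_het :: "'b \<Rightarrow> 'd \<Rightarrow> 'd" where
  "ext_het t d = cell_comp X (rep_cell X t t) id\<^sub>A [d]"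

definition ext_mult :: "'b \<Rightarrow> 'd \<Rightarrow> 'd" where
  "ext_mult t d = lift X (rep_cell X id\<^sub>E t) id\<^sub>E id\<^sub>A
     (rep_cell X id\<^sub>E t \<star> cell_comp X (ext_het t d) id\<^sub>A [join t])"

definition exts :: "'b \<Rightarrow> 'd set" where
  "exts t = globular X [rep X j t] (rep X t t)"

definition mults :: "'b \<Rightarrow> 'd set" where
  "mults t = globular X [rep X id\<^sub>E t, rep X j id\<^sub>E, rep X id\<^sub>E t] (rep X id\<^sub>E t)"

lemma exts_frame:
  "\<lbrakk>t \<in> T; d \<in> exts t\<rbrakk> \<Longrightarrow> d \<in> cells X \<and> cell_dom X d = [rep X j t] \<and> cell_cod X d = rep X t t \<and>
    cell_left X d = id\<^sub>A \<and> cell_right X d = id\<^sub>A"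
  by (simp add: exts_def globular_def)

lemma ext_het_frame [simp]:
  "\<lbrakk>t \<in> T; d \<in> exts t\<rbrakk> \<Longrightarrow> ext_het t d \<in> hets \<and> cell_dom X (ext_het t d) = [rep X j t] \<and>
    cell_left X (ext_het t d) = t \<and> cell_right X (ext_het t d) = t"
  using exts_frame[of t d] by (simp add: ext_het_def)

lemma ext_mult_frame [simp]:
  assumes t: "t \<in> T" and d: "d \<in> exts t"
  shows "ext_mult t d \<in> cells X \<and> cell_dom X (ext_mult t d) = [rep X id\<^sub>E t, rep X j id\<^sub>E, rep X id\<^sub>E t] \<and>
    cell_cod X (ext_mult t d) = rep X id\<^sub>E t \<and> cell_left X (ext_mult t d) = id\<^sub>E \<and>
    cell_right X (ext_mult t d) = id\<^sub>A \<and>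
    cell_comp X (rep_cell X id\<^sub>E t) id\<^sub>E [ext_mult t d] =
      rep_cell X id\<^sub>E t \<star> cell_comp X (ext_het t d) id\<^sub>A [join t]"
  using lift_rep_cell[of "id\<^sub>E" t "rep_cell X id\<^sub>E t \<star> cell_comp X (ext_het t d) id\<^sub>A [join t]" "id\<^sub>E" "id\<^sub>A"] t d
  by (simp add: ext_mult_def)

lemma bij_ext_mult:
  assumes t: "t \<in> T"
  shows "bij_betw (ext_mult t) (exts t) (mults t)"
proof (rule bij_betw_imageI)
  show "inj_on (ext_mult t) (exts t)"
  proof (rule inj_onI)
    fix d d' assume d: "d \<in> exts t" "d' \<in> exts t" "ext_mult t d = ext_mult t d'"
    have "rep_cell X id\<^sub>E t \<star> cell_comp X (ext_het t d) id\<^sub>A [join t] =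
        rep_cell X id\<^sub>E t \<star> cell_comp X (ext_het t d') id\<^sub>A [join t]"
      using ext_mult_frame[OF t d(1)] ext_mult_frame[OF t d(2)] d(3) by metis
    then have "cell_comp X (ext_het t d) id\<^sub>A [join t] = cell_comp X (ext_het t d') id\<^sub>A [join t]"
      by (rule yoneda_cancel[of t, rotated 6]) (use t d(1,2) in simp_all)
    then have "ext_het t d = ext_het t d'"
      by (rule join_cancel[OF t, of _ _ t, rotated 8]) (use t d(1,2) in simp_all)
    then show "d = d'"
      unfolding ext_het_def by (rule rep_cancel[of t t d d' "id\<^sub>A", rotated 11]) (use t exts_frame[OF t d(1)] exts_frame[OF t d(2)] in simp_all)
  qed
  have "ext_mult t d \<in> mults t" if "d \<in> exts t" for d
    using t that by (simp add: mults_def globular_def)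
  moreover have "\<exists>d\<in>exts t. ext_mult t d = m" if m: "m \<in> mults t" for m
  proof -
    have m: "m \<in> cells X" "cell_dom X m = [rep X id\<^sub>E t, rep X j id\<^sub>E, rep X id\<^sub>E t]"
      "cell_cod X m = rep X id\<^sub>E t" "cell_left X m = id\<^sub>E" "cell_right X m = id\<^sub>A"
      using m t by (simp_all add: mults_def globular_def)
    let ?M = "cell_comp X (rep_cell X id\<^sub>E t) id\<^sub>E [m]"
    \<comment> \<open>The preimage of \<open>m\<close> is built backwards: evaluation at the
      companion unit strips off \<open>\<epsilon>\<^sub>t\<close>, then the result is factored
      through \<open>join t\<close> and lifted to E(t, t).\<close>
    let ?D = "cell_comp X ?M t (companion_unit t # map (cell_id X) [rep X j id\<^sub>E, rep X id\<^sub>E t])"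
    have D: "?D \<in> hets" "cell_dom X ?D = [rep X j id\<^sub>E, rep X id\<^sub>E t]" "cell_left X ?D = t" "cell_right X ?D = t"
      using t m by simp_all
    have M: "rep_cell X id\<^sub>E t \<star> ?D = ?M"
      by (rule yoneda_eq) (use t m in simp_all)
    obtain D' where D': "D' \<in> cells X" "cell_dom X D' = [rep X j t]" "cell_cod X D' = I"
      "cell_left X D' = t" "cell_right X D' = t" "ctx D' [] [join t] [] = ?D"
      using opcartesian_factor[OF join_opcartesian[OF t], of ?D "[]" "[]"] t D by auto
    have D'h: "D' \<in> hets" using D'(1,3) by (simp add: hets_def del: hetsD)
    define d where "d = lift X (rep_cell X t t) id\<^sub>A id\<^sub>A D'"
    have d: "d \<in> exts t" and dD: "ext_het t d = D'"
      using lift_rep_cell[of t t D' "id\<^sub>A" "id\<^sub>A"] t D'(1-5) D'h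
      by (simp_all add: exts_def globular_def d_def ext_het_def)
    have "cell_comp X D' id\<^sub>A [join t] = ?D"
      using D'(4,6) t by (simp add: ctx_def)
    then have "cell_comp X (rep_cell X id\<^sub>E t) id\<^sub>E [ext_mult t d] = ?M"
      using ext_mult_frame[OF t d] dD M by simp
    then have "ext_mult t d = m"
      by (rule rep_cancel[of "id\<^sub>E" t _ _ "id\<^sub>E", rotated 11]) (use t m d in simp_all)
    then show ?thesis using d by blast
  qed
  ultimately show "ext_mult t ` exts t = mults t"
    by (auto simp: image_iff)
qed

lemma ext_het_comp:
  assumes "t \<in> T" "d \<in> exts t" "cell_chain X id\<^sub>A xs (last_tight X id\<^sub>A xs)" "map (cell_cod X) xs = [rep X j t]"
  shows "cell_comp X (rep_cell X t t) id\<^sub>A [cell_comp X d id\<^sub>A xs] = cell_comp X (ext_het t d) id\<^sub>A xs"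
  using comp_single[of "rep_cell X t t" d "id\<^sub>A" "id\<^sub>A" xs] exts_frame[of t d] assms by (simp add: ext_het_def)

text \<open>Every composite with a multiplication is evaluated by this rule: the first entry meets
  only \<open>\<epsilon>\<^sub>t\<close>, while the other two reach the extension operator through
  \<open>join t\<close>.\<close>

lemma ext_mult_comp:
  assumes t: "t \<in> T" "d \<in> exts t" and x: "x \<in> cells X" "cell_cod X x = rep X id\<^sub>E t"
    "cell_left X x = id\<^sub>E" "cell_right X x = id\<^sub>A"
    and y: "y \<in> cells X" "cell_cod X y = rep X j id\<^sub>E" "cell_left X y = id\<^sub>A" "cell_right X y = id\<^sub>E"
    and z: "z \<in> cells X" "cell_cod X z = rep X id\<^sub>E t" "cell_left X z = id\<^sub>E"
  shows "cell_comp X (rep_cell X id\<^sub>E t) id\<^sub>E [cell_comp X (ext_mult t d) id\<^sub>E [x, y, z]] =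
    cell_comp X (rep_cell X id\<^sub>E t) id\<^sub>E [x] \<star> cell_comp X (ext_het t d) id\<^sub>A [cell_comp X (join t) id\<^sub>A [y, z]]"
proof -
  have "cell_comp X (rep_cell X id\<^sub>E t) id\<^sub>E [cell_comp X (ext_mult t d) id\<^sub>E [x, y, z]] =
      cell_comp X (cell_comp X (rep_cell X id\<^sub>E t) id\<^sub>E [ext_mult t d]) id\<^sub>E [x, y, z]"
    using assms by (subst comp_single) simp_all
  also have "\<dots> = cell_comp X (rep_cell X id\<^sub>E t \<star> cell_comp X (ext_het t d) id\<^sub>A [join t]) id\<^sub>E ([x] @ [y, z])"
    using t by simp
  also have "\<dots> = cell_comp X (rep_cell X id\<^sub>E t) id\<^sub>E [x] \<star> cell_comp X (cell_comp X (ext_het t d) id\<^sub>A [join t]) id\<^sub>A [y, z]"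
    using assms by (subst mul_comp) simp_all
  also have "cell_comp X (cell_comp X (ext_het t d) id\<^sub>A [join t]) id\<^sub>A [y, z] =
      cell_comp X (ext_het t d) id\<^sub>A [cell_comp X (join t) id\<^sub>A [y, z]]"
    using assms by (subst comp_single) simp_all
  finally show ?thesis .
qed

lemma join_comp:
  assumes t: "t \<in> T" and y: "y \<in> cells X" "cell_cod X y = rep X j id\<^sub>E" "cell_left X y = id\<^sub>A" "cell_right X y = id\<^sub>E"
    and z: "z \<in> cells X" "cell_cod X z = rep X id\<^sub>E t" "cell_left X z = id\<^sub>E"
  shows "cell_comp X (rep_cell X j t) id\<^sub>A [cell_comp X (join t) id\<^sub>A [y, z]] =
    cell_comp X (rep_cell X j id\<^sub>E) id\<^sub>A [y] \<star> cell_comp X (rep_cell X id\<^sub>E t) id\<^sub>E [z]"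
proof -
  have "cell_comp X (rep_cell X j t) id\<^sub>A [cell_comp X (join t) id\<^sub>A [y, z]] =
      cell_comp X (cell_comp X (rep_cell X j t) id\<^sub>A [join t]) id\<^sub>A [y, z]"
    using assms by (subst comp_single) simp_all
  also have "\<dots> = cell_comp X (rep_cell X j id\<^sub>E \<star> rep_cell X id\<^sub>E t) id\<^sub>A ([y] @ [z])"
    using t by simp
  also have "\<dots> = cell_comp X (rep_cell X j id\<^sub>E) id\<^sub>A [y] \<star> cell_comp X (rep_cell X id\<^sub>E t) id\<^sub>E [z]"
    using assms by (subst mul_comp) simp_all
  finally show ?thesis .
qed

lemma join_ids: "t \<in> T \<Longrightarrow> cell_comp X (join t) id\<^sub>A [cell_id X (rep X j id\<^sub>E), cell_id X (rep X id\<^sub>E t)] = join t"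
  using cell_comp_id[of "join t"] by simp

text \<open>This and the next two lemmas recast cancellation as equivalences, so that each law
  becomes one chain of equivalent equations and both directions are obtained at once.\<close>

lemma iff_by_rep_cell:
  assumes "f \<in> slice" "g \<in> slice" "\<chi> \<in> cells X" "\<chi>' \<in> cells X" "cell_cod X \<chi> = rep X f g" "cell_cod X \<chi>' = rep X f g"
    "cell_dom X \<chi>' = cell_dom X \<chi>" "cell_left X \<chi> = h" "cell_left X \<chi>' = h" "cell_right X \<chi>' = cell_right X \<chi>"
  shows "\<chi> = \<chi>' \<longleftrightarrow> cell_comp X (rep_cell X f g) h [\<chi>] = cell_comp X (rep_cell X f g) h [\<chi>']"
  using rep_cancel[of f g \<chi> \<chi>' h] assms by (metis sliceD)

lemma iff_by_yoneda:
  assumes "t \<in> slice" "\<phi> \<in> hets" "\<psi> \<in> hets" "cell_left X \<phi> = t" "cell_left X \<psi> = t" "cell_dom X \<psi> = cell_dom X \<phi>"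
  shows "\<phi> = \<psi> \<longleftrightarrow> rep_cell X id\<^sub>E t \<star> \<phi> = rep_cell X id\<^sub>E t \<star> \<psi>"
  using yoneda_cancel[OF assms] by metis

lemma iff_by_join:
  assumes "t \<in> T" "\<phi> \<in> hets" "\<psi> \<in> hets" "cell_dom X \<phi> = [rep X j t]" "cell_dom X \<psi> = [rep X j t]"
    "cell_left X \<phi> = f" "cell_left X \<psi> = f" "f \<in> T" "cell_right X \<phi> = cell_right X \<psi>"
  shows "\<phi> = \<psi> \<longleftrightarrow> cell_comp X \<phi> id\<^sub>A [join t] = cell_comp X \<psi> id\<^sub>A [join t]"
  using join_cancel[OF assms] by metis

section \<open>Laws of an extension operator as laws of its multiplication\<close>

lemma smile_frame [simp]:
  "t \<in> T \<Longrightarrow> smile X t \<in> hets \<and> cell_dom X (smile X t) = [rep X id\<^sub>E t, rep X t id\<^sub>E] \<and>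
    cell_left X (smile X t) = id\<^sub>E \<and> cell_right X (smile X t) = id\<^sub>E"
  by (simp add: smile_eq)

text \<open>Over E(1, 1) the monad law says that the point of \<open>u\<close> times
  \<open>?D\<close> is the cartesian 2-cell of E(j, t). Split by \<open>join t\<close> and
  multiplied by the cartesian 2-cell of E(1, j), its left-hand side gives the multiplication applied
  to \<open>u\<close>, and its right-hand side gives \<open>smile X j\<close> acting on E(1,
  t).\<close>

lemma left_unit_law:
  assumes t: "t \<in> T" and d: "d \<in> exts t" and u: "u \<in> tight_cells2 X j t"
  shows "gcomp X (rep_contravariant X j t u t) [d] = cell_id X (rep X j t) \<longleftrightarrow>
    xj_comp X j (ext_mult t d) [Obj u, Obj (cell_id X (rep X id\<^sub>E t))] =
    xj_lam X j [Obj t] t 0 (cell_id X (rep X id\<^sub>E t))"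
proof -
  let ?r = "rep_contravariant X j t u t" and ?D = "ext_het t d" and ?u = "point j t u"
  let ?m = "ext_mult t d" and ?e = "rep_cell X id\<^sub>E t" and ?p = "rep X j id\<^sub>E" and ?q = "rep X id\<^sub>E t"
  let ?DJ = "cell_comp X ?D id\<^sub>A [join t]" and ?k = "loose_unitor X ?q"
  note r = rep_contravariant_frame[OF u j t t] and pt = point_frame[OF u j t]
    and df = exts_frame[OF t d] and uf = tight_cells2_frame[OF u j t]
  have "gcomp X ?r [d] = cell_id X (rep X j t) \<longleftrightarrow> cell_comp X ?r id\<^sub>A [d] = cell_id X (rep X j t)"
    using r t by (simp add: gcomp_def)
  also have "\<dots> \<longleftrightarrow> cell_comp X (rep_cell X j t) id\<^sub>A [cell_comp X ?r id\<^sub>A [d]] =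
      cell_comp X (rep_cell X j t) id\<^sub>A [cell_id X (rep X j t)]"
    by (rule iff_by_rep_cell) (use r t df in simp_all)
  also have "cell_comp X (rep_cell X j t) id\<^sub>A [cell_comp X ?r id\<^sub>A [d]] = cell_comp X (?u \<star> rep_cell X t t) id\<^sub>A [d]"
    using r t df comp_single[of "rep_cell X j t" ?r "id\<^sub>A" "id\<^sub>A" "[d]"] by simp
  also have "\<dots> = ?u \<star> ?D"
    unfolding ext_het_def by (rule point_mul_comp[OF u j t]) (use t df in simp_all)
  also have "?u \<star> ?D = cell_comp X (rep_cell X j t) id\<^sub>A [cell_id X (rep X j t)] \<longleftrightarrow>
      cell_comp X (?u \<star> ?D) id\<^sub>A [join t] = cell_comp X (rep_cell X j t) id\<^sub>A [join t]"
    by (subst iff_by_join[of t _ _ j]) (use t d pt in simp_all)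
  also have "cell_comp X (?u \<star> ?D) id\<^sub>A [join t] = ?u \<star> ?DJ"
    by (rule point_mul_comp[OF u j t]) (use t d in simp_all)
  also have "cell_comp X (rep_cell X j t) id\<^sub>A [join t] = rep_cell X j id\<^sub>E \<star> ?e"
    using t by simp
  \<comment> \<open>Both sides have left tight-cell \<open>j\<close>, not \<open>t\<close>, so the
    Yoneda lemma is used for E(1, j).\<close>
  also have "?u \<star> ?DJ = rep_cell X j id\<^sub>E \<star> ?e \<longleftrightarrow>
      rep_cell X id\<^sub>E j \<star> (?u \<star> ?DJ) = rep_cell X id\<^sub>E j \<star> (rep_cell X j id\<^sub>E \<star> ?e)"
    by (rule iff_by_yoneda) (use t d pt in simp_all)
  also have "rep_cell X id\<^sub>E j \<star> (?u \<star> ?DJ) = (rep_cell X id\<^sub>E j \<star> ?u) \<star> ?DJ"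
    using t d pt by (subst mul_assoc) simp_all
  also have "\<dots> = cell_comp X ?e id\<^sub>E [cell_comp X ?m id\<^sub>E [u, cell_id X ?p, cell_id X ?q]]"
    using t d uf rep_cell_comp_tight_cells2[OF u j t] join_ids[OF t] by (subst ext_mult_comp) simp_all
  also have "rep_cell X id\<^sub>E j \<star> (rep_cell X j id\<^sub>E \<star> ?e) = smile X j \<star> ?e"
    using t by (simp add: smile_eq mul_assoc)
  \<comment> \<open>Naturality exchanges the unitor of E(1, 1), hidden in the product, for the
    unitor of E(1, t) that occurs in \<open>xj_lam\<close>.\<close>
  also have "\<dots> = cell_comp X (cell_comp X (loose_unitor X I) id\<^sub>E [cell_id X I, ?e]) id\<^sub>E [smile X j, cell_id X ?q]"
    using t by (subst cell_assoc1[where \<phi>ss = "[[smile X j], [cell_id X ?q]]"]) (simp_all, simp add: mul_def)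
  also have "\<dots> = cell_comp X ?e id\<^sub>E [cell_comp X ?k id\<^sub>E [smile X j, cell_id X ?q]]"
  proof -
    have nat: "cell_comp X (loose_unitor X I) id\<^sub>E [cell_id X I, ?e] = cell_comp X ?e id\<^sub>E [?k]"
      using loose_unitor_natural[of ?e ?q "[]" I E] t by (simp add: ctx_def)
    show ?thesis
      unfolding nat using t by (subst comp_single) simp_all
  qed
  also have "cell_comp X ?e id\<^sub>E [cell_comp X ?m id\<^sub>E [u, cell_id X ?p, cell_id X ?q]] =
        cell_comp X ?e id\<^sub>E [cell_comp X ?k id\<^sub>E [smile X j, cell_id X ?q]] \<longleftrightarrow>
      cell_comp X ?m id\<^sub>E [u, cell_id X ?p, cell_id X ?q] = cell_comp X ?k id\<^sub>E [smile X j, cell_id X ?q]"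
    by (rule iff_by_rep_cell[symmetric]) (use t d uf in simp_all)
  also have "\<dots> \<longleftrightarrow> xj_comp X j ?m [Obj u, Obj (cell_id X ?q)] = xj_lam X j [Obj t] t 0 (cell_id X ?q)"
    using t d by (simp add: xj_comp_def xj_lam_def gcomp_def Let_def)
  finally show ?thesis .
qed

text \<open>The right unitor is given by a definite description, so its value must first be
  identified: the product of the multiplication with the unit \<open>u\<close> is factored through
  E(1, t), E(j, j). Pasting \<open>frown X j\<close> onto the factor \<open>Y\<close> then gives the
  monad law multiplied by \<open>\<epsilon>\<^sub>t\<close>.\<close>

lemma right_unit_law:
  assumes t: "t \<in> T" and d: "d \<in> exts t" and u: "u \<in> tight_cells2 X j t"
  shows "gcomp X d [gcomp X (rep_covariant X j j t u) [frown X j]] = frown X t \<longleftrightarrow>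
    xj_rho X j [Obj t] t 1 (xj_comp X j (ext_mult t d) [Obj (cell_id X (rep X id\<^sub>E t)), Obj u]) =
    cell_id X (rep X id\<^sub>E t)"
proof -
  let ?D = "ext_het t d" and ?m = "ext_mult t d" and ?e = "rep_cell X id\<^sub>E t"
    and ?p = "rep X j id\<^sub>E" and ?q = "rep X id\<^sub>E t" and ?v = "rep_covariant X j j t u"
  note v = rep_covariant_frame[OF u j t j]
    and df = exts_frame[OF t d] and uf = tight_cells2_frame[OF u j t]
  \<comment> \<open>The same formula as for the multiplication, with E(j, \<eta>) : E(j, j)
    \<Rightarrow> E(j, t) in place of \<open>join t\<close>. By \<open>rep_covariant_join\<close>,
    preceding it by \<open>join j\<close> amounts to applying \<open>u\<close> in the last
    entry.\<close>
  define Y where "Y = lift X ?e id\<^sub>E id\<^sub>A (?e \<star> cell_comp X ?D id\<^sub>A [?v])"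
  have Y: "Y \<in> cells X \<and> cell_dom X Y = [?q, rep X j j] \<and> cell_cod X Y = ?q \<and> cell_left X Y = id\<^sub>E \<and>
      cell_right X Y = id\<^sub>A \<and> cell_comp X ?e id\<^sub>E [Y] = ?e \<star> cell_comp X ?D id\<^sub>A [?v]"
    using lift_rep_cell[of "id\<^sub>E" t "?e \<star> cell_comp X ?D id\<^sub>A [?v]" "id\<^sub>E" "id\<^sub>A"] t d v by (simp add: Y_def)
  have Yc: "cell_comp X ?e id\<^sub>E [cell_comp X Y id\<^sub>E [cell_id X ?q, \<theta>]] = ?e \<star> cell_comp X ?D id\<^sub>A [cell_comp X ?v id\<^sub>A [\<theta>]]"
    if \<theta>: "\<theta> \<in> cells X" "cell_cod X \<theta> = rep X j j" "cell_left X \<theta> = id\<^sub>A" for \<theta>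
  proof -
    have "cell_comp X ?e id\<^sub>E [cell_comp X Y id\<^sub>E [cell_id X ?q, \<theta>]] =
        cell_comp X (cell_comp X ?e id\<^sub>E [Y]) id\<^sub>E [cell_id X ?q, \<theta>]"
      using t Y \<theta> by (subst comp_single) simp_all
    also have "\<dots> = cell_comp X (?e \<star> cell_comp X ?D id\<^sub>A [?v]) id\<^sub>E ([cell_id X ?q] @ [\<theta>])"
      using Y by simp
    also have "\<dots> = ?e \<star> cell_comp X (cell_comp X ?D id\<^sub>A [?v]) id\<^sub>A [\<theta>]"
      using t d v \<theta> by (subst mul_comp) simp_all
    also have "cell_comp X (cell_comp X ?D id\<^sub>A [?v]) id\<^sub>A [\<theta>] = cell_comp X ?D id\<^sub>A [cell_comp X ?v id\<^sub>A [\<theta>]]"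
      using t d v \<theta> by (subst comp_single) simp_all
    finally show ?thesis .
  qed
  have Yjoin: "cell_comp X Y id\<^sub>E [cell_id X ?q, join j] = cell_comp X ?m id\<^sub>E [cell_id X ?q, cell_id X ?p, u]"
  proof (rule rep_cancel[of "id\<^sub>E" t _ _ "id\<^sub>E"])
    have "cell_comp X ?e id\<^sub>E [cell_comp X Y id\<^sub>E [cell_id X ?q, join j]] =
        ?e \<star> cell_comp X ?D id\<^sub>A [cell_comp X (join t) id\<^sub>A [cell_id X ?p, u]]"
      unfolding rep_covariant_join[OF u j t, symmetric] by (rule Yc) simp_all
    also have "\<dots> = cell_comp X ?e id\<^sub>E [cell_comp X ?m id\<^sub>E [cell_id X ?q, cell_id X ?p, u]]"
      using t d uf by (subst ext_mult_comp) simp_all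
    finally show "cell_comp X ?e id\<^sub>E [cell_comp X Y id\<^sub>E [cell_id X ?q, join j]] = \<dots>" .
  qed (use t d Y uf in simp_all)
  have the: "(THE \<chi>. \<chi> \<in> globular X [?q, rep X j j] ?q \<and>
      gcomp X \<chi> [cell_id X ?q, join j] = cell_comp X ?m id\<^sub>E [cell_id X ?q, cell_id X ?p, u]) = Y"
  proof (rule the_equality)
    show "Y \<in> globular X [?q, rep X j j] ?q \<and>
      gcomp X Y [cell_id X ?q, join j] = cell_comp X ?m id\<^sub>E [cell_id X ?q, cell_id X ?p, u]"
      using Y Yjoin t by (simp add: globular_def gcomp_def)
  next
    fix \<chi> assume \<chi>: "\<chi> \<in> globular X [?q, rep X j j] ?q \<and>
      gcomp X \<chi> [cell_id X ?q, join j] = cell_comp X ?m id\<^sub>E [cell_id X ?q, cell_id X ?p, u]"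
    then have \<chi>': "\<chi> \<in> cells X" "cell_dom X \<chi> = [?q, rep X j j]" "cell_cod X \<chi> = ?q" "cell_left X \<chi> = id\<^sub>E"
      "cell_right X \<chi> = id\<^sub>A"
      using t by (simp_all add: globular_def)
    have eq: "cell_comp X \<chi> id\<^sub>E [cell_id X ?q, join j] = cell_comp X Y id\<^sub>E [cell_id X ?q, join j]"
      using \<chi> \<chi>' t Yjoin by (simp add: gcomp_def)
    \<comment> \<open>Uniqueness comes from the case \<open>t = j\<close> of
      \<open>join_opcartesian\<close>.\<close>
    show "\<chi> = Y"
      by (rule opcartesian_cancel[OF join_opcartesian[OF j], of _ _ "[?q]" "[]"]) (use t \<chi>' Y eq in \<open>simp_all add: ctx_def\<close>)
  qed
  \<comment> \<open>The marker stands after the only entry, so the context in \<open>xj_rho\<close>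
    consists of E(1, t) on the left and nothing on the right.\<close>
  have rho: "xj_rho X j [Obj t] t 1 (xj_comp X j ?m [Obj (cell_id X ?q), Obj u]) = cell_comp X Y id\<^sub>E [cell_id X ?q, frown X j]"
    using the t d Y by (simp add: xj_rho_def xj_comp_def xj_chain_def gcomp_def Let_def)
  have "gcomp X d [gcomp X ?v [frown X j]] = frown X t \<longleftrightarrow>
      cell_comp X d id\<^sub>A [cell_comp X ?v id\<^sub>A [frown X j]] = frown X t"
    using v df t by (simp add: gcomp_def)
  also have "\<dots> \<longleftrightarrow> cell_comp X (rep_cell X t t) id\<^sub>A [cell_comp X d id\<^sub>A [cell_comp X ?v id\<^sub>A [frown X j]]] =
      cell_comp X (rep_cell X t t) id\<^sub>A [frown X t]"
    by (rule iff_by_rep_cell) (use v t df in simp_all)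
  also have "cell_comp X (rep_cell X t t) id\<^sub>A [cell_comp X d id\<^sub>A [cell_comp X ?v id\<^sub>A [frown X j]]] =
      cell_comp X ?D id\<^sub>A [cell_comp X ?v id\<^sub>A [frown X j]]"
    using v t d by (subst ext_het_comp) simp_all
  also have "cell_comp X (rep_cell X t t) id\<^sub>A [frown X t] = one t"
    using t by simp
  also have "cell_comp X ?D id\<^sub>A [cell_comp X ?v id\<^sub>A [frown X j]] = one t \<longleftrightarrow>
      ?e \<star> cell_comp X ?D id\<^sub>A [cell_comp X ?v id\<^sub>A [frown X j]] = ?e \<star> one t"
    by (rule iff_by_yoneda) (use v t d in simp_all)
  also have "?e \<star> one t = cell_comp X ?e id\<^sub>E [cell_id X ?q]"
    using t by simp
  also have "?e \<star> cell_comp X ?D id\<^sub>A [cell_comp X ?v id\<^sub>A [frown X j]] =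
      cell_comp X ?e id\<^sub>E [cell_comp X Y id\<^sub>E [cell_id X ?q, frown X j]]"
    by (rule Yc[symmetric]) simp_all
  also have "\<dots> = cell_comp X ?e id\<^sub>E [cell_id X ?q] \<longleftrightarrow> cell_comp X Y id\<^sub>E [cell_id X ?q, frown X j] = cell_id X ?q"
    by (rule iff_by_rep_cell[symmetric]) (use t Y in simp_all)
  finally show ?thesis
    unfolding rho .
qed

text \<open>Over E(1, 1) the law equates \<open>?D \<star> ?D\<close> with \<open>?D\<close> applied
  to \<open>?N\<close>. Splitting both copies of E(j, t) and multiplying by
  \<open>\<epsilon>\<^sub>t\<close> turns the former into the multiplication nested in the first
  entry, the latter into the multiplication nested in the last one.\<close>

lemma assoc_law:
  assumes t: "t \<in> T" and d: "d \<in> exts t"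
  shows "gcomp X (smile_at X t t t) [d, d] = gcomp X d [gcomp X (smile_at X t j t) [cell_id X (rep X j t), d]] \<longleftrightarrow>
    xj_comp X j (ext_mult t d) [Obj (ext_mult t d), Obj (cell_id X (rep X id\<^sub>E t))] =
    xj_comp X j (ext_mult t d) [Obj (cell_id X (rep X id\<^sub>E t)), Obj (ext_mult t d)]"
proof -
  let ?D = "ext_het t d" and ?m = "ext_mult t d" and ?e = "rep_cell X id\<^sub>E t"
    and ?p = "rep X j id\<^sub>E" and ?q = "rep X id\<^sub>E t" and ?r = "rep X j t"
  let ?DJ = "cell_comp X ?D id\<^sub>A [join t]"
    and ?N = "cell_comp X (smile_at X t j t) id\<^sub>A [cell_id X ?r, d]"
    and ?J = "cell_comp X (join t) id\<^sub>A [cell_id X ?p, ?m]"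
  note df = exts_frame[OF t d]
  have DD: "cell_comp X (rep_cell X t t) id\<^sub>A [cell_comp X (smile_at X t t t) id\<^sub>A [d, d]] = ?D \<star> ?D"
  proof -
    have "cell_comp X (rep_cell X t t) id\<^sub>A [cell_comp X (smile_at X t t t) id\<^sub>A [d, d]] =
        cell_comp X (cell_comp X (rep_cell X t t) id\<^sub>A [smile_at X t t t]) id\<^sub>A [d, d]"
      using t df by (subst comp_single) simp_all
    also have "\<dots> = cell_comp X (rep_cell X t t \<star> rep_cell X t t) id\<^sub>A ([d] @ [d])"
      using t by simp
    also have "\<dots> = ?D \<star> ?D"
      using t df by (subst mul_comp) (simp_all add: ext_het_def)
    finally show ?thesis .
  qed
  have N: "cell_comp X (rep_cell X j t) id\<^sub>A [?N] = rep_cell X j t \<star> ?D"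
  proof -
    have "cell_comp X (rep_cell X j t) id\<^sub>A [?N] =
        cell_comp X (cell_comp X (rep_cell X j t) id\<^sub>A [smile_at X t j t]) id\<^sub>A [cell_id X ?r, d]"
      using t df by (subst comp_single) simp_all
    also have "\<dots> = cell_comp X (rep_cell X j t \<star> rep_cell X t t) id\<^sub>A ([cell_id X ?r] @ [d])"
      using t by simp
    also have "\<dots> = rep_cell X j t \<star> ?D"
      using t df by (subst mul_comp) (simp_all add: ext_het_def)
    finally show ?thesis .
  qed
  \<comment> \<open>Once split, the composition \<open>?N\<close> is \<open>join t\<close> with the
    multiplication in its second entry: over E(1, 1) the two are bracketings of one triple
    product.\<close>
  have NJ: "cell_comp X ?N id\<^sub>A [join t, join t] = ?J"
  proof (rule rep_cancel[of j t _ _ "id\<^sub>A"])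
    have "cell_comp X (rep_cell X j t) id\<^sub>A [cell_comp X ?N id\<^sub>A [join t, join t]] =
        cell_comp X (cell_comp X (rep_cell X j t) id\<^sub>A [?N]) id\<^sub>A [join t, join t]"
      using t df by (subst comp_single) simp_all
    also have "\<dots> = cell_comp X (rep_cell X j t \<star> ?D) id\<^sub>A ([join t] @ [join t])"
      unfolding N by simp
    also have "\<dots> = (rep_cell X j id\<^sub>E \<star> ?e) \<star> ?DJ"
      using t d by (subst mul_comp) simp_all
    also have "\<dots> = rep_cell X j id\<^sub>E \<star> (?e \<star> ?DJ)"
      using t d by (subst mul_assoc) simp_all
    also have "\<dots> = cell_comp X (rep_cell X j t) id\<^sub>A [?J]"
      using t d by (subst join_comp) simp_all
    finally show "cell_comp X (rep_cell X j t) id\<^sub>A [cell_comp X ?N id\<^sub>A [join t, join t]] = \<dots>" .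
  qed (use t d df in simp_all)
  have DJ: "cell_comp X (?D \<star> ?D) id\<^sub>A [join t, join t] = ?DJ \<star> ?DJ"
    using mul_comp[of ?D ?D "id\<^sub>A" "[join t]" "[join t]"] t d by simp
  have DNJ: "cell_comp X (cell_comp X ?D id\<^sub>A [?N]) id\<^sub>A [join t, join t] = cell_comp X ?D id\<^sub>A [?J]"
    using NJ t d df by (subst comp_single) simp_all
  have "gcomp X (smile_at X t t t) [d, d] = gcomp X d [gcomp X (smile_at X t j t) [cell_id X ?r, d]] \<longleftrightarrow>
      cell_comp X (smile_at X t t t) id\<^sub>A [d, d] = cell_comp X d id\<^sub>A [?N]"
    using t df by (simp add: gcomp_def)
  also have "\<dots> \<longleftrightarrow> cell_comp X (rep_cell X t t) id\<^sub>A [cell_comp X (smile_at X t t t) id\<^sub>A [d, d]] =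
      cell_comp X (rep_cell X t t) id\<^sub>A [cell_comp X d id\<^sub>A [?N]]"
    by (rule iff_by_rep_cell) (use t df in simp_all)
  also have "\<dots> \<longleftrightarrow> ?D \<star> ?D = cell_comp X ?D id\<^sub>A [?N]"
    unfolding DD using t d df by (subst ext_het_comp) simp_all
  also have "\<dots> \<longleftrightarrow> cell_comp X (?D \<star> ?D) id\<^sub>A [join t, join t] =
      cell_comp X (cell_comp X ?D id\<^sub>A [?N]) id\<^sub>A [join t, join t]"
    using join_join_cancel[OF t, of "?D \<star> ?D" "cell_comp X ?D id\<^sub>A [?N]" t t] t d df by (intro iffI) simp_all
  also have "\<dots> \<longleftrightarrow> ?e \<star> (?DJ \<star> ?DJ) = ?e \<star> cell_comp X ?D id\<^sub>A [?J]"
    unfolding DJ DNJ by (rule iff_by_yoneda) (use t d in simp_all)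
  also have "?e \<star> (?DJ \<star> ?DJ) = (?e \<star> ?DJ) \<star> ?DJ"
    using t d by (subst mul_assoc) simp_all
  also have "\<dots> = cell_comp X ?e id\<^sub>E [cell_comp X ?m id\<^sub>E [?m, cell_id X ?p, cell_id X ?q]]"
    using t d join_ids[OF t] by (subst ext_mult_comp) simp_all
  also have "?e \<star> cell_comp X ?D id\<^sub>A [?J] = cell_comp X ?e id\<^sub>E [cell_comp X ?m id\<^sub>E [cell_id X ?q, cell_id X ?p, ?m]]"
    using t d by (subst ext_mult_comp) simp_all
  also have "cell_comp X ?e id\<^sub>E [cell_comp X ?m id\<^sub>E [?m, cell_id X ?p, cell_id X ?q]] =
        cell_comp X ?e id\<^sub>E [cell_comp X ?m id\<^sub>E [cell_id X ?q, cell_id X ?p, ?m]] \<longleftrightarrow>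
      cell_comp X ?m id\<^sub>E [?m, cell_id X ?p, cell_id X ?q] = cell_comp X ?m id\<^sub>E [cell_id X ?q, cell_id X ?p, ?m]"
    by (rule iff_by_rep_cell[symmetric]) (use t d in simp_all)
  finally show ?thesis
    using t d by (simp add: xj_comp_def gcomp_def)
qed

text \<open>Over E(1, 1) the law reads \<open>?D \<star> ?\<tau> = ?\<tau> \<star> ?DV\<close>.
  Multiplication by \<open>?e\<close> lets \<open>?\<tau>\<close> act after \<open>?m\<close> on the
  left-hand side and in the first entry of \<open>?m'\<close> on the right-hand side; the \<tau> in
  the last entry comes from \<open>?v\<close> through \<open>rep_covariant_join\<close>.\<close>

lemma hom_law:
  assumes t: "t \<in> T" "t' \<in> T" and d: "d \<in> exts t" "d' \<in> exts t'" and \<tau>: "\<tau> \<in> tight_cells2 X t t'"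
  shows "gcomp X (rep_covariant X t t t' \<tau>) [d] =
      gcomp X (rep_contravariant X t t' \<tau> t') [gcomp X d' [rep_covariant X j t t' \<tau>]] \<longleftrightarrow>
    xj_comp X j \<tau> [Obj (ext_mult t d)] = xj_comp X j (ext_mult t' d') [Obj \<tau>, Obj \<tau>]"
proof -
  let ?D = "ext_het t d" and ?D' = "ext_het t' d'" and ?m = "ext_mult t d" and ?m' = "ext_mult t' d'"
    and ?e = "rep_cell X id\<^sub>E t" and ?e' = "rep_cell X id\<^sub>E t'" and ?p = "rep X j id\<^sub>E"
    and ?\<tau> = "point t t' \<tau>" and ?v = "rep_covariant X j t t' \<tau>" and ?w = "rep_covariant X t t t' \<tau>"
    and ?c = "rep_contravariant X t t' \<tau> t'"
  let ?DJ = "cell_comp X ?D id\<^sub>A [join t]" and ?DV = "cell_comp X ?D' id\<^sub>A [?v]"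
    and ?J = "cell_comp X (join t') id\<^sub>A [cell_id X ?p, \<tau>]"
  note v = rep_covariant_frame[OF \<tau> t j] and w = rep_covariant_frame[OF \<tau> t t(1)]
    and c = rep_contravariant_frame[OF \<tau> t t(2)] and pt = point_frame[OF \<tau> t]
    and df = exts_frame[OF t(1) d(1)] exts_frame[OF t(2) d(2)] and \<tau>f = tight_cells2_frame[OF \<tau> t]
  have l: "cell_comp X (rep_cell X t t') id\<^sub>A [cell_comp X ?w id\<^sub>A [d]] = ?D \<star> ?\<tau>"
  proof -
    have "cell_comp X (rep_cell X t t') id\<^sub>A [cell_comp X ?w id\<^sub>A [d]] =
        cell_comp X (cell_comp X (rep_cell X t t') id\<^sub>A [?w]) id\<^sub>A [d]"
      using t w df by (subst comp_single) simp_all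
    also have "\<dots> = cell_comp X (rep_cell X t t \<star> ?\<tau>) id\<^sub>A [d]"
      using w by simp
    also have "\<dots> = ?D \<star> ?\<tau>"
      unfolding ext_het_def by (rule mul_point_comp[OF \<tau> t]) (use t df in simp_all)
    finally show ?thesis .
  qed
  have r: "cell_comp X (rep_cell X t t') id\<^sub>A [cell_comp X ?c id\<^sub>A [cell_comp X d' id\<^sub>A [?v]]] = ?\<tau> \<star> ?DV"
  proof -
    have "cell_comp X (rep_cell X t t') id\<^sub>A [cell_comp X ?c id\<^sub>A [cell_comp X d' id\<^sub>A [?v]]] =
        cell_comp X (cell_comp X (rep_cell X t t') id\<^sub>A [?c]) id\<^sub>A [cell_comp X d' id\<^sub>A [?v]]"
      using t v c df by (subst comp_single) simp_all
    also have "\<dots> = cell_comp X (?\<tau> \<star> rep_cell X t' t') id\<^sub>A [cell_comp X d' id\<^sub>A [?v]]"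
      using c by simp
    also have "\<dots> = ?\<tau> \<star> cell_comp X (rep_cell X t' t') id\<^sub>A [cell_comp X d' id\<^sub>A [?v]]"
      by (rule point_mul_comp[OF \<tau> t]) (use t v df in simp_all)
    also have "\<dots> = ?\<tau> \<star> ?DV"
      using t d v by (subst ext_het_comp) simp_all
    finally show ?thesis .
  qed
  have DVJ: "cell_comp X ?DV id\<^sub>A [join t] = cell_comp X ?D' id\<^sub>A [?J]"
    unfolding rep_covariant_join[OF \<tau> t, symmetric] using t d v by (subst comp_single) simp_all
  have "gcomp X ?w [d] = gcomp X ?c [gcomp X d' [?v]] \<longleftrightarrow>
      cell_comp X ?w id\<^sub>A [d] = cell_comp X ?c id\<^sub>A [cell_comp X d' id\<^sub>A [?v]]"
    using t w c df by (simp add: gcomp_def)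
  also have "\<dots> \<longleftrightarrow> cell_comp X (rep_cell X t t') id\<^sub>A [cell_comp X ?w id\<^sub>A [d]] =
      cell_comp X (rep_cell X t t') id\<^sub>A [cell_comp X ?c id\<^sub>A [cell_comp X d' id\<^sub>A [?v]]]"
    by (rule iff_by_rep_cell) (use t v w c df in simp_all)
  also have "\<dots> \<longleftrightarrow> ?D \<star> ?\<tau> = ?\<tau> \<star> ?DV"
    unfolding l r ..
  also have "\<dots> \<longleftrightarrow> cell_comp X (?D \<star> ?\<tau>) id\<^sub>A [join t] = cell_comp X (?\<tau> \<star> ?DV) id\<^sub>A [join t]"
    by (rule iff_by_join[of t _ _ t]) (use t d v pt in simp_all)
  also have "cell_comp X (?D \<star> ?\<tau>) id\<^sub>A [join t] = ?DJ \<star> ?\<tau>"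
    by (rule mul_point_comp[OF \<tau> t]) (use t d in simp_all)
  also have "cell_comp X (?\<tau> \<star> ?DV) id\<^sub>A [join t] = ?\<tau> \<star> cell_comp X ?D' id\<^sub>A [?J]"
    unfolding DVJ[symmetric] by (rule point_mul_comp[OF \<tau> t]) (use t d v in simp_all)
  also have "?DJ \<star> ?\<tau> = ?\<tau> \<star> cell_comp X ?D' id\<^sub>A [?J] \<longleftrightarrow>
      ?e \<star> (?DJ \<star> ?\<tau>) = ?e \<star> (?\<tau> \<star> cell_comp X ?D' id\<^sub>A [?J])"
    by (rule iff_by_yoneda) (use t d \<tau>f pt in simp_all)
  also have "?e \<star> (?DJ \<star> ?\<tau>) = (?e \<star> ?DJ) \<star> ?\<tau>"
    using t d pt by (subst mul_assoc) simp_all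
  also have "\<dots> = cell_comp X (?e \<star> ?\<tau>) id\<^sub>E [?m]"
    using t d by (subst mul_point_comp[OF \<tau> t]) simp_all
  also have "\<dots> = cell_comp X (cell_comp X ?e' id\<^sub>E [\<tau>]) id\<^sub>E [?m]"
    unfolding rep_cell_comp_tight_cells2[OF \<tau> t] ..
  also have "\<dots> = cell_comp X ?e' id\<^sub>E [cell_comp X \<tau> id\<^sub>E [?m]]"
    using t d \<tau>f by (subst comp_single) simp_all
  also have "?e \<star> (?\<tau> \<star> cell_comp X ?D' id\<^sub>A [?J]) = (?e \<star> ?\<tau>) \<star> cell_comp X ?D' id\<^sub>A [?J]"
    using t d pt \<tau>f by (subst mul_assoc) simp_all
  also have "\<dots> = cell_comp X ?e' id\<^sub>E [cell_comp X ?m' id\<^sub>E [\<tau>, cell_id X ?p, \<tau>]]"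
    unfolding rep_cell_comp_tight_cells2[OF \<tau> t, symmetric] using t d \<tau>f by (subst ext_mult_comp) simp_all
  also have "cell_comp X ?e' id\<^sub>E [cell_comp X \<tau> id\<^sub>E [?m]] =
        cell_comp X ?e' id\<^sub>E [cell_comp X ?m' id\<^sub>E [\<tau>, cell_id X ?p, \<tau>]] \<longleftrightarrow>
      cell_comp X \<tau> id\<^sub>E [?m] = cell_comp X ?m' id\<^sub>E [\<tau>, cell_id X ?p, \<tau>]"
    by (rule iff_by_rep_cell[symmetric]) (use t d \<tau>f in simp_all)
  finally show ?thesis
    using t d \<tau>f by (simp add: xj_comp_def gcomp_def)
qed

section \<open>The isomorphism of categories over X[A, E]\<close>

lemma tight_cells2_comp:
  assumes "\<alpha> \<in> tight_cells2 X f g" "\<beta> \<in> tight_cells2 X g h" "f \<in> T" "g \<in> T" "h \<in> T"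
  shows "gcomp X \<beta> [\<alpha>] \<in> tight_cells2 X f h"
  using tight_cells2_frame[of \<alpha> f g] tight_cells2_frame[of \<beta> g h] assms
  by (simp add: tight_cells2_iff gcomp_def)

lemma is_category_tight_cat: "is_category (tight_cat X A E)"
proof (unfold_locales, goal_cases)
  case (1 f)
  then show ?case by (simp add: tight_cat_def tight_cells2_iff)
next
  case (2 f g h \<alpha> \<beta>)
  then show ?case by (simp add: tight_cat_def tight_cells2_comp)
next
  case (3 f g \<alpha>)
  then show ?case
    using tight_cells2_frame[of \<alpha> f g] by (simp add: tight_cat_def gcomp_def)
next
  case (4 f g \<alpha>)
  then show ?case
    using tight_cells2_frame[of \<alpha> f g] by (simp add: tight_cat_def gcomp_def)
next
  case (5 f g h k \<alpha> \<beta> \<gamma>)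
  then have T: "f \<in> T" "g \<in> T" "h \<in> T" "k \<in> T"
    and cells: "\<alpha> \<in> tight_cells2 X f g" "\<beta> \<in> tight_cells2 X g h" "\<gamma> \<in> tight_cells2 X h k"
    by (simp_all add: tight_cat_def)
  have "gcomp X (gcomp X \<gamma> [\<beta>]) [\<alpha>] = cell_comp X (cell_comp X \<gamma> id\<^sub>E [\<beta>]) id\<^sub>E [\<alpha>]"
    using T tight_cells2_frame[OF cells(2)] tight_cells2_frame[OF cells(3)] by (simp add: gcomp_def)
  also have "\<dots> = cell_comp X \<gamma> id\<^sub>E [cell_comp X \<beta> id\<^sub>E [\<alpha>]]"
    using T tight_cells2_frame[OF cells(1)] tight_cells2_frame[OF cells(2)] tight_cells2_frame[OF cells(3)]
    by (subst comp_single) simp_all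
  also have "\<dots> = gcomp X \<gamma> [gcomp X \<beta> [\<alpha>]]"
    using T tight_cells2_frame[OF cells(2)] tight_cells2_frame[OF cells(3)] by (simp add: gcomp_def)
  finally show ?case by (simp add: tight_cat_def)
qed

lemma XJ_sel: "sk_id (XJ X j) = (\<lambda>t. cell_id X (companion X t))" "sk_comp (XJ X j) = xj_comp X j"
  by (simp_all add: XJ_def)

lemma xj_hom_unary: "\<lbrakk>t \<in> T; t' \<in> T\<rbrakk> \<Longrightarrow> sk_hom (XJ X j) [Obj t] t' = tight_cells2 X t t'"
  by (simp add: XJ_def xj_hom_def xj_chain_def tight_cells2_def)

lemma xj_hom_bullet: "t \<in> T \<Longrightarrow> sk_hom (XJ X j) [\<bullet>] t = tight_cells2 X j t"
  by (simp add: XJ_def xj_hom_def xj_chain_def tight_cells2_def)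

lemma xj_hom_binary: "t \<in> T \<Longrightarrow> sk_hom (XJ X j) [Obj t, Obj t] t = mults t"
  by (simp add: XJ_def xj_hom_def xj_chain_def mults_def)

definition to_monoid :: "('b, 'd) rel_monad \<Rightarrow> ('b, 'd) monoid_obj" where
  "to_monoid R = \<lparr>mon_carrier = rm_cell R, mon_mult = ext_mult (rm_cell R) (rm_ext R), mon_unit = rm_unit R\<rparr>"

text \<open>By \<open>bij_ext_mult\<close>, the chosen preimage is the only one in
  \<open>exts t\<close> whenever the multiplication lies in \<open>mults t\<close>.\<close>

definition of_monoid :: "('b, 'd) monoid_obj \<Rightarrow> ('b, 'd) rel_monad" where
  "of_monoid Q = (let t = mon_carrier Q in
    \<lparr>rm_cell = t, rm_ext = inv_into (exts t) (ext_mult t) (mon_mult Q), rm_unit = mon_unit Q\<rparr>)"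

lemma rm_cell_of_monoid: "rm_cell (of_monoid Q) = mon_carrier Q"
  by (simp add: of_monoid_def Let_def)

lemma is_monoid_iff:
  "is_monoid (XJ X j) Q \<longleftrightarrow> (let t = mon_carrier Q; m = mon_mult Q; u = mon_unit Q; e = cell_id X (rep X id\<^sub>E t) in
     t \<in> T \<and> m \<in> mults t \<and> u \<in> tight_cells2 X j t \<and>
     xj_comp X j m [Obj u, Obj e] = xj_lam X j [Obj t] t 0 e \<and>
     xj_rho X j [Obj t] t 1 (xj_comp X j m [Obj e, Obj u]) = e \<and>
     xj_comp X j m [Obj m, Obj e] = xj_comp X j m [Obj e, Obj m])"
proof (cases "mon_carrier Q \<in> T")
  case True
  then show ?thesis
    using xj_hom_binary[OF True] xj_hom_bullet[OF True] by (simp add: is_monoid_def XJ_def Let_def)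
next
  case False
  then show ?thesis by (simp add: is_monoid_def XJ_def Let_def)
qed

text \<open>The frame of the extension operator is a separate conjunct because
  \<open>ext_mult\<close> is a total function: the monoid only sees its value, which says nothing
  about an argument outside \<open>exts\<close>.\<close>

lemma relative_monad_iff:
  "relative_monad X j R \<longleftrightarrow> rm_ext R \<in> exts (rm_cell R) \<and> is_monoid (XJ X j) (to_monoid R)"
proof (cases "rm_cell R \<in> T \<and> rm_ext R \<in> exts (rm_cell R) \<and> rm_unit R \<in> tight_cells2 X j (rm_cell R)")
  case True
  then have "ext_mult (rm_cell R) (rm_ext R) \<in> mults (rm_cell R)"
    using bij_ext_mult bij_betwE by metis
  then show ?thesis
    using True left_unit_law[of "rm_cell R" "rm_ext R" "rm_unit R"] right_unit_law[of "rm_cell R" "rm_ext R" "rm_unit R"]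
      assoc_law[of "rm_cell R" "rm_ext R"]
    by (simp add: is_monoid_iff relative_monad_def to_monoid_def Let_def exts_def[symmetric])
next
  case False
  then show ?thesis
    by (auto simp: is_monoid_iff relative_monad_def to_monoid_def Let_def exts_def[symmetric])
qed

lemma relative_monadD:
  "relative_monad X j R \<Longrightarrow> rm_cell R \<in> T \<and> rm_ext R \<in> exts (rm_cell R) \<and> rm_unit R \<in> tight_cells2 X j (rm_cell R)"
  by (auto simp: relative_monad_def Let_def exts_def)

lemma to_monoid_of_monoid:
  assumes "is_monoid (XJ X j) Q"
  shows "to_monoid (of_monoid Q) = Q" and "relative_monad X j (of_monoid Q)"
proof -
  let ?t = "mon_carrier Q"
  have t: "?t \<in> T" and m: "mon_mult Q \<in> mults ?t"
    using assms by (simp_all add: is_monoid_iff Let_def)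
  show 1: "to_monoid (of_monoid Q) = Q"
    using bij_betw_inv_into_right[OF bij_ext_mult[OF t] m] by (simp add: to_monoid_def of_monoid_def Let_def)
  have "rm_ext (of_monoid Q) \<in> exts ?t"
    using bij_betw_inv_into[OF bij_ext_mult[OF t]] m by (auto simp: of_monoid_def Let_def dest: bij_betwE)
  then show "relative_monad X j (of_monoid Q)"
    using assms 1 by (simp add: relative_monad_iff) (simp add: of_monoid_def Let_def)
qed

lemma of_monoid_to_monoid:
  assumes "relative_monad X j R"
  shows "of_monoid (to_monoid R) = R"
  using relative_monadD[OF assms] bij_betw_inv_into_left[OF bij_ext_mult, of "rm_cell R" "rm_ext R"]
  by (simp add: to_monoid_def of_monoid_def Let_def)

text \<open>Since the hom-sets coincide as sets, both functors can leave morphisms untouched, and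
  only objects need an inverse construction.\<close>

lemma relative_monad_hom_eq:
  assumes R: "relative_monad X j R" "relative_monad X j R'"
  shows "relative_monad_hom X j R R' = monoid_hom (XJ X j) (to_monoid R) (to_monoid R')"
proof -
  note f = relative_monadD[OF R(1)] relative_monadD[OF R(2)]
  have u: "gcomp X \<tau> [rm_unit R] = xj_comp X j \<tau> [Obj (rm_unit R)]" for \<tau>
    by (simp add: xj_comp_def)
  show ?thesis
    using hom_law[of "rm_cell R" "rm_cell R'" "rm_ext R" "rm_ext R'"] f xj_hom_unary[of "rm_cell R" "rm_cell R'"]
    by (auto simp: relative_monad_hom_def monoid_hom_def to_monoid_def Let_def u) (simp_all add: XJ_def)
qed

lemma mults_frame:
  "\<lbrakk>t \<in> T; m \<in> mults t\<rbrakk> \<Longrightarrow> m \<in> cells X \<and> cell_dom X m = [rep X id\<^sub>E t, rep X j id\<^sub>E, rep X id\<^sub>E t] \<and>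
    cell_cod X m = rep X id\<^sub>E t \<and> cell_left X m = id\<^sub>E \<and> cell_right X m = id\<^sub>A"
  by (simp add: mults_def globular_def)

lemma monoidD:
  "is_monoid (XJ X j) Q \<Longrightarrow>
    mon_carrier Q \<in> T \<and> mon_mult Q \<in> mults (mon_carrier Q) \<and> mon_unit Q \<in> tight_cells2 X j (mon_carrier Q)"
  by (simp add: is_monoid_iff Let_def)

lemma monoid_hom_iff:
  assumes "is_monoid (XJ X j) Q" "is_monoid (XJ X j) Q'"
  shows "f \<in> monoid_hom (XJ X j) Q Q' \<longleftrightarrow> f \<in> tight_cells2 X (mon_carrier Q) (mon_carrier Q') \<and>
    cell_comp X f id\<^sub>E [mon_unit Q] = mon_unit Q' \<and>
    cell_comp X f id\<^sub>E [mon_mult Q] = cell_comp X (mon_mult Q') id\<^sub>E [f, cell_id X (rep X j id\<^sub>E), f]"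
proof -
  note Q = monoidD[OF assms(1)] monoidD[OF assms(2)]
  have "xj_comp X j f [Obj x] = cell_comp X f id\<^sub>E [x]" if "f \<in> tight_cells2 X (mon_carrier Q) (mon_carrier Q')" for x
    using tight_cells2_frame[OF that] Q by (simp add: xj_comp_def gcomp_def)
  moreover have "xj_comp X j (mon_mult Q') [Obj f, Obj f] = cell_comp X (mon_mult Q') id\<^sub>E [f, cell_id X (rep X j id\<^sub>E), f]"
    using mults_frame[of "mon_carrier Q'" "mon_mult Q'"] Q by (simp add: xj_comp_def gcomp_def)
  ultimately show ?thesis
    using Q xj_hom_unary[of "mon_carrier Q" "mon_carrier Q'"] by (auto simp: monoid_hom_def Let_def) (simp_all add: XJ_def)
qed

lemma monoid_hom_id:
  assumes Q: "is_monoid (XJ X j) Q"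
  shows "cell_id X (rep X id\<^sub>E (mon_carrier Q)) \<in> monoid_hom (XJ X j) Q Q"
proof -
  let ?t = "mon_carrier Q"
  note f = monoidD[OF Q]
  note m = mults_frame[of ?t "mon_mult Q"] and u = tight_cells2_frame[of "mon_unit Q" j ?t]
  have "cell_comp X (mon_mult Q) id\<^sub>E (map (cell_id X) [rep X id\<^sub>E ?t, rep X j id\<^sub>E, rep X id\<^sub>E ?t]) = mon_mult Q"
    using m f cell_comp_id[of "mon_mult Q"] by simp
  then show ?thesis
    using f m u by (simp add: monoid_hom_iff[OF Q Q] tight_cells2_iff)
qed

lemma monoid_hom_comp:
  assumes Q: "is_monoid (XJ X j) Q" "is_monoid (XJ X j) Q'" "is_monoid (XJ X j) Q''"
    and f: "f \<in> monoid_hom (XJ X j) Q Q'" and g: "g \<in> monoid_hom (XJ X j) Q' Q''"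
  shows "gcomp X g [f] \<in> monoid_hom (XJ X j) Q Q''"
proof -
  let ?t = "mon_carrier Q" and ?t' = "mon_carrier Q'" and ?t'' = "mon_carrier Q''"
  let ?m = "mon_mult Q" and ?m' = "mon_mult Q'" and ?m'' = "mon_mult Q''" and ?p = "cell_id X (rep X j id\<^sub>E)"
  have T: "?t \<in> T" "?t' \<in> T" "?t'' \<in> T"
    using Q by (simp_all add: monoidD)
  have cells: "f \<in> tight_cells2 X ?t ?t'" "g \<in> tight_cells2 X ?t' ?t''"
    using f g Q by (simp_all add: monoid_hom_iff)
  have M: "?m \<in> mults ?t" "?m' \<in> mults ?t'" "?m'' \<in> mults ?t''" "mon_unit Q \<in> tight_cells2 X j ?t"
    using Q by (simp_all add: monoidD)
  note fr = tight_cells2_frame[OF cells(1) T(1,2)] tight_cells2_frame[OF cells(2) T(2,3)]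
    mults_frame[OF T(1) M(1)] mults_frame[OF T(2) M(2)] mults_frame[OF T(3) M(3)]
    tight_cells2_frame[OF M(4) j T(1)]
  have gf: "gcomp X g [f] = cell_comp X g id\<^sub>E [f]"
    using fr T by (simp add: gcomp_def)
  have "cell_comp X (cell_comp X g id\<^sub>E [f]) id\<^sub>E [mon_unit Q] = cell_comp X g id\<^sub>E [cell_comp X f id\<^sub>E [mon_unit Q]]"
    using fr T by (subst comp_single) simp_all
  also have "\<dots> = mon_unit Q''"
    using f g Q by (simp add: monoid_hom_iff)
  finally have unit: "cell_comp X (cell_comp X g id\<^sub>E [f]) id\<^sub>E [mon_unit Q] = mon_unit Q''" .
  have "cell_comp X (cell_comp X g id\<^sub>E [f]) id\<^sub>E [?m] = cell_comp X g id\<^sub>E [cell_comp X f id\<^sub>E [?m]]"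
    using fr T by (subst comp_single) simp_all
  also have "cell_comp X f id\<^sub>E [?m] = cell_comp X ?m' id\<^sub>E [f, ?p, f]"
    using f Q by (simp add: monoid_hom_iff)
  also have "cell_comp X g id\<^sub>E [cell_comp X ?m' id\<^sub>E [f, ?p, f]] = cell_comp X (cell_comp X g id\<^sub>E [?m']) id\<^sub>E [f, ?p, f]"
    using fr T by (subst comp_single) simp_all
  also have "cell_comp X g id\<^sub>E [?m'] = cell_comp X ?m'' id\<^sub>E [g, ?p, g]"
    using g Q by (simp add: monoid_hom_iff)
  \<comment> \<open>The identity of E(j, 1) between the two arguments forms a block of its own and
    composes to itself.\<close>
  also have "cell_comp X (cell_comp X ?m'' id\<^sub>E [g, ?p, g]) id\<^sub>E [f, ?p, f] =
      cell_comp X ?m'' id\<^sub>E [cell_comp X g id\<^sub>E [f], ?p, cell_comp X g id\<^sub>E [f]]"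
    using fr T by (subst cell_assoc1[where \<phi>ss = "[[f], [?p], [f]]"]) simp_all
  finally show ?thesis
    using tight_cells2_comp[OF cells T] unit by (simp add: monoid_hom_iff[OF Q(1,3)] gf)
qed

text \<open>Being a functor includes that the source is a category. The laws of \<open>Mon\<close>
  are pulled back from X[A, E] along the carrier, leaving only identities and closure under
  composition to be checked.\<close>

lemma is_functor_U_Mon: "is_functor (Mon (XJ X j)) (tight_cat X A E) U_Mon"
  unfolding U_Mon_def
proof (rule is_functor_inclusion[OF is_category_tight_cat], goal_cases)
  case (2 Q Q')
  then show ?case by (auto simp: Mon_def tight_cat_def monoid_hom_iff)
next
  case (5 Q)
  then show ?case
    using monoidD[of Q] monoid_hom_id[of Q] by (simp add: Mon_def XJ_sel)
next
  case (6 Q Q' Q'' f g)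
  then show ?case
    using monoid_hom_comp[of Q Q' Q'' f g] by (simp add: Mon_def XJ_sel xj_comp_def)
qed (auto simp: Mon_def tight_cat_def monoidD XJ_sel xj_comp_def fun_eq_iff)

text \<open>In the same way, \<open>RMnd\<close> becomes a category by pulling back the laws of
  \<open>Mon\<close>.\<close>

lemma is_functor_to_monoid:
  "is_functor (RMnd X j) (Mon (XJ X j)) \<lparr>fun_ob = to_monoid, fun_hom = (\<lambda>R R' \<tau>. \<tau>)\<rparr>"
proof -
  interpret M: is_category "Mon (XJ X j)"
    using is_functor_U_Mon by (simp add: is_functor_def)
  have ob: "to_monoid R \<in> cat_ob (Mon (XJ X j))" if "R \<in> cat_ob (RMnd X j)" for R
    using that by (simp add: RMnd_def Mon_def relative_monad_iff)
  have hom: "cat_hom (RMnd X j) R R' = cat_hom (Mon (XJ X j)) (to_monoid R) (to_monoid R')"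
    if "R \<in> cat_ob (RMnd X j)" "R' \<in> cat_ob (RMnd X j)" for R R'
    using that by (simp add: RMnd_def Mon_def relative_monad_hom_eq)
  have id: "cat_id (RMnd X j) R = cat_id (Mon (XJ X j)) (to_monoid R)" for R
    by (simp add: RMnd_def Mon_def XJ_sel to_monoid_def)
  have comp: "cat_comp (RMnd X j) = cat_comp (Mon (XJ X j))"
    by (simp add: RMnd_def Mon_def XJ_sel xj_comp_def fun_eq_iff)
  show ?thesis
  proof (rule is_functor_inclusion, goal_cases)
    case (7 R R' R'' \<sigma> \<tau>)
    then show ?case
      using M.comp_in_hom[of "to_monoid R" "to_monoid R'" "to_monoid R''" \<sigma> \<tau>] by (simp add: ob hom comp)
  qed (use M.is_category_axioms ob hom id comp M.id_in_hom in simp_all)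
qed

lemma is_functor_of_monoid:
  "is_functor (Mon (XJ X j)) (RMnd X j) \<lparr>fun_ob = of_monoid, fun_hom = (\<lambda>Q Q' f. f)\<rparr>"
proof -
  interpret F: is_functor "RMnd X j" "Mon (XJ X j)" "\<lparr>fun_ob = to_monoid, fun_hom = (\<lambda>R R' \<tau>. \<tau>)\<rparr>"
    by (rule is_functor_to_monoid)
  have comp: "cat_comp (RMnd X j) = cat_comp (Mon (XJ X j))"
    by (simp add: RMnd_def Mon_def XJ_sel xj_comp_def fun_eq_iff)
  show ?thesis
  proof (rule is_functor_inclusion, goal_cases)
    case 1
    show ?case by unfold_locales
  next
    case (3 Q Q')
    then show ?case
      using relative_monad_hom_eq[of "of_monoid Q" "of_monoid Q'"] by (simp add: RMnd_def Mon_def to_monoid_of_monoid)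
  next
    case (6 Q)
    then show ?case by (rule F.D.id_in_hom)
  next
    case (7 Q Q' Q'' f g)
    then show ?case by (rule F.D.comp_in_hom)
  qed (use comp in \<open>simp_all add: RMnd_def Mon_def XJ_sel to_monoid_of_monoid rm_cell_of_monoid\<close>)
qed

lemma category_iso_to_monoid:
  "category_iso (RMnd X j) (Mon (XJ X j)) \<lparr>fun_ob = to_monoid, fun_hom = (\<lambda>R R' \<tau>. \<tau>)\<rparr>"
proof -
  let ?F = "\<lparr>fun_ob = to_monoid, fun_hom = (\<lambda>R R' \<tau>. \<tau>)\<rparr> :: (('b, 'd) rel_monad, 'd, ('b, 'd) monoid_obj, 'd) functor_data"
  let ?G = "\<lparr>fun_ob = of_monoid, fun_hom = (\<lambda>Q Q' f. f)\<rparr> :: (('b, 'd) monoid_obj, 'd, ('b, 'd) rel_monad, 'd) functor_data"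
  have "functor_eq (RMnd X j) (RMnd X j) (functor_comp ?G ?F) functor_id"
    unfolding functor_eq_def
    using is_functor_comp[OF is_functor_to_monoid is_functor_of_monoid] is_functor_functor_id[of "RMnd X j"]
      is_functor_to_monoid of_monoid_to_monoid
    by (simp add: functor_comp_def functor_id_def is_functor_def RMnd_def)
  moreover have "functor_eq (Mon (XJ X j)) (Mon (XJ X j)) (functor_comp ?F ?G) functor_id"
    unfolding functor_eq_def
    using is_functor_comp[OF is_functor_of_monoid is_functor_to_monoid] is_functor_functor_id[of "Mon (XJ X j)"]
      is_functor_to_monoid to_monoid_of_monoid(1)
    by (simp add: functor_comp_def functor_id_def is_functor_def Mon_def)
  ultimately show ?thesis
    unfolding category_iso_def using is_functor_to_monoid is_functor_of_monoid by blast
qed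

text \<open>\<open>to_monoid\<close> keeps the carrier and morphisms are untouched, so the two
  functors are even equal as records.\<close>

lemma functor_eq_forgetful:
  "functor_eq (RMnd X j) (tight_cat X A E)
    (functor_comp U_Mon \<lparr>fun_ob = to_monoid, fun_hom = (\<lambda>R R' \<tau>. \<tau>)\<rparr>) U_RMnd"
proof -
  have "functor_comp U_Mon \<lparr>fun_ob = to_monoid, fun_hom = (\<lambda>R R' \<tau>. \<tau>)\<rparr> = U_RMnd"
    by (simp add: functor_comp_def U_Mon_def U_RMnd_def to_monoid_def)
  then show ?thesis
    using is_functor_comp[OF is_functor_to_monoid is_functor_U_Mon] by (simp add: functor_eq_def)
qed

end

theorem theorem4p16:
  fixes X :: "('o, 't, 'l, 'c) vequip" and A E :: 'o and j :: 't
  assumes "virtual_equipment X"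
    and "j \<in> tight_hom X A E"
  shows "\<exists>F. category_iso (RMnd X j) (Mon (XJ X j)) F \<and>
    functor_eq (RMnd X j) (tight_cat X A E) (functor_comp U_Mon F) U_RMnd"
proof -
  interpret virtual_equipment X by (rule assms(1))
  have "j \<in> tight X" "tight_dom X j = A" "tight_cod X j = E"
    using assms(2) by (simp_all add: tight_hom_def)
  then interpret rooted_equipment X E A j
    using assms(2) by unfold_locales auto
  show ?thesis
    using category_iso_to_monoid functor_eq_forgetful by blast
qed

end
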